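(* Let $(M,g)$ be a time-oriented Lorentz manifold and let $H\subset M$ be a horizon. Then for every $p\in H$ there are an open neighbourhood $U\subset M$ of $p$ diffeomorphic to an open ball, a set $S\subset U$ that is achronal in the time-oriented Lorentz manifold $(U,g|_U)$, and an open neighbourhood $U_p\subset U$ of $p$ such that $$H\cap U_p=H^{+}(S)\cap U_p,$$ where $H^{+}(S)$ is the future Cauchy horizon of $S$ in $(U,g|_U)$.
   Context: Horizon: a subset $H\subset M$ of a time-oriented Lorentz manifold $(M,g)$ is a horizon if (i) it is a topological hypersurface; (ii) it is achronal (no two points of $H$ are chronologically related); (iii) for every $p\in H$ there is a past inextendable, past directed, light-like geodesic $\gamma:[0,a)\to H$ with $\gamma(0)=p$. Cauchy horizon: for an achronal subset $S$ of a time-oriented Lorentz manifold $(N,h)$, the future Cauchy development of $S$ is $$D^{+}(S)=\{z\in N \mid \text{every past directed, (past) inextendable causal curve of } N \text{ from } z \text{ intersects } S\},$$ and the future Cauchy horizon of $S$ is $H^{+}(S)=\partial D^{+}(S)\setminus\overline{S}$, with boundary and closure taken in $N$. In the claim these are taken with $(N,h)=(U,g|_U)$. *)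

theory Defs
  imports "HOL-Analysis.Analysis"
begin

section \<open>Smooth maps between open subsets of normed spaces\<close>

primrec Ck_on ::
  "nat \<Rightarrow> 'a::real_normed_vector set \<Rightarrow> ('a \<Rightarrow> 'b::real_normed_vector) \<Rightarrow> bool" where
  "Ck_on 0 S f \<longleftrightarrow> continuous_on S f"
| "Ck_on (Suc k) S f \<longleftrightarrow>
     (\<forall>x\<in>S. f differentiable (at x)) \<and> (\<forall>v. Ck_on k S (\<lambda>x. frechet_derivative f (at x) v))"

definition smooth_on :: "'a::real_normed_vector set \<Rightarrow> ('a \<Rightarrow> 'b::real_normed_vector) \<Rightarrow> bool" where
  "smooth_on S f \<longleftrightarrow> (\<forall>k. Ck_on k S f)"

section \<open>Time-oriented Lorentz manifolds\<close>

text \<open>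
  The points of a manifold form an open subset of a Hausdorff second countable space, namely the
  union of the chart domains. A chart is a pair of a domain and a coordinate map; only the values
  of the coordinate map on the domain matter, and its inverse is \<^term>\<open>inv_into D \<phi>\<close>.
  Tensor fields are given classically, by their components with respect to each coordinate map,
  subject to the usual transformation laws: \<open>metric M \<phi> p\<close> is the Gram matrix of the metric
  at \<open>p\<close> in the coordinate basis of \<open>\<phi>\<close>, and \<open>torient M \<phi> p\<close> is the coordinate vector of
  a timelike vector field that determines the time orientation. The components depend on the
  coordinate map and not on its domain, so they restrict verbatim to open subsets.
\<close>

type_synonym ('a, 'n) chart = "'a set \<times> ('a \<Rightarrow> real ^ 'n)"

record ('a, 'n) lorentz =
  atlas :: "('a, 'n) chart set"
  metric :: "('a \<Rightarrow> real ^ 'n) \<Rightarrow> 'a \<Rightarrow> real ^ 'n ^ 'n"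
  torient :: "('a \<Rightarrow> real ^ 'n) \<Rightarrow> 'a \<Rightarrow> real ^ 'n"

definition points :: "('a, 'n::finite) lorentz \<Rightarrow> 'a set" where
  "points M = (\<Union>(D, \<phi>)\<in>atlas M. D)"

definition is_chart :: "('a::topological_space, 'n::finite) chart \<Rightarrow> bool" where
  "is_chart = (\<lambda>(D, \<phi>). open D \<and> open (\<phi> ` D) \<and> homeomorphism D (\<phi> ` D) \<phi> (inv_into D \<phi>))"

definition smooth_manifold :: "('a::{t2_space, second_countable_topology}, 'n::finite) lorentz \<Rightarrow> bool"
  where "smooth_manifold M \<longleftrightarrow>
    (\<forall>c\<in>atlas M. is_chart c) \<and>
    (\<forall>(D, \<phi>)\<in>atlas M. \<forall>(E, \<psi>)\<in>atlas M. smooth_on (\<phi> ` (D \<inter> E)) (\<psi> \<circ> inv_into D \<phi>))"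

definition transition_jacobian ::
  "('a, 'n::finite) chart \<Rightarrow> ('a, 'n) chart \<Rightarrow> 'a \<Rightarrow> real ^ 'n ^ 'n" where
  "transition_jacobian = (\<lambda>(D, \<phi>) (E, \<psi>) p.
     matrix (frechet_derivative (\<psi> \<circ> inv_into D \<phi>) (at (\<phi> p))))"

text \<open>Signature \<open>(-, +, \<dots>, +)\<close>: some basis is orthonormal with exactly one timelike vector.\<close>

definition lorentz_signature :: "real ^ 'n ^ 'n::finite \<Rightarrow> bool" where
  "lorentz_signature G \<longleftrightarrow> (\<exists>(P :: real ^ 'n ^ 'n) i0. invertible P \<and>
     transpose P ** G ** P = (\<chi> i j. if i = j then (if i = i0 then - 1 else 1) else 0))"

definition metric_at :: "('a, 'n::finite) lorentz \<Rightarrow> ('a \<Rightarrow> real ^ 'n) \<Rightarrow> 'a \<Rightarrow> real ^ 'n \<Rightarrow> real ^ 'n \<Rightarrow> real"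
  where "metric_at M \<phi> p v w = v \<bullet> (metric M \<phi> p *v w)"

definition lorentz_metric :: "('a, 'n::finite) lorentz \<Rightarrow> bool" where
  "lorentz_metric M \<longleftrightarrow>
    (\<forall>(D, \<phi>)\<in>atlas M. smooth_on (\<phi> ` D) (metric M \<phi> \<circ> inv_into D \<phi>) \<and>
       (\<forall>p\<in>D. lorentz_signature (metric M \<phi> p))) \<and>
    (\<forall>(D, \<phi>)\<in>atlas M. \<forall>(E, \<psi>)\<in>atlas M. \<forall>p\<in>D \<inter> E.
       let J = transition_jacobian (D, \<phi>) (E, \<psi>) p
       in metric M \<phi> p = transpose J ** metric M \<psi> p ** J)"

definition time_orientation :: "('a::topological_space, 'n::finite) lorentz \<Rightarrow> bool" where
  "time_orientation M \<longleftrightarrow>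
    (\<forall>(D, \<phi>)\<in>atlas M. continuous_on D (torient M \<phi>) \<and>
       (\<forall>p\<in>D. metric_at M \<phi> p (torient M \<phi> p) (torient M \<phi> p) < 0)) \<and>
    (\<forall>(D, \<phi>)\<in>atlas M. \<forall>(E, \<psi>)\<in>atlas M. \<forall>p\<in>D \<inter> E.
       torient M \<psi> p = transition_jacobian (D, \<phi>) (E, \<psi>) p *v torient M \<phi> p)"

definition time_oriented_lorentz_manifold ::
  "('a::{t2_space, second_countable_topology}, 'n::finite) lorentz \<Rightarrow> bool" where
  "time_oriented_lorentz_manifold M \<longleftrightarrow>
    smooth_manifold M \<and> lorentz_metric M \<and> time_orientation M"

text \<open>The open submanifold \<open>U\<close> with the restricted metric and time orientation.\<close>

definition open_submanifold :: "('a, 'n::finite) lorentz \<Rightarrow> 'a set \<Rightarrow> ('a, 'n) lorentz" where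
  "open_submanifold M U = M\<lparr>atlas := (\<lambda>(D, \<phi>). (D \<inter> U, \<phi>)) ` atlas M\<rparr>"

definition diffeomorphic_to_open_ball ::
  "('a::topological_space, 'n::finite) lorentz \<Rightarrow> bool" where
  "diffeomorphic_to_open_ball N \<longleftrightarrow>
    (\<exists>F G. homeomorphism (points N) (ball (0 :: real ^ 'n) 1) F G \<and>
       (\<forall>(D, \<phi>)\<in>atlas N. smooth_on (\<phi> ` D) (F \<circ> inv_into D \<phi>) \<and> smooth_on (F ` D) (\<phi> \<circ> G)))"

section \<open>Causality\<close>

definition timelike_vec :: "('a, 'n::finite) lorentz \<Rightarrow> ('a \<Rightarrow> real ^ 'n) \<Rightarrow> 'a \<Rightarrow> real ^ 'n \<Rightarrow> bool" where
  "timelike_vec M \<phi> p v \<longleftrightarrow> metric_at M \<phi> p v v < 0"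

definition lightlike_vec :: "('a, 'n::finite) lorentz \<Rightarrow> ('a \<Rightarrow> real ^ 'n) \<Rightarrow> 'a \<Rightarrow> real ^ 'n \<Rightarrow> bool" where
  "lightlike_vec M \<phi> p v \<longleftrightarrow> v \<noteq> 0 \<and> metric_at M \<phi> p v v = 0"

definition causal_vec :: "('a, 'n::finite) lorentz \<Rightarrow> ('a \<Rightarrow> real ^ 'n) \<Rightarrow> 'a \<Rightarrow> real ^ 'n \<Rightarrow> bool" where
  "causal_vec M \<phi> p v \<longleftrightarrow> timelike_vec M \<phi> p v \<or> lightlike_vec M \<phi> p v"

text \<open>The next two notions are meant for causal vectors only.\<close>

definition future_vec :: "('a, 'n::finite) lorentz \<Rightarrow> ('a \<Rightarrow> real ^ 'n) \<Rightarrow> 'a \<Rightarrow> real ^ 'n \<Rightarrow> bool" where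
  "future_vec M \<phi> p v \<longleftrightarrow> metric_at M \<phi> p (torient M \<phi> p) v < 0"

definition past_vec :: "('a, 'n::finite) lorentz \<Rightarrow> ('a \<Rightarrow> real ^ 'n) \<Rightarrow> 'a \<Rightarrow> real ^ 'n \<Rightarrow> bool" where
  "past_vec M \<phi> p v \<longleftrightarrow> metric_at M \<phi> p (torient M \<phi> p) v > 0"

text \<open>
  A curve on an interval is smooth if in charts it extends smoothly past the endpoints that belong
  to the interval; its velocity at such an endpoint is the one-sided derivative.
\<close>

definition smooth_curve ::
  "('a::topological_space, 'n::finite) lorentz \<Rightarrow> real set \<Rightarrow> (real \<Rightarrow> 'a) \<Rightarrow> bool" where
  "smooth_curve M I \<gamma> \<longleftrightarrow> \<gamma> ` I \<subseteq> points M \<and>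
    (\<forall>t\<in>I. \<forall>(D, \<phi>)\<in>atlas M. \<gamma> t \<in> D \<longrightarrow>
      (\<exists>e>0. \<exists>\<eta>. smooth_on {t - e<..<t + e} \<eta> \<and>
         (\<forall>s\<in>I \<inter> {t - e<..<t + e}. \<gamma> s \<in> D \<and> \<phi> (\<gamma> s) = \<eta> s)))"

definition velocity :: "('a \<Rightarrow> real ^ 'n::finite) \<Rightarrow> real set \<Rightarrow> (real \<Rightarrow> 'a) \<Rightarrow> real \<Rightarrow> real ^ 'n" where
  "velocity \<phi> I \<gamma> t = vector_derivative (\<phi> \<circ> \<gamma>) (at t within I)"

definition velocities_satisfy ::
  "('a, 'n::finite) lorentz \<Rightarrow> (('a \<Rightarrow> real ^ 'n) \<Rightarrow> 'a \<Rightarrow> real ^ 'n \<Rightarrow> bool) \<Rightarrow> real set \<Rightarrow> (real \<Rightarrow> 'a) \<Rightarrow> bool"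
  where "velocities_satisfy M Q I \<gamma> \<longleftrightarrow>
    (\<forall>t\<in>I. \<forall>(D, \<phi>)\<in>atlas M. \<gamma> t \<in> D \<longrightarrow> Q \<phi> (\<gamma> t) (velocity \<phi> I \<gamma> t))"

text \<open>
  Piecewise smooth curves all of whose velocities, including both one-sided ones at the break
  points, satisfy \<open>Q\<close>. The set \<open>B\<close> of break points does not accumulate in \<open>I\<close>.
\<close>

definition piecewise_curve ::
  "('a::topological_space, 'n::finite) lorentz \<Rightarrow> (('a \<Rightarrow> real ^ 'n) \<Rightarrow> 'a \<Rightarrow> real ^ 'n \<Rightarrow> bool)
    \<Rightarrow> real set \<Rightarrow> (real \<Rightarrow> 'a) \<Rightarrow> bool" where
  "piecewise_curve M Q I \<gamma> \<longleftrightarrow> continuous_on I \<gamma> \<and> \<gamma> ` I \<subseteq> points M \<and>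
    (\<exists>B. \<forall>s\<in>I. \<forall>t\<in>I. finite (B \<inter> {s..t}) \<and>
       (s < t \<and> B \<inter> {s<..<t} = {} \<longrightarrow>
          smooth_curve M {s..t} \<gamma> \<and> velocities_satisfy M Q {s..t} \<gamma>))"

definition chronological :: "('a::topological_space, 'n::finite) lorentz \<Rightarrow> 'a \<Rightarrow> 'a \<Rightarrow> bool" where
  "chronological M p q \<longleftrightarrow> (\<exists>\<gamma>.
     piecewise_curve M (\<lambda>\<phi> x v. timelike_vec M \<phi> x v \<and> future_vec M \<phi> x v) {0..1} \<gamma> \<and>
     \<gamma> 0 = p \<and> \<gamma> 1 = q)"

definition achronal :: "('a::topological_space, 'n::finite) lorentz \<Rightarrow> 'a set \<Rightarrow> bool" where
  "achronal M S \<longleftrightarrow> S \<subseteq> points M \<and> (\<forall>p\<in>S. \<forall>q\<in>S. \<not> chronological M p q)"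

text \<open>The interval \<open>[0, a)\<close>, where \<open>a = \<infinity>\<close> is allowed.\<close>

definition half_open :: "ereal \<Rightarrow> real set" where
  "half_open a = {t. 0 \<le> t \<and> ereal t < a}"

definition past_causal_curve ::
  "('a::topological_space, 'n::finite) lorentz \<Rightarrow> ereal \<Rightarrow> (real \<Rightarrow> 'a) \<Rightarrow> bool" where
  "past_causal_curve M a \<gamma> \<longleftrightarrow>
     piecewise_curve M (\<lambda>\<phi> x v. causal_vec M \<phi> x v \<and> past_vec M \<phi> x v) (half_open a) \<gamma>"

text \<open>A curve on \<open>[0, a)\<close> is inextendable if it has no endpoint in the manifold.\<close>

definition inextendable :: "('a::topological_space, 'n::finite) lorentz \<Rightarrow> ereal \<Rightarrow> (real \<Rightarrow> 'a) \<Rightarrow> bool"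
  where "inextendable M a \<gamma> \<longleftrightarrow>
    \<not> (\<exists>q\<in>points M. ((\<lambda>t. \<gamma> (real_of_ereal t)) \<longlongrightarrow> q) (at_left a))"

section \<open>Geodesics\<close>

definition metric_partial ::
  "('a, 'n::finite) lorentz \<Rightarrow> ('a, 'n) chart \<Rightarrow> 'a \<Rightarrow> 'n \<Rightarrow> 'n \<Rightarrow> 'n \<Rightarrow> real" where
  "metric_partial M = (\<lambda>(D, \<phi>) p m i j.
     frechet_derivative (\<lambda>x. metric M \<phi> (inv_into D \<phi> x) $ i $ j) (at (\<phi> p)) (axis m 1))"

definition christoffel ::
  "('a, 'n::finite) lorentz \<Rightarrow> ('a, 'n) chart \<Rightarrow> 'a \<Rightarrow> 'n \<Rightarrow> 'n \<Rightarrow> 'n \<Rightarrow> real" where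
  "christoffel M c p k i j = (1 / 2) * (\<Sum>l\<in>UNIV. matrix_inv (metric M (snd c) p) $ k $ l *
     (metric_partial M c p i j l + metric_partial M c p j i l - metric_partial M c p l i j))"

definition geodesic ::
  "('a::topological_space, 'n::finite) lorentz \<Rightarrow> real set \<Rightarrow> (real \<Rightarrow> 'a) \<Rightarrow> bool" where
  "geodesic M I \<gamma> \<longleftrightarrow> smooth_curve M I \<gamma> \<and>
    (\<forall>t\<in>I. \<forall>(D, \<phi>)\<in>atlas M. \<gamma> t \<in> D \<longrightarrow>
      (let v = velocity \<phi> I \<gamma>; acc = vector_derivative v (at t within I)
       in \<forall>k. acc $ k +
            (\<Sum>i\<in>UNIV. \<Sum>j\<in>UNIV. christoffel M (D, \<phi>) (\<gamma> t) k i j * v t $ i * v t $ j) = 0))"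

section \<open>Horizons and Cauchy horizons\<close>

text \<open>
  A topological hypersurface is a subset that is locally mapped onto a piece of a hyperplane of
  \<open>\<real>\<^sup>n\<close> by a homeomorphism of an open set of the ambient manifold onto an open set of \<open>\<real>\<^sup>n\<close>.
\<close>

definition topological_hypersurface ::
  "('a::topological_space, 'n::finite) lorentz \<Rightarrow> 'a set \<Rightarrow> bool" where
  "topological_hypersurface M H \<longleftrightarrow> H \<subseteq> points M \<and>
    (\<forall>p\<in>H. \<exists>V W h h' a b. open V \<and> p \<in> V \<and> V \<subseteq> points M \<and>
       open (W :: (real ^ 'n) set) \<and> homeomorphism V W h h' \<and> a \<noteq> 0 \<and>
       h ` (V \<inter> H) = W \<inter> {x. a \<bullet> x = b})"

definition horizon :: "('a::topological_space, 'n::finite) lorentz \<Rightarrow> 'a set \<Rightarrow> bool" where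
  "horizon M H \<longleftrightarrow> topological_hypersurface M H \<and> achronal M H \<and>
    (\<forall>p\<in>H. \<exists>a>0. \<exists>\<gamma>. geodesic M (half_open a) \<gamma> \<and>
       velocities_satisfy M (\<lambda>\<phi> x v. lightlike_vec M \<phi> x v \<and> past_vec M \<phi> x v) (half_open a) \<gamma> \<and>
       inextendable M a \<gamma> \<and> \<gamma> ` half_open a \<subseteq> H \<and> \<gamma> 0 = p)"

definition future_cauchy_development ::
  "('a::topological_space, 'n::finite) lorentz \<Rightarrow> 'a set \<Rightarrow> 'a set" where
  "future_cauchy_development N S = {z \<in> points N. \<forall>a>0. \<forall>\<gamma>.
     past_causal_curve N a \<gamma> \<and> inextendable N a \<gamma> \<and> \<gamma> 0 = z \<longrightarrow> \<gamma> ` half_open a \<inter> S \<noteq> {}}"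

definition future_cauchy_horizon ::
  "('a::topological_space, 'n::finite) lorentz \<Rightarrow> 'a set \<Rightarrow> 'a set" where
  "future_cauchy_horizon N S =
     (top_of_set (points N) frontier_of future_cauchy_development N S)
     - (top_of_set (points N) closure_of S)"

end

theory Submission
  imports Defs
begin

text \<open>
  In a small coordinate ball around \<open>p\<close> the light cones are nearly constant, so there are a linear
  time function \<open>\<tau>\<close> that decreases along past causal curves at a rate comparable to their length,
  and a constant timelike direction \<open>e\<close>. Achronality and invariance of domain make \<open>H\<close> near \<open>p\<close> a
  graph in direction \<open>e\<close>: every line in this direction meets \<open>H\<close> exactly once. Let \<open>S\<close> be the part of
  a level set of \<open>\<tau>\<close> slightly to the past of \<open>p\<close> that lies strictly below \<open>H\<close>.

  A past inextendable causal curve from a point below \<open>H\<close> reaches that level; there it is still below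
  \<open>H\<close>, since otherwise pushing the curve up would give a timelike curve between two points of \<open>H\<close>.
  From a point above \<open>H\<close> one can descend to \<open>H\<close> and then follow a null generator, which stays in \<open>H\<close>
  and so never meets \<open>S\<close>. Hence near \<open>p\<close> the Cauchy development of \<open>S\<close> agrees, up to points of
  \<open>H\<close>, with the region below \<open>H\<close>, and its boundary is \<open>H\<close>.
\<close>

section \<open>Calculus of smooth maps\<close>

text \<open>The Cauchy development quantifies over causal curves, whereas achronality of
  \<open>H\<close> forbids only timelike ones, and the metric varies with the coordinates. The
  bridge is quantitative: a causal curve is moved along \<open>e\<close> by an amount affine in
  \<tau>. The derivative of the metric bounds the resulting tilt of the light cones by a multiple of
  the displacement, while the velocity gains an \<open>e\<close>-component governed by the slope
  \<mu> of the displacement. In a ball of small \<tau>-width the gain wins. The second estimate is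
  that the length of a past causal vector is at most \<open>K\<close> times the drop of \<tau>. It
  turns levels into distances: with \<open>S\<close> at depth \<open>r / (4 * K)\<close> below
  \<open>p\<close>, a curve that starts close to \<open>p\<close> cannot leave the ball of radius
  \<open>r\<close> before it has reached the level of \<open>S\<close>. Since \<open>H\<close> is
  achronal in all of \<open>M\<close>, the contradicting timelike curves may run in a larger ball
  than \<open>U\<close>; the set \<open>S\<close> is only compared with curves inside
  \<open>U\<close>, where the cone estimates hold. Points of \<open>H\<close> are never tested for
  membership in the development, because a boundary point only needs points of both kinds in each of
  its neighbourhoods.\<close>

lemma Ck_on_subset: "Ck_on k S f \<Longrightarrow> T \<subseteq> S \<Longrightarrow> Ck_on k T f"
  by (induction k arbitrary: f) (auto intro: continuous_on_subset)

text \<open>Derivatives are taken at a point of the whole space, so agreement on \<open>S\<close>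
  has to be agreement on a neighbourhood; this is where openness enters.\<close>

lemma Ck_on_cong:
  assumes "open S" and "\<And>x. x \<in> S \<Longrightarrow> f x = g x" and "Ck_on k S f"
  shows "Ck_on k S g"
  using assms(2,3)
proof (induction k arbitrary: f g)
  case 0
  then show ?case using continuous_on_cong by force
next
  case (Suc k)
  have f: "f differentiable at x" if "x \<in> S" for x
    using that Suc.prems by simp
  have g: "g differentiable at x" if "x \<in> S" for x
    using f[OF that] has_derivative_transform_within_open[of f _ x UNIV S g] \<open>open S\<close> that Suc.prems(1)
    unfolding differentiable_def by blast
  have D: "frechet_derivative f (at x) = frechet_derivative g (at x)" if "x \<in> S" for x
    using frechet_derivative_transform_within_open[OF f[OF that] \<open>open S\<close> that Suc.prems(1)] .
  have "Ck_on k S (\<lambda>x. frechet_derivative g (at x) v)" for v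
    using Suc.prems(2) D by (auto intro: Suc.IH[of "\<lambda>x. frechet_derivative f (at x) v", rotated])
  then show ?case using g by simp
qed

lemma Ck_on_SucD: "Ck_on (Suc k) S f \<Longrightarrow> Ck_on k S f"
proof (induction k arbitrary: f)
  case 0
  then show ?case
    by (simp add: differentiable_imp_continuous_on differentiable_on_def differentiable_at_withinI)
next
  case (Suc k)
  show ?case
  proof (subst Ck_on.simps, intro conjI ballI allI)
    fix x assume "x \<in> S"
    then show "f differentiable at x" using Suc.prems by simp
  next
    fix v
    have "Ck_on (Suc k) S (\<lambda>x. frechet_derivative f (at x) v)"
      using Suc.prems by (subst (asm) Ck_on.simps) blast
    then show "Ck_on k S (\<lambda>x. frechet_derivative f (at x) v)" by (rule Suc.IH)
  qed
qed

lemma Ck_on_bounded_linear: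
  assumes "bounded_linear L" "open S" "Ck_on k S f"
  shows "Ck_on k S (\<lambda>x. L (f x))"
  using assms(3)
proof (induction k arbitrary: f)
  case 0
  then show ?case using assms(1) by (simp add: bounded_linear.continuous_on)
next
  case (Suc k)
  have D: "((\<lambda>x. L (f x)) has_derivative (\<lambda>v. L (frechet_derivative f (at x) v))) (at x)"
    if "x \<in> S" for x
    using Suc.prems that frechet_derivative_works bounded_linear.has_derivative[OF assms(1)] by fastforce
  have "Ck_on k S (\<lambda>x. frechet_derivative (\<lambda>x. L (f x)) (at x) v)" for v
  proof (rule Ck_on_cong[OF \<open>open S\<close>])
    show "Ck_on k S (\<lambda>x. L (frechet_derivative f (at x) v))" using Suc by auto
  qed (simp add: frechet_derivative_at[OF D, symmetric])
  then show ?case using D by (auto simp: differentiable_def)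
qed

lemma Ck_on_add:
  assumes "open S" "Ck_on k S f" "Ck_on k S g"
  shows "Ck_on k S (\<lambda>x. f x + g x)"
  using assms(2,3)
proof (induction k arbitrary: f g)
  case 0
  then show ?case by (simp add: continuous_on_add)
next
  case (Suc k)
  have D: "((\<lambda>x. f x + g x) has_derivative
      (\<lambda>v. frechet_derivative f (at x) v + frechet_derivative g (at x) v)) (at x)" if "x \<in> S" for x
    using Suc.prems that by (auto intro!: has_derivative_add simp: frechet_derivative_works[symmetric])
  have "Ck_on k S (\<lambda>x. frechet_derivative (\<lambda>x. f x + g x) (at x) v)" for v
  proof (rule Ck_on_cong[OF \<open>open S\<close>])
    show "Ck_on k S (\<lambda>x. frechet_derivative f (at x) v + frechet_derivative g (at x) v)"
      using Suc by auto
  qed (simp add: frechet_derivative_at[OF D, symmetric])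
  then show ?case using D by (auto simp: differentiable_def)
qed

lemma Ck_on_scaleR:
  fixes f :: "'a::real_normed_vector \<Rightarrow> real"
  assumes "open S" "Ck_on k S f" "Ck_on k S g"
  shows "Ck_on k S (\<lambda>x. f x *\<^sub>R g x)"
  using assms(2,3)
proof (induction k arbitrary: f g)
  case 0
  then show ?case by (simp add: continuous_on_scaleR)
next
  case (Suc k)
  have D: "((\<lambda>x. f x *\<^sub>R g x) has_derivative
      (\<lambda>v. f x *\<^sub>R frechet_derivative g (at x) v + frechet_derivative f (at x) v *\<^sub>R g x)) (at x)"
    if "x \<in> S" for x
    using Suc.prems that by (auto intro!: has_derivative_scaleR simp: frechet_derivative_works[symmetric])
  have "Ck_on k S (\<lambda>x. frechet_derivative (\<lambda>x. f x *\<^sub>R g x) (at x) v)" for v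
  proof (rule Ck_on_cong[OF \<open>open S\<close>])
    \<comment> \<open>The product rule leaves one factor undifferentiated; that factor is of class
      \<open>Suc k\<close> and is lowered to class \<open>k\<close> to fit the induction
      hypothesis.\<close>
    show "Ck_on k S (\<lambda>x. f x *\<^sub>R frechet_derivative g (at x) v + frechet_derivative f (at x) v *\<^sub>R g x)"
      using Suc.prems[THEN Ck_on_SucD] Suc.prems
      by (intro Ck_on_add[OF \<open>open S\<close>] Suc.IH) auto
  qed (simp add: frechet_derivative_at[OF D, symmetric])
  then show ?case using D by (auto simp: differentiable_def)
qed

lemma Ck_on_const [simp]: "Ck_on k S (\<lambda>x. c)"
proof (induction k arbitrary: c)
  case (Suc k)
  have "frechet_derivative (\<lambda>x. c) (at x) v = 0" for x v
    by (simp add: frechet_derivative_at[OF has_derivative_const, symmetric])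
  then show ?case using Suc by simp
qed simp

lemma Ck_on_ident [simp]: "Ck_on k S (\<lambda>x. x)"
proof (cases k)
  case (Suc k)
  have "frechet_derivative (\<lambda>x. x) (at x) v = v" for x v
    by (simp add: frechet_derivative_at[OF has_derivative_ident, symmetric])
  then show ?thesis using Suc by simp
qed simp

lemma Ck_on_sum:
  assumes "open S" "\<And>i. i \<in> A \<Longrightarrow> Ck_on k S (f i)"
  shows "Ck_on k S (\<lambda>x. \<Sum>i\<in>A. f i x)"
  using assms(2) by (induction A rule: infinite_finite_induct) (auto intro: Ck_on_add[OF assms(1)])

text \<open>The chain rule differentiates \<open>f\<close> in a direction that itself varies with
  \<open>x\<close>, while \<open>Ck_on\<close> controls fixed directions only. Expanding the
  direction in the finite basis of \<open>'b\<close> turns the derivative into a sum of products of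
  known functions.\<close>

lemma Ck_on_compose:
  fixes f :: "'b::euclidean_space \<Rightarrow> 'c::real_normed_vector" and g :: "'a::real_normed_vector \<Rightarrow> 'b"
  assumes "open S" "g ` S \<subseteq> T" "Ck_on k T f" "Ck_on k S g"
  shows "Ck_on k S (\<lambda>x. f (g x))"
  using assms(3,4)
proof (induction k arbitrary: f)
  case 0
  then show ?case using assms(2) continuous_on_compose2[of T f S g] by simp
next
  case (Suc k)
  have f: "(f has_derivative frechet_derivative f (at (g x))) (at (g x))"
    and g: "(g has_derivative frechet_derivative g (at x)) (at x)" if "x \<in> S" for x
    using Suc.prems that assms(2) by (auto simp: frechet_derivative_works[symmetric])
  have D: "((\<lambda>x. f (g x)) has_derivative (\<lambda>v. frechet_derivative f (at (g x)) (frechet_derivative g (at x) v))) (at x)"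
    if "x \<in> S" for x
    using has_derivative_compose[OF g[OF that] f[OF that]] .
  have "Ck_on k S (\<lambda>x. frechet_derivative (\<lambda>x. f (g x)) (at x) v)" for v
  proof (rule Ck_on_cong[OF \<open>open S\<close>])
    show "Ck_on k S (\<lambda>x. \<Sum>i\<in>Basis. (frechet_derivative g (at x) v \<bullet> i) *\<^sub>R frechet_derivative f (at (g x)) i)"
    proof (intro Ck_on_sum[OF \<open>open S\<close>] Ck_on_scaleR[OF \<open>open S\<close>])
      fix i :: 'b
      show "Ck_on k S (\<lambda>x. frechet_derivative g (at x) v \<bullet> i)"
        using Suc.prems by (intro Ck_on_bounded_linear[OF bounded_linear_inner_left \<open>open S\<close>]) auto
      show "Ck_on k S (\<lambda>x. frechet_derivative f (at (g x)) i)"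
        using Suc.prems(1) Ck_on_SucD[OF Suc.prems(2)]
        by (intro Suc.IH[of "\<lambda>y. frechet_derivative f (at y) i"]) auto
    qed
  next
    fix x assume x: "x \<in> S"
    interpret L: linear "frechet_derivative f (at (g x))"
      using f[OF x] has_derivative_linear by blast
    have "frechet_derivative (\<lambda>x. f (g x)) (at x) v =
        frechet_derivative f (at (g x)) (frechet_derivative g (at x) v)"
      by (simp add: frechet_derivative_at[OF D[OF x], symmetric])
    also have "\<dots> = frechet_derivative f (at (g x)) (\<Sum>i\<in>Basis. (frechet_derivative g (at x) v \<bullet> i) *\<^sub>R i)"
      by (simp add: euclidean_representation)
    finally show "(\<Sum>i\<in>Basis. (frechet_derivative g (at x) v \<bullet> i) *\<^sub>R frechet_derivative f (at (g x)) i) =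
        frechet_derivative (\<lambda>x. f (g x)) (at x) v"
      by (simp add: L.sum L.scale)
  qed
  then show ?case using D by (auto simp: differentiable_def)
qed

lemma smooth_on_subset: "smooth_on S f \<Longrightarrow> T \<subseteq> S \<Longrightarrow> smooth_on T f"
  unfolding smooth_on_def by (blast intro: Ck_on_subset)

lemma smooth_on_cong:
  "open S \<Longrightarrow> (\<And>x. x \<in> S \<Longrightarrow> f x = g x) \<Longrightarrow> smooth_on S f \<Longrightarrow> smooth_on S g"
  unfolding smooth_on_def by (blast intro: Ck_on_cong)

lemma smooth_on_compose:
  fixes f :: "'b::euclidean_space \<Rightarrow> 'c::real_normed_vector"
  shows "open S \<Longrightarrow> g ` S \<subseteq> T \<Longrightarrow> smooth_on T f \<Longrightarrow> smooth_on S g \<Longrightarrow> smooth_on S (\<lambda>x. f (g x))"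
  unfolding smooth_on_def by (blast intro: Ck_on_compose)

lemma smooth_on_affine:
  assumes "bounded_linear L"
  shows "smooth_on S (\<lambda>x. c + L x)"
proof -
  have "Ck_on k UNIV (\<lambda>x. c + L x)" for k
    by (intro Ck_on_add Ck_on_bounded_linear[OF assms]) simp_all
  then show ?thesis
    unfolding smooth_on_def by (blast intro: Ck_on_subset)
qed

lemma smooth_on_imp_continuous_on: "smooth_on S f \<Longrightarrow> continuous_on S f"
  unfolding smooth_on_def by (metis Ck_on.simps(1))

lemma smooth_on_differentiable: "smooth_on S f \<Longrightarrow> x \<in> S \<Longrightarrow> f differentiable at x"
  unfolding smooth_on_def by (metis Ck_on.simps(2))

lemma smooth_on_derivative: "smooth_on S f \<Longrightarrow> smooth_on S (\<lambda>x. frechet_derivative f (at x) v)"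
  unfolding smooth_on_def by (metis Ck_on.simps(2))

section \<open>Curves in a chart\<close>

text \<open>The coordinate counterpart of \<open>smooth_curve\<close>: smoothness at an endpoint of
  \<open>I\<close> means a smooth extension past it, so no one-sided higher derivatives
  occur.\<close>

definition locally_smooth :: "real set \<Rightarrow> (real \<Rightarrow> 'b::real_normed_vector) \<Rightarrow> bool" where
  "locally_smooth I c \<longleftrightarrow> (\<forall>t\<in>I. \<exists>e>0. \<exists>\<eta>. smooth_on {t - e<..<t + e} \<eta> \<and>
     (\<forall>s\<in>I \<inter> {t - e<..<t + e}. c s = \<eta> s))"

text \<open>Combines the two operations of the push-up: an affine map applied to the points, and an
  affine change of parameter that may reverse the direction. The windows of smoothness are rescaled
  by the factor 1 / \<bar>b\<bar>.\<close>

lemma locally_smooth_affine: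
  fixes c :: "real \<Rightarrow> 'b::euclidean_space"
  assumes c: "locally_smooth I c" and L: "bounded_linear L" and J: "\<And>t. t \<in> J \<Longrightarrow> a + b * t \<in> I"
    and b: "b \<noteq> 0"
  shows "locally_smooth J (\<lambda>t. x + L (c (a + b * t)))"
  unfolding locally_smooth_def
proof
  fix t assume "t \<in> J"
  then obtain e \<eta> where e: "e > 0" and \<eta>: "smooth_on {a + b * t - e<..<a + b * t + e} \<eta>"
    and eq: "\<forall>s\<in>I \<inter> {a + b * t - e<..<a + b * t + e}. c s = \<eta> s"
    using c J unfolding locally_smooth_def by blast
  have in_ivl: "a + b * s \<in> {a + b * t - e<..<a + b * t + e}"
    if "s \<in> {t - e / \<bar>b\<bar><..<t + e / \<bar>b\<bar>}" for s
  proof -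
    have "\<bar>s - t\<bar> < e / \<bar>b\<bar>" using that by (auto simp: abs_if)
    then have "\<bar>b\<bar> * \<bar>s - t\<bar> < e" using b by (simp add: mult.commute pos_less_divide_eq)
    then have "\<bar>b * s - b * t\<bar> < e" by (simp add: abs_mult[symmetric] right_diff_distrib)
    then show ?thesis by auto
  qed
  have "smooth_on {t - e / \<bar>b\<bar><..<t + e / \<bar>b\<bar>} (\<lambda>s. \<eta> (a + b * s))"
    by (rule smooth_on_compose[OF _ _ \<eta>])
      (use in_ivl in \<open>auto intro: smooth_on_affine bounded_linear_mult_right\<close>)
  then have "smooth_on {t - e / \<bar>b\<bar><..<t + e / \<bar>b\<bar>} (\<lambda>s. x + L (\<eta> (a + b * s)))"
    using smooth_on_compose[OF _ subset_UNIV smooth_on_affine[OF L], of "{t - e / \<bar>b\<bar><..<t + e / \<bar>b\<bar>}"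
      "\<lambda>s. \<eta> (a + b * s)"] by simp
  moreover have "\<forall>s\<in>J \<inter> {t - e / \<bar>b\<bar><..<t + e / \<bar>b\<bar>}. x + L (c (a + b * s)) = x + L (\<eta> (a + b * s))"
    using in_ivl eq J by auto
  ultimately show "\<exists>e>0. \<exists>\<eta>. smooth_on {t - e<..<t + e} \<eta> \<and>
      (\<forall>s\<in>J \<inter> {t - e<..<t + e}. x + L (c (a + b * s)) = \<eta> s)"
    using e b by (intro exI[of _ "e / \<bar>b\<bar>"] conjI exI[of _ "\<lambda>s. x + L (\<eta> (a + b * s))"]) auto
qed

lemma locally_smooth_line: "locally_smooth I (\<lambda>t. x + t *\<^sub>R v)"
  unfolding locally_smooth_def
proof
  fix t
  have "smooth_on {t - 1<..<t + 1} (\<lambda>t. x + t *\<^sub>R v)"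
    by (rule smooth_on_affine) (rule bounded_linear_scaleR_left)
  then show "\<exists>e>0. \<exists>\<eta>. smooth_on {t - e<..<t + e} \<eta> \<and>
      (\<forall>s\<in>I \<inter> {t - e<..<t + e}. x + s *\<^sub>R v = \<eta> s)"
    by (intro exI[of _ 1]) auto
qed

lemma smooth_curve_extension:
  assumes "smooth_curve M I \<gamma>" "(D, \<phi>) \<in> atlas M" "t \<in> I" "\<gamma> t \<in> D"
  obtains e \<eta> where "e > 0" "smooth_on {t - e<..<t + e} \<eta>"
    "\<And>s. s \<in> I \<Longrightarrow> s \<in> {t - e<..<t + e} \<Longrightarrow> \<gamma> s \<in> D \<and> \<phi> (\<gamma> s) = \<eta> s"
proof -
  have "\<forall>t\<in>I. \<forall>(D, \<phi>)\<in>atlas M. \<gamma> t \<in> D \<longrightarrow>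
      (\<exists>e>0. \<exists>\<eta>. smooth_on {t - e<..<t + e} \<eta> \<and>
         (\<forall>s\<in>I \<inter> {t - e<..<t + e}. \<gamma> s \<in> D \<and> \<phi> (\<gamma> s) = \<eta> s))"
    using assms(1) unfolding smooth_curve_def by (rule conjunct2)
  from bspec[OF bspec[OF this assms(3)] assms(2)] assms(4)
  have "\<exists>e>0. \<exists>\<eta>. smooth_on {t - e<..<t + e} \<eta> \<and>
         (\<forall>s\<in>I \<inter> {t - e<..<t + e}. \<gamma> s \<in> D \<and> \<phi> (\<gamma> s) = \<eta> s)"
    by simp
  then show thesis using that by blast
qed

lemma smooth_curve_imp_locally_smooth:
  assumes "smooth_curve M I \<gamma>" "(D, \<phi>) \<in> atlas M" "\<gamma> ` I \<subseteq> D"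
  shows "locally_smooth I (\<lambda>t. \<phi> (\<gamma> t))"
  unfolding locally_smooth_def
proof
  fix t assume "t \<in> I"
  then obtain e \<eta> where "e > 0" "smooth_on {t - e<..<t + e} \<eta>"
    "\<forall>s\<in>I \<inter> {t - e<..<t + e}. \<gamma> s \<in> D \<and> \<phi> (\<gamma> s) = \<eta> s"
    using assms unfolding smooth_curve_def by blast
  then show "\<exists>e>0. \<exists>\<eta>. smooth_on {t - e<..<t + e} \<eta> \<and>
      (\<forall>s\<in>I \<inter> {t - e<..<t + e}. \<phi> (\<gamma> s) = \<eta> s)"
    by blast
qed

text \<open>\<open>velocity\<close> is defined by choice; the smooth extension supplies the
  differentiability within \<open>I\<close> that makes it a genuine derivative, at endpoints
  too.\<close>

lemma smooth_curve_velocity: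
  assumes "smooth_curve M I \<gamma>" "(D, \<phi>) \<in> atlas M" "t \<in> I" "\<gamma> t \<in> D"
  shows "((\<lambda>t. \<phi> (\<gamma> t)) has_vector_derivative velocity \<phi> I \<gamma> t) (at t within I)"
proof -
  obtain e \<eta> where e: "e > 0" and \<eta>: "smooth_on {t - e<..<t + e} \<eta>"
    and eq: "\<forall>s\<in>I \<inter> {t - e<..<t + e}. \<gamma> s \<in> D \<and> \<phi> (\<gamma> s) = \<eta> s"
    using assms unfolding smooth_curve_def by blast
  have "\<eta> differentiable (at t within I)"
    using smooth_on_differentiable[OF \<eta>] e by (simp add: differentiable_at_withinI)
  then obtain d where "(\<eta> has_derivative d) (at t within I)"
    unfolding differentiable_def by blast
  then have "((\<phi> \<circ> \<gamma>) has_derivative d) (at t within I)"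
    by (rule has_derivative_transform_within[where d = e])
      (use e eq assms(3) in \<open>auto simp: dist_real_def abs_if split: if_splits\<close>)
  then have "(\<phi> \<circ> \<gamma>) differentiable (at t within I)"
    unfolding differentiable_def by blast
  then show ?thesis
    by (simp add: vector_derivative_works velocity_def comp_def)
qed

lemma smooth_curve_subset:
  assumes "smooth_curve M I \<gamma>" "J \<subseteq> I"
  shows "smooth_curve M J \<gamma>"
  unfolding smooth_curve_def
proof (intro conjI ballI, goal_cases)
  case 1
  then show ?case using assms unfolding smooth_curve_def by blast
next
  case (2 t c)
  obtain D \<phi> where c: "c = (D, \<phi>)" by force
  show ?case unfolding c prod.case
  proof
    assume "\<gamma> t \<in> D"
    then obtain e \<eta> where "e > 0" "smooth_on {t - e<..<t + e} \<eta>"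
      "\<forall>s\<in>I \<inter> {t - e<..<t + e}. \<gamma> s \<in> D \<and> \<phi> (\<gamma> s) = \<eta> s"
      using assms 2 c unfolding smooth_curve_def by blast
    then show "\<exists>e>0. \<exists>\<eta>. smooth_on {t - e<..<t + e} \<eta> \<and>
        (\<forall>s\<in>J \<inter> {t - e<..<t + e}. \<gamma> s \<in> D \<and> \<phi> (\<gamma> s) = \<eta> s)"
      using assms(2) by blast
  qed
qed

text \<open>One-sided derivatives are unique on a nondegenerate interval, so restricting the curve
  cannot change its velocity. On a single point every vector would be a derivative, whence
  \<open>s < t\<close>.\<close>

lemma velocity_subinterval:
  assumes "smooth_curve M I \<gamma>" "(D, \<phi>) \<in> atlas M" "{s..t} \<subseteq> I" "s < t" "u \<in> {s..t}" "\<gamma> u \<in> D"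
  shows "velocity \<phi> {s..t} \<gamma> u = velocity \<phi> I \<gamma> u"
proof -
  have "((\<lambda>t. \<phi> (\<gamma> t)) has_vector_derivative velocity \<phi> I \<gamma> u) (at u within {s..t})"
    using smooth_curve_velocity[OF assms(1,2) _ assms(6)] assms(3,5)
    by (blast intro: has_vector_derivative_within_subset)
  then show ?thesis
    using assms(4,5) vector_derivative_within_cbox[of s t u] by (auto simp: velocity_def comp_def)
qed

lemma velocities_satisfy_subinterval:
  assumes "smooth_curve M I \<gamma>" "velocities_satisfy M Q I \<gamma>" "{s..t} \<subseteq> I" "s < t"
  shows "velocities_satisfy M Q {s..t} \<gamma>"
  using assms velocity_subinterval[OF assms(1) _ assms(3,4)]
  unfolding velocities_satisfy_def by (fastforce split: prod.splits)

lemma smooth_curve_shift: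
  assumes "smooth_curve M {s..t} \<gamma>"
  shows "smooth_curve M {s + r..t + r} (\<lambda>u. \<gamma> (u - r))"
  unfolding smooth_curve_def
proof (intro conjI ballI, goal_cases)
  case 1
  then show ?case using assms unfolding smooth_curve_def by auto
next
  case (2 u c)
  obtain D \<phi> where c: "c = (D, \<phi>)" by force
  show ?case unfolding c prod.case
  proof
    assume "\<gamma> (u - r) \<in> D"
    then obtain e \<eta> where e: "e > 0" and \<eta>: "smooth_on {u - r - e<..<u - r + e} \<eta>"
      and eq: "\<And>v. v \<in> {s..t} \<Longrightarrow> v \<in> {u - r - e<..<u - r + e} \<Longrightarrow> \<gamma> v \<in> D \<and> \<phi> (\<gamma> v) = \<eta> v"
      using smooth_curve_extension[OF assms, of D \<phi> "u - r"] 2 c by auto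
    have "smooth_on {u - e<..<u + e} (\<lambda>v. - r + v)"
      using smooth_on_affine[OF bounded_linear_ident] .
    then have "smooth_on {u - e<..<u + e} (\<lambda>v. \<eta> (- r + v))"
      by (rule smooth_on_compose[OF _ _ \<eta>, rotated 2]) auto
    then show "\<exists>e>0. \<exists>\<eta>. smooth_on {u - e<..<u + e} \<eta> \<and>
        (\<forall>v\<in>{s + r..t + r} \<inter> {u - e<..<u + e}. \<gamma> (v - r) \<in> D \<and> \<phi> (\<gamma> (v - r)) = \<eta> v)"
      using e eq by (intro exI[of _ e] conjI exI[of _ "\<lambda>v. \<eta> (- r + v)"]) auto
  qed
qed

lemma velocities_satisfy_shift:
  assumes "smooth_curve M {s..t} \<gamma>" "velocities_satisfy M Q {s..t} \<gamma>" "s < t"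
  shows "velocities_satisfy M Q {s + r..t + r} (\<lambda>u. \<gamma> (u - r))"
  unfolding velocities_satisfy_def
proof (intro ballI, clarify)
  fix u D \<phi> assume u: "u \<in> {s + r..t + r}" and c: "(D, \<phi>) \<in> atlas M" "\<gamma> (u - r) \<in> D"
  have "((\<lambda>t. \<phi> (\<gamma> t)) has_vector_derivative velocity \<phi> {s..t} \<gamma> (u - r)) (at (u - r) within {s..t})"
    using smooth_curve_velocity[OF assms(1) c(1) _ c(2)] u by auto
  moreover have "(\<lambda>u. u - r) ` {s + r..t + r} = {s..t}"
    by (auto simp: image_iff intro!: bexI[of _ "_ + r"])
  moreover have "((\<lambda>u. u - r) has_vector_derivative 1) (at u within {s + r..t + r})"
    by (auto intro!: derivative_eq_intros)
  ultimately have "((\<lambda>v. \<phi> (\<gamma> (v - r))) has_vector_derivative velocity \<phi> {s..t} \<gamma> (u - r))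
      (at u within {s + r..t + r})"
    using vector_diff_chain_within[of "\<lambda>u. u - r" 1 u "{s + r..t + r}" "\<lambda>t. \<phi> (\<gamma> t)"] by (simp add: comp_def)
  then have "velocity \<phi> {s + r..t + r} (\<lambda>u. \<gamma> (u - r)) u = velocity \<phi> {s..t} \<gamma> (u - r)"
    using assms(3) u vector_derivative_within_cbox[of "s + r" "t + r" u] by (auto simp: velocity_def comp_def)
  then show "Q \<phi> (\<gamma> (u - r)) (velocity \<phi> {s + r..t + r} (\<lambda>u. \<gamma> (u - r)) u)"
    using assms(2) c u unfolding velocities_satisfy_def by (auto dest!: bspec[of _ _ "u - r"] bspec[of _ _ "(D, \<phi>)"])
qed

text \<open>Induction on the number of break points strictly between \<open>s\<close> and
  \<open>t\<close>: splitting at one of them leaves fewer on either side, and transitivity glues the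
  two halves.\<close>

lemma piecewise_curve_trans:
  assumes "piecewise_curve M Q I \<gamma>" "is_interval I"
    and step: "\<And>s t. s \<in> I \<Longrightarrow> t \<in> I \<Longrightarrow> s < t \<Longrightarrow> smooth_curve M {s..t} \<gamma> \<Longrightarrow>
      velocities_satisfy M Q {s..t} \<gamma> \<Longrightarrow> R s t"
    and trans: "\<And>s t u. R s t \<Longrightarrow> R t u \<Longrightarrow> R s u"
    and "s \<in> I" "t \<in> I" "s < t"
  shows "R s t"
proof -
  obtain B where B: "\<And>s t. s \<in> I \<Longrightarrow> t \<in> I \<Longrightarrow> finite (B \<inter> {s..t})"
    "\<And>s t. s \<in> I \<Longrightarrow> t \<in> I \<Longrightarrow> s < t \<Longrightarrow> B \<inter> {s<..<t} = {} \<Longrightarrow>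
      smooth_curve M {s..t} \<gamma> \<and> velocities_satisfy M Q {s..t} \<gamma>"
    using assms(1) unfolding piecewise_curve_def by metis
  show ?thesis
    using assms(5-7)
  proof (induction "card (B \<inter> {s<..<t})" arbitrary: s t rule: less_induct)
    case less
    have fin: "finite (B \<inter> {s<..<t})"
      using B(1)[OF less.prems(1,2)] by (rule rev_finite_subset) auto
    show ?case
    proof (cases "B \<inter> {s<..<t} = {}")
      case True
      then show ?thesis using B(2) step less.prems by blast
    next
      case False
      then obtain b where b: "b \<in> B" "s < b" "b < t" by auto
      then have "b \<in> I"
        using \<open>is_interval I\<close> less.prems unfolding is_interval_1 by (meson less_imp_le)
      have "B \<inter> {s<..<b} \<subset> B \<inter> {s<..<t}" "B \<inter> {b<..<t} \<subset> B \<inter> {s<..<t}"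
        using b by auto
      then have "R s b" "R b t"
        using less fin b \<open>b \<in> I\<close> by (auto intro!: less.hyps psubset_card_mono)
      then show ?thesis by (rule trans)
    qed
  qed
qed

section \<open>Open submanifolds\<close>

lemma points_open_submanifold: "points (open_submanifold M U) = points M \<inter> U"
  by (auto simp: points_def open_submanifold_def)

lemma open_submanifold_vec_simps [simp]:
  "timelike_vec (open_submanifold M U) = timelike_vec M"
  "causal_vec (open_submanifold M U) = causal_vec M"
  "future_vec (open_submanifold M U) = future_vec M"
  "past_vec (open_submanifold M U) = past_vec M"
  by (simp_all add: fun_eq_iff timelike_vec_def causal_vec_def lightlike_vec_def future_vec_def
      past_vec_def metric_at_def open_submanifold_def)

lemma smooth_curve_open_submanifold:
  assumes "\<gamma> ` I \<subseteq> U"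
  shows "smooth_curve (open_submanifold M U) I \<gamma> \<longleftrightarrow> smooth_curve M I \<gamma>"
proof
  assume L: "smooth_curve (open_submanifold M U) I \<gamma>"
  show "smooth_curve M I \<gamma>"
    unfolding smooth_curve_def
  proof (intro conjI ballI, goal_cases)
    case 1
    then show ?case using L by (auto simp: smooth_curve_def points_open_submanifold)
  next
    case (2 t c)
    obtain D \<phi> where "c = (D, \<phi>)" by force
    with 2 have c: "c = (D, \<phi>)" "(D \<inter> U, \<phi>) \<in> atlas (open_submanifold M U)"
      by (force simp: open_submanifold_def)+
    show ?case
      unfolding c(1) prod.case
    proof
      assume "\<gamma> t \<in> D"
      then obtain e \<eta> where "e > 0" "smooth_on {t - e<..<t + e} \<eta>"
        "\<And>s. s \<in> I \<Longrightarrow> s \<in> {t - e<..<t + e} \<Longrightarrow> \<gamma> s \<in> D \<inter> U \<and> \<phi> (\<gamma> s) = \<eta> s"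
        using smooth_curve_extension[OF L c(2) \<open>t \<in> I\<close>] assms 2 by blast
      then show "\<exists>e>0. \<exists>\<eta>. smooth_on {t - e<..<t + e} \<eta> \<and>
          (\<forall>s\<in>I \<inter> {t - e<..<t + e}. \<gamma> s \<in> D \<and> \<phi> (\<gamma> s) = \<eta> s)"
        by blast
    qed
  qed
next
  assume L: "smooth_curve M I \<gamma>"
  show "smooth_curve (open_submanifold M U) I \<gamma>"
    unfolding smooth_curve_def
  proof (intro conjI ballI, goal_cases)
    case 1
    then show ?case using L assms by (auto simp: smooth_curve_def points_open_submanifold)
  next
    case (2 t c)
    then obtain D \<phi> where c: "c = (D \<inter> U, \<phi>)" "(D, \<phi>) \<in> atlas M"
      by (force simp: open_submanifold_def)
    show ?case
      unfolding c prod.case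
    proof
      assume "\<gamma> t \<in> D \<inter> U"
      then obtain e \<eta> where "e > 0" "smooth_on {t - e<..<t + e} \<eta>"
        "\<forall>s\<in>I \<inter> {t - e<..<t + e}. \<gamma> s \<in> D \<and> \<phi> (\<gamma> s) = \<eta> s"
        using L c(2) 2 unfolding smooth_curve_def by blast
      then show "\<exists>e>0. \<exists>\<eta>. smooth_on {t - e<..<t + e} \<eta> \<and>
          (\<forall>s\<in>I \<inter> {t - e<..<t + e}. \<gamma> s \<in> D \<inter> U \<and> \<phi> (\<gamma> s) = \<eta> s)"
        using assms by blast
    qed
  qed
qed

lemma velocities_satisfy_open_submanifold:
  assumes "\<gamma> ` I \<subseteq> U"
  shows "velocities_satisfy (open_submanifold M U) Q I \<gamma> \<longleftrightarrow> velocities_satisfy M Q I \<gamma>"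
  using assms by (fastforce simp: open_submanifold_def velocities_satisfy_def split: prod.splits)

text \<open>Lets curves pass between \<open>U\<close> and \<open>M\<close>: those that define the
  Cauchy development live in \<open>U\<close>, whereas achronality of the horizon is a statement
  about \<open>M\<close>.\<close>

lemma piecewise_curve_open_submanifold:
  assumes "\<gamma> ` I \<subseteq> U" "is_interval I"
  shows "piecewise_curve (open_submanifold M U) Q I \<gamma> \<longleftrightarrow> piecewise_curve M Q I \<gamma>"
proof -
  have "\<gamma> ` {s..t} \<subseteq> U" if "s \<in> I" "t \<in> I" for s t
    using assms mem_is_interval_1_I[OF assms(2) that] by auto
  then have "smooth_curve (open_submanifold M U) {s..t} \<gamma> \<longleftrightarrow> smooth_curve M {s..t} \<gamma>"
    "velocities_satisfy (open_submanifold M U) Q {s..t} \<gamma> \<longleftrightarrow> velocities_satisfy M Q {s..t} \<gamma>"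
    if "s \<in> I" "t \<in> I" for s t
    using that smooth_curve_open_submanifold velocities_satisfy_open_submanifold by metis+
  moreover have "\<gamma> ` I \<subseteq> points M \<inter> U \<longleftrightarrow> \<gamma> ` I \<subseteq> points M"
    using assms(1) by blast
  ultimately show ?thesis
    unfolding piecewise_curve_def points_open_submanifold by (simp cong: ball_cong)
qed

section \<open>A chart of a time-oriented Lorentz manifold\<close>

locale lorentz_chart =
  fixes M :: "('a::{t2_space, second_countable_topology}, 'n::finite) lorentz"
    and D :: "'a set" and \<phi> :: "'a \<Rightarrow> real ^ 'n"
  assumes manifold: "time_oriented_lorentz_manifold M" and chart: "(D, \<phi>) \<in> atlas M"
begin

abbreviation \<iota> :: "real ^ 'n \<Rightarrow> 'a" where "\<iota> \<equiv> inv_into D \<phi>"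

lemma is_chart_atlas: "(E, \<psi>) \<in> atlas M \<Longrightarrow> is_chart (E, \<psi>)"
  using manifold by (auto simp: time_oriented_lorentz_manifold_def smooth_manifold_def)

lemma open_D: "open D" and open_image: "open (\<phi> ` D)"
  and homeo: "homeomorphism D (\<phi> ` D) \<phi> \<iota>"
  using is_chart_atlas[OF chart] by (simp_all add: is_chart_def)

lemma continuous_on_coord: "continuous_on D \<phi>" and continuous_on_inv: "continuous_on (\<phi> ` D) \<iota>"
  using homeo by (simp_all add: homeomorphism_def)

lemma inv_coord [simp]: "x \<in> D \<Longrightarrow> \<iota> (\<phi> x) = x" and coord_inv [simp]: "y \<in> \<phi> ` D \<Longrightarrow> \<phi> (\<iota> y) = y"
  and inv_in_D [simp]: "y \<in> \<phi> ` D \<Longrightarrow> \<iota> y \<in> D"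
  using homeo by (auto simp: homeomorphism_def inv_into_into)

lemma D_subset_points: "D \<subseteq> points M"
  using chart by (auto simp: points_def)

lemma open_coord_image:
  assumes "open W" shows "open (\<phi> ` (D \<inter> W))"
proof -
  have "openin (top_of_set (\<phi> ` D)) (\<phi> ` (D \<inter> W))"
    using homeo assms by (intro homeomorphism_imp_open_map) (auto simp: openin_open)
  then show ?thesis using open_image openin_open_trans by blast
qed

lemma open_inv_image:
  assumes "open W" "W \<subseteq> \<phi> ` D" shows "open (\<iota> ` W)"
proof -
  have "openin (top_of_set D) (\<iota> ` W)"
    using homeomorphism_sym[THEN iffD1, OF homeo] assms
    by (intro homeomorphism_imp_open_map) (auto simp: openin_open)
  then show ?thesis using open_D openin_open_trans by blast
qed

lemma smooth_transition:
  assumes "(E, \<psi>) \<in> atlas M" shows "smooth_on (\<phi> ` (D \<inter> E)) (\<lambda>y. \<psi> (\<iota> y))"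
  using manifold chart assms
  by (auto simp: time_oriented_lorentz_manifold_def smooth_manifold_def comp_def)

text \<open>The transition map does not involve the domain of the target chart, so
  \<open>UNIV\<close> stands in for it.\<close>

definition jacobian :: "('a \<Rightarrow> real ^ 'n) \<Rightarrow> 'a \<Rightarrow> real ^ 'n ^ 'n" where
  "jacobian \<psi> x = transition_jacobian (D, \<phi>) (UNIV, \<psi>) x"

lemma jacobian: "transition_jacobian (D, \<phi>) (E, \<psi>) x = jacobian \<psi> x"
  by (simp add: jacobian_def transition_jacobian_def)

lemma has_derivative_transition:
  assumes "(E, \<psi>) \<in> atlas M" "x \<in> D \<inter> E"
  shows "((\<lambda>y. \<psi> (\<iota> y)) has_derivative (\<lambda>v. jacobian \<psi> x *v v)) (at (\<phi> x))"
proof -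
  have d: "((\<lambda>y. \<psi> (\<iota> y)) has_derivative frechet_derivative (\<lambda>y. \<psi> (\<iota> y)) (at (\<phi> x))) (at (\<phi> x))"
    using smooth_on_differentiable[OF smooth_transition[OF assms(1)]] assms(2)
    by (auto simp: frechet_derivative_works)
  then show ?thesis
    using matrix_vector_mul(2)[OF has_derivative_linear[OF d]]
    by (simp add: jacobian_def transition_jacobian_def comp_def)
qed

lemma metric_at_transition:
  assumes "(E, \<psi>) \<in> atlas M" "x \<in> D \<inter> E"
  shows "metric_at M \<phi> x v w = metric_at M \<psi> x (jacobian \<psi> x *v v) (jacobian \<psi> x *v w)"
proof -
  have "metric M \<phi> x = transpose (jacobian \<psi> x) ** metric M \<psi> x ** jacobian \<psi> x"
    using manifold chart assms jacobian
    by (fastforce simp: time_oriented_lorentz_manifold_def lorentz_metric_def Let_def)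
  then have "metric_at M \<phi> x v w =
      v \<bullet> (transpose (jacobian \<psi> x) *v (metric M \<psi> x *v (jacobian \<psi> x *v w)))"
    by (simp only: metric_at_def matrix_vector_mul_assoc matrix_mul_assoc)
  also have "\<dots> = (v v* transpose (jacobian \<psi> x)) \<bullet> (metric M \<psi> x *v (jacobian \<psi> x *v w))"
    by (rule dot_lmul_matrix[symmetric])
  finally show ?thesis
    by (simp only: metric_at_def vector_transpose_matrix)
qed

lemma torient_transition:
  assumes "(E, \<psi>) \<in> atlas M" "x \<in> D \<inter> E"
  shows "torient M \<psi> x = jacobian \<psi> x *v torient M \<phi> x"
  using manifold chart assms jacobian
  by (fastforce simp: time_oriented_lorentz_manifold_def time_orientation_def)

text \<open>Causal character and time direction do not depend on the chart. Velocities of a curve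
  inside \<open>D\<close> therefore need checking in the single chart \<phi>.\<close>

lemma vec_transition:
  assumes "(E, \<psi>) \<in> atlas M" "x \<in> D \<inter> E"
  shows "timelike_vec M \<psi> x (jacobian \<psi> x *v v) \<longleftrightarrow> timelike_vec M \<phi> x v"
    "future_vec M \<psi> x (jacobian \<psi> x *v v) \<longleftrightarrow> future_vec M \<phi> x v"
    "past_vec M \<psi> x (jacobian \<psi> x *v v) \<longleftrightarrow> past_vec M \<phi> x v"
  using metric_at_transition[OF assms] torient_transition[OF assms]
  by (simp_all add: timelike_vec_def future_vec_def past_vec_def)

lemma smooth_curve_inv:
  assumes c: "locally_smooth I c" and cI: "c ` I \<subseteq> \<phi> ` D"
  shows "smooth_curve M I (\<lambda>t. \<iota> (c t))"
  unfolding smooth_curve_def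
proof (intro conjI ballI, goal_cases)
  case 1
  then show ?case using cI D_subset_points inv_in_D by blast
next
  case (2 t C)
  obtain E \<psi> where C: "C = (E, \<psi>)" by force
  with 2 have E: "(E, \<psi>) \<in> atlas M" by simp
  then have "open E" using is_chart_atlas by (simp add: is_chart_def)
  then have opn: "open (\<phi> ` (D \<inter> E))" by (rule open_coord_image)
  show ?case
    unfolding C prod.case
  proof
    assume "\<iota> (c t) \<in> E"
    moreover have "c t \<in> \<phi> ` D" using 2(1) cI by blast
    ultimately have ct: "c t \<in> \<phi> ` (D \<inter> E)"
      by (intro image_eqI[of _ _ "\<iota> (c t)"]) auto
    obtain e \<eta> where e: "e > 0" and \<eta>: "smooth_on {t - e<..<t + e} \<eta>"
      and eq: "\<forall>s\<in>I \<inter> {t - e<..<t + e}. c s = \<eta> s"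
      using c 2(1) unfolding locally_smooth_def by blast
    \<comment> \<open>The extension \<eta> may run out of the overlap of the two charts. Continuity
      shrinks the window until it stays inside, so that the transition map applies to it.\<close>
    have "continuous_on {t - e<..<t + e} \<eta>" using \<eta> by (rule smooth_on_imp_continuous_on)
    then have "open ({t - e<..<t + e} \<inter> \<eta> -` (\<phi> ` (D \<inter> E)))"
      by (rule continuous_open_preimage) (use opn in auto)
    moreover have "t \<in> {t - e<..<t + e} \<inter> \<eta> -` (\<phi> ` (D \<inter> E))"
      using ct e eq 2(1) by auto
    ultimately obtain d where d: "d > 0" "ball t d \<subseteq> {t - e<..<t + e} \<inter> \<eta> -` (\<phi> ` (D \<inter> E))"
      by (meson open_contains_ball)
    have ball: "ball t d = {t - d<..<t + d}" by (auto simp: dist_real_def)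
    have "smooth_on {t - d<..<t + d} \<eta>"
      by (rule smooth_on_subset[OF \<eta>]) (use d ball in blast)
    then have "smooth_on {t - d<..<t + d} (\<lambda>s. \<psi> (\<iota> (\<eta> s)))"
      by (rule smooth_on_compose[OF _ _ smooth_transition[OF E], rotated 2]) (use d ball in auto)
    moreover have "\<iota> (c s) \<in> E \<and> \<psi> (\<iota> (c s)) = \<psi> (\<iota> (\<eta> s))"
      if "s \<in> I" "s \<in> {t - d<..<t + d}" for s
    proof -
      have "s \<in> {t - e<..<t + e}" "\<eta> s \<in> \<phi> ` (D \<inter> E)" using that(2) d ball by auto
      then show ?thesis using eq that(1) by auto
    qed
    ultimately show "\<exists>e>0. \<exists>\<eta>. smooth_on {t - e<..<t + e} \<eta> \<and>
       (\<forall>s\<in>I \<inter> {t - e<..<t + e}. \<iota> (c s) \<in> E \<and> \<psi> (\<iota> (c s)) = \<eta> s)"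
      using d(1) by blast
  qed
qed

lemma velocities_satisfy_inv:
  assumes cI: "c ` {a..b} \<subseteq> \<phi> ` D" and "a < b"
    and Q: "\<And>E \<psi> x v. (E, \<psi>) \<in> atlas M \<Longrightarrow> x \<in> D \<inter> E \<Longrightarrow> Q \<phi> x v \<Longrightarrow> Q \<psi> x (jacobian \<psi> x *v v)"
    and vel: "\<And>t. t \<in> {a..b} \<Longrightarrow> \<exists>v. (c has_vector_derivative v) (at t within {a..b}) \<and> Q \<phi> (\<iota> (c t)) v"
  shows "velocities_satisfy M Q {a..b} (\<lambda>t. \<iota> (c t))"
  unfolding velocities_satisfy_def
proof (intro ballI, clarify)
  fix t E \<psi> assume t: "t \<in> {a..b}" and E: "(E, \<psi>) \<in> atlas M" and tE: "\<iota> (c t) \<in> E"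
  define x where "x = \<iota> (c t)"
  have "c t \<in> \<phi> ` D" using t cI by blast
  then have x: "x \<in> D \<inter> E" "\<phi> x = c t" using tE by (simp_all add: x_def)
  obtain v where v: "(c has_vector_derivative v) (at t within {a..b})" "Q \<phi> x v"
    using vel[OF t] by (auto simp: x_def)
  have "((\<lambda>s. \<psi> (\<iota> (c s))) has_derivative (\<lambda>h. jacobian \<psi> x *v (h *\<^sub>R v))) (at t within {a..b})"
    using has_derivative_compose[OF v(1)[unfolded has_vector_derivative_def]] has_derivative_transition[OF E x(1)]
    unfolding x(2) by blast
  then have "((\<lambda>s. \<psi> (\<iota> (c s))) has_vector_derivative jacobian \<psi> x *v v) (at t within {a..b})"
    by (simp add: has_vector_derivative_def matrix_vector_mult_scaleR)
  then have "velocity \<psi> {a..b} (\<lambda>t. \<iota> (c t)) t = jacobian \<psi> x *v v"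
    using \<open>a < b\<close> t vector_derivative_within_cbox[of a b t] by (simp add: velocity_def comp_def)
  then show "Q \<psi> (\<iota> (c t)) (velocity \<psi> {a..b} (\<lambda>t. \<iota> (c t)) t)"
    using Q[OF E x(1) v(2)] by (simp add: x_def)
qed

lemma piecewise_curve_inv:
  assumes "is_interval I" "continuous_on I c" and cI: "c ` I \<subseteq> \<phi> ` D"
    and Q: "\<And>E \<psi> x v. (E, \<psi>) \<in> atlas M \<Longrightarrow> x \<in> D \<inter> E \<Longrightarrow> Q \<phi> x v \<Longrightarrow> Q \<psi> x (jacobian \<psi> x *v v)"
    and B: "\<And>s t. s \<in> I \<Longrightarrow> t \<in> I \<Longrightarrow> finite (B \<inter> {s..t})"
    and smooth: "\<And>s t. s \<in> I \<Longrightarrow> t \<in> I \<Longrightarrow> s < t \<Longrightarrow> B \<inter> {s<..<t} = {} \<Longrightarrow> locally_smooth {s..t} c"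
    and vel: "\<And>s t u. s \<in> I \<Longrightarrow> t \<in> I \<Longrightarrow> s < t \<Longrightarrow> B \<inter> {s<..<t} = {} \<Longrightarrow> u \<in> {s..t} \<Longrightarrow>
      \<exists>v. (c has_vector_derivative v) (at u within {s..t}) \<and> Q \<phi> (\<iota> (c u)) v"
  shows "piecewise_curve M Q I (\<lambda>t. \<iota> (c t))"
  unfolding piecewise_curve_def
proof (intro conjI exI[of _ B] ballI impI)
  show "continuous_on I (\<lambda>t. \<iota> (c t))"
    by (rule continuous_on_compose2[OF continuous_on_inv assms(2) cI])
  show "(\<lambda>t. \<iota> (c t)) ` I \<subseteq> points M" using cI D_subset_points inv_in_D by blast
next
  fix s t assume st: "s \<in> I" "t \<in> I" and "s < t \<and> B \<inter> {s<..<t} = {}"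
  then have st': "s < t" "B \<inter> {s<..<t} = {}" by auto
  have cst: "c ` {s..t} \<subseteq> \<phi> ` D"
    using cI mem_is_interval_1_I[OF assms(1) st] by auto
  show "smooth_curve M {s..t} (\<lambda>t. \<iota> (c t))"
    by (rule smooth_curve_inv[OF smooth[OF st st'] cst])
  show "velocities_satisfy M Q {s..t} (\<lambda>t. \<iota> (c t))"
    by (rule velocities_satisfy_inv[OF cst st'(1) Q vel[OF st st']])
qed (use B in auto)

end

section \<open>Lorentz products\<close>

lemma continuous_on_matrix_vector_mult [continuous_intros]:
  fixes A :: "'a::topological_space \<Rightarrow> real ^ 'n ^ 'm" and x :: "'a \<Rightarrow> real ^ 'n"
  assumes "continuous_on S A" "continuous_on S x"
  shows "continuous_on S (\<lambda>y. A y *v x y)"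
  unfolding matrix_vector_mult_def by (intro continuous_intros assms)

lemma continuous_on_vector_matrix_mult [continuous_intros]:
  fixes A :: "'a::topological_space \<Rightarrow> real ^ 'n ^ 'm" and x :: "'a \<Rightarrow> real ^ 'm"
  assumes "continuous_on S A" "continuous_on S x"
  shows "continuous_on S (\<lambda>y. x y v* A y)"
  unfolding vector_matrix_mult_def by (intro continuous_intros assms)

lemma norm_matrix_vector_mult_bound:
  obtains B where "B > 0" "\<forall>(A :: real ^ 'n ^ 'm) x. norm (A *v x) \<le> norm A * norm x * B"
proof -
  have "bilinear ((*v) :: real ^ 'n ^ 'm \<Rightarrow> _)"
    unfolding bilinear_def
    by (auto intro!: linearI simp: matrix_vector_right_distrib matrix_vector_mult_add_rdistrib
        matrix_vector_mult_scaleR scaleR_matrix_vector_assoc)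
  then have "bounded_bilinear ((*v) :: real ^ 'n ^ 'm \<Rightarrow> _)"
    by (simp add: bilinear_conv_bounded_bilinear)
  then show thesis using that bounded_bilinear.pos_bounded by blast
qed

text \<open>In the basis given by the columns of \<open>P\<close> the form is that of Minkowski.
  Writing it as the Euclidean product minus twice the time part makes the Euclidean Cauchy-Schwarz
  inequality available.\<close>

lemma lorentz_signature_form:
  fixes G :: "real ^ 'n ^ 'n::finite"
  assumes "lorentz_signature G"
  obtains P :: "real ^ 'n ^ 'n" and i0 where "\<forall>v. \<exists>a. v = P *v a"
    "\<forall>a b. (P *v a) \<bullet> (G *v (P *v b)) = a \<bullet> b - 2 * (a $ i0) * (b $ i0)"
proof -
  obtain P :: "real ^ 'n ^ 'n" and i0 where P: "invertible P"
    "transpose P ** G ** P = (\<chi> i j. if i = j then (if i = i0 then - 1 else 1) else 0)" (is "_ = ?E")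
    using assms unfolding lorentz_signature_def by blast
  have "\<exists>a. v = P *v a" for v
  proof -
    obtain Q where "P ** Q = mat 1" using P(1) invertible_def by blast
    then have "v = P *v (Q *v v)" by (simp add: matrix_vector_mul_assoc)
    then show ?thesis ..
  qed
  moreover have "(P *v a) \<bullet> (G *v (P *v b)) = a \<bullet> b - 2 * (a $ i0) * (b $ i0)" for a b
  proof -
    have "(P *v a) \<bullet> (G *v (P *v b)) = a \<bullet> (transpose P *v (G *v (P *v b)))"
      by (simp only: dot_lmul_matrix[symmetric] vector_transpose_matrix)
    also have "\<dots> = a \<bullet> (?E *v b)"
      by (simp only: matrix_vector_mul_assoc matrix_mul_assoc P(2))
    also have "?E *v b = (\<chi> i. (if i = i0 then - 1 else 1) * b $ i)"
      by (simp add: matrix_vector_mult_def vec_eq_iff if_distrib[of "\<lambda>x. x * _"] cong: if_cong)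
    also have "a \<bullet> \<dots> = (\<Sum>i\<in>UNIV. a $ i * b $ i - (if i = i0 then 2 * (a $ i0) * (b $ i0) else 0))"
      unfolding inner_vec_def by (intro sum.cong) auto
    also have "\<dots> = a \<bullet> b - 2 * (a $ i0) * (b $ i0)"
      by (simp add: sum_subtractf inner_vec_def)
    finally show ?thesis .
  qed
  ultimately show thesis using that by blast
qed

lemma lorentz_signature_sym:
  fixes G :: "real ^ 'n ^ 'n::finite"
  assumes "lorentz_signature G"
  shows "v \<bullet> (G *v w) = w \<bullet> (G *v v)"
proof -
  obtain P :: "real ^ 'n ^ 'n" and i0 where P: "\<forall>v. \<exists>a. v = P *v a"
    "\<forall>a b. (P *v a) \<bullet> (G *v (P *v b)) = a \<bullet> b - 2 * (a $ i0) * (b $ i0)"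
    using lorentz_signature_form[OF assms] by blast
  then obtain a b where "v = P *v a" "w = P *v b" by blast
  then show ?thesis by (simp add: P(2) inner_commute)
qed

text \<open>A reversed Cauchy-Schwarz argument. Orthogonality says that the spatial parts
  \<open>a'\<close> and \<open>b'\<close> have the product of the time components as their inner
  product; if \<open>v\<close> were causal, the time components would be too large for
  Cauchy-Schwarz on the spatial parts.\<close>

lemma lorentz_signature_orthogonal_timelike:
  fixes G :: "real ^ 'n ^ 'n::finite"
  assumes "lorentz_signature G" "T \<bullet> (G *v T) < 0" "T \<bullet> (G *v v) = 0" "v \<noteq> 0"
  shows "v \<bullet> (G *v v) > 0"
proof (rule ccontr)
  obtain P :: "real ^ 'n ^ 'n" and i0 where P: "\<forall>v. \<exists>a. v = P *v a"
    "\<forall>a b. (P *v a) \<bullet> (G *v (P *v b)) = a \<bullet> b - 2 * (a $ i0) * (b $ i0)"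
    using lorentz_signature_form[OF assms(1)] by blast
  then obtain a b where ab: "T = P *v a" "v = P *v b" by blast
  assume "\<not> v \<bullet> (G *v v) > 0"
  then have b: "b \<bullet> b \<le> 2 * (b $ i0)\<^sup>2" using P(2)[rule_format, of b b] ab by (simp add: power2_eq_square)
  have a: "a \<bullet> a < 2 * (a $ i0)\<^sup>2" and c: "a \<bullet> b = 2 * (a $ i0) * (b $ i0)"
    using assms(2,3) P(2)[rule_format, of a a] P(2)[rule_format, of a b] ab by (simp_all add: power2_eq_square)
  define a' where "a' = a - (a $ i0) *\<^sub>R axis i0 1"
  define b' where "b' = b - (b $ i0) *\<^sub>R axis i0 1"
  have *: "a' \<bullet> b' = (a $ i0) * (b $ i0)" "a' \<bullet> a' < (a $ i0)\<^sup>2" "b' \<bullet> b' \<le> (b $ i0)\<^sup>2"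
    using a b c by (simp_all add: a'_def b'_def inner_diff_left inner_diff_right inner_axis
        inner_axis' power2_eq_square inner_axis_axis)
  have "b \<noteq> 0" using ab assms(4) by auto
  then have "0 < 2 * (b $ i0)\<^sup>2" using b by (intro less_le_trans[OF _ b]) simp
  then have "b $ i0 \<noteq> 0" by auto
  then have "(b $ i0)\<^sup>2 > 0" by simp
  have "(a $ i0)\<^sup>2 * (b $ i0)\<^sup>2 = (a' \<bullet> b')\<^sup>2" by (simp add: * power_mult_distrib)
  also have "\<dots> \<le> (a' \<bullet> a') * (b' \<bullet> b')" by (rule Cauchy_Schwarz_ineq)
  also have "\<dots> \<le> (a' \<bullet> a') * (b $ i0)\<^sup>2" using * by (intro mult_left_mono) auto
  also have "\<dots> < (a $ i0)\<^sup>2 * (b $ i0)\<^sup>2" using * \<open>(b $ i0)\<^sup>2 > 0\<close> by (intro mult_strict_right_mono)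
  finally show False by simp
qed

text \<open>Positivity on the orthogonal complement of \<open>T\<close> becomes uniform because the
  unit sphere of that complement is compact. In dimension one this sphere is empty and the constant
  is arbitrary.\<close>

lemma lorentz_signature_orthogonal_bound:
  fixes G :: "real ^ 'n ^ 'n::finite"
  assumes "lorentz_signature G" "T \<bullet> (G *v T) < 0"
  obtains \<alpha> where "\<alpha> > 0" "\<And>w. T \<bullet> (G *v w) = 0 \<Longrightarrow> \<alpha> * (norm w)\<^sup>2 \<le> w \<bullet> (G *v w)"
proof -
  define C where "C = sphere 0 1 \<inter> {w. T \<bullet> (G *v w) = 0}"
  have "closed {w. T \<bullet> (G *v w) = 0}"
    by (intro closed_Collect_eq continuous_intros)
  then have C: "compact C" unfolding C_def by (intro compact_Int_closed compact_sphere)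
  have cont: "continuous_on C (\<lambda>w. w \<bullet> (G *v w))" by (intro continuous_intros)
  have pos: "w \<bullet> (G *v w) > 0" if "w \<in> C" for w
    using lorentz_signature_orthogonal_timelike[OF assms, of w] that by (force simp: C_def)
  have "\<exists>\<alpha>>0. \<forall>w\<in>C. \<alpha> \<le> w \<bullet> (G *v w)"
  proof (cases "C = {}")
    case False
    then show ?thesis using continuous_attains_inf[OF C _ cont] pos by blast
  qed (auto intro: exI[of _ 1])
  then obtain \<alpha> where \<alpha>: "\<alpha> > 0" "\<And>w. w \<in> C \<Longrightarrow> \<alpha> \<le> w \<bullet> (G *v w)" by blast
  have "\<alpha> * (norm w)\<^sup>2 \<le> w \<bullet> (G *v w)" if "T \<bullet> (G *v w) = 0" for w
  proof (cases "w = 0")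
    case False
    then have "w /\<^sub>R norm w \<in> C" using that by (simp add: C_def matrix_vector_mult_scaleR)
    then have "\<alpha> \<le> (w \<bullet> (G *v w)) / (norm w)\<^sup>2"
      using \<alpha>(2) by (fastforce simp: matrix_vector_mult_scaleR power2_eq_square divide_simps)
    then show ?thesis using False by (simp add: pos_le_divide_eq)
  qed simp
  then show thesis using that \<alpha>(1) by blast
qed

section \<open>Metric and time orientation in coordinates\<close>

context lorentz_chart
begin

definition gram :: "real ^ 'n \<Rightarrow> real ^ 'n ^ 'n" where "gram y = metric M \<phi> (\<iota> y)"
definition ori :: "real ^ 'n \<Rightarrow> real ^ 'n" where "ori y = torient M \<phi> (\<iota> y)"

lemma vec_iff_gram:
  "timelike_vec M \<phi> (\<iota> y) v \<longleftrightarrow> v \<bullet> (gram y *v v) < 0"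
  "causal_vec M \<phi> (\<iota> y) v \<longleftrightarrow> v \<noteq> 0 \<and> v \<bullet> (gram y *v v) \<le> 0"
  "future_vec M \<phi> (\<iota> y) v \<longleftrightarrow> ori y \<bullet> (gram y *v v) < 0"
  "past_vec M \<phi> (\<iota> y) v \<longleftrightarrow> ori y \<bullet> (gram y *v v) > 0"
  by (auto simp: timelike_vec_def causal_vec_def lightlike_vec_def future_vec_def past_vec_def
      metric_at_def gram_def ori_def)

lemma smooth_gram: "smooth_on (\<phi> ` D) gram"
  using manifold chart
  by (auto simp: time_oriented_lorentz_manifold_def lorentz_metric_def gram_def[abs_def] comp_def)

lemma signature_gram: "y \<in> \<phi> ` D \<Longrightarrow> lorentz_signature (gram y)"
  using manifold chart inv_in_D[of y]
  by (fastforce simp: time_oriented_lorentz_manifold_def lorentz_metric_def gram_def)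

lemma continuous_on_ori: "continuous_on (\<phi> ` D) ori"
proof -
  have "continuous_on D (torient M \<phi>)"
    using manifold chart by (auto simp: time_oriented_lorentz_manifold_def time_orientation_def)
  then show ?thesis
    unfolding ori_def[abs_def] by (rule continuous_on_compose2[OF _ continuous_on_inv]) auto
qed

lemma ori_timelike: "y \<in> \<phi> ` D \<Longrightarrow> ori y \<bullet> (gram y *v ori y) < 0"
  using manifold chart inv_in_D[of y]
  by (fastforce simp: time_oriented_lorentz_manifold_def time_orientation_def metric_at_def gram_def ori_def)

end

text \<open>
  A ball of coordinates on which the metric is nearly constant: \<open>\<tau>\<close> is a linear time function and
  \<open>e\<close> a timelike direction. In assumption \<open>push\<close>, \<open>y\<close> is moved by \<open>f *\<^sub>R e\<close>, which tilts the
  light cone by \<open>O(f)\<close>; adding \<open>(\<mu> * \<tau> v) *\<^sub>R e\<close> to a causal vector compensates this tilt as soon as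
  \<open>\<mu>\<close> is at least a fixed multiple of \<open>\<bar>f\<bar>\<close>.
\<close>

locale cone_chart = lorentz_chart M D \<phi>
  for M :: "('a::{t2_space, second_countable_topology}, 'n::finite) lorentz" and D \<phi> +
  fixes y0 :: "real ^ 'n" and R :: real and \<tau> :: "real ^ 'n \<Rightarrow> real" and e :: "real ^ 'n"
    and K \<kappa> m :: real
  assumes R: "R > 0" and ball_subset: "ball y0 R \<subseteq> \<phi> ` D" and \<tau>: "bounded_linear \<tau>" "\<tau> e = 1"
    and K: "K > 0" and \<kappa>: "\<kappa> > 0"
    and past_cone: "\<And>y v. y \<in> ball y0 R \<Longrightarrow> causal_vec M \<phi> (\<iota> y) v \<Longrightarrow> past_vec M \<phi> (\<iota> y) v \<Longrightarrow>
      \<tau> v < 0 \<and> norm v \<le> K * (- \<tau> v)"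
    and narrow_cone: "\<And>y v. y \<in> ball y0 R \<Longrightarrow> norm (v - e) < \<kappa> \<Longrightarrow>
      timelike_vec M \<phi> (\<iota> y) v \<and> future_vec M \<phi> (\<iota> y) v"
    and push: "\<And>y v f \<mu>. y \<in> ball y0 R \<Longrightarrow> y + f *\<^sub>R e \<in> ball y0 R \<Longrightarrow> \<mu> > 0 \<Longrightarrow> \<bar>f\<bar> \<le> \<mu> * m \<Longrightarrow>
      causal_vec M \<phi> (\<iota> y) v \<Longrightarrow> past_vec M \<phi> (\<iota> y) v \<Longrightarrow>
      timelike_vec M \<phi> (\<iota> (y + f *\<^sub>R e)) (v + (\<mu> * \<tau> v) *\<^sub>R e) \<and>
      past_vec M \<phi> (\<iota> (y + f *\<^sub>R e)) (v + (\<mu> * \<tau> v) *\<^sub>R e)"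
    and width: "\<And>y y'. y \<in> ball y0 R \<Longrightarrow> y' \<in> ball y0 R \<Longrightarrow> \<bar>\<tau> y - \<tau> y'\<bar> \<le> m"

section \<open>Existence of cone charts\<close>

context lorentz_chart
begin

text \<open>Mean value inequality along a segment in direction \<open>e\<close>, with the derivative
  of the metric bounded on the compact ball. Mere continuity would not suffice for
  \<open>push\<close>: the error must be linear in \<bar>f\<bar> to be outweighed by a gain
  proportional to \<mu>.\<close>

lemma gram_lipschitz_along:
  assumes "cball y0 r \<subseteq> \<phi> ` D"
  obtains L where "L > 0" "\<And>y f v. y \<in> ball y0 r \<Longrightarrow> y + f *\<^sub>R e \<in> ball y0 r \<Longrightarrow>
    v \<bullet> (gram (y + f *\<^sub>R e) *v v) \<le> v \<bullet> (gram y *v v) + L * \<bar>f\<bar> * (norm v)\<^sup>2"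
proof -
  define g' where "g' y = frechet_derivative gram (at y) e" for y
  have "continuous_on (\<phi> ` D) g'"
    unfolding g'_def using smooth_gram smooth_on_derivative smooth_on_imp_continuous_on by blast
  then have "compact (g' ` cball y0 r)"
    using assms by (meson compact_cball compact_continuous_image continuous_on_subset)
  then have "bounded (g' ` cball y0 r)" by (rule compact_imp_bounded)
  then obtain L0 where L0: "L0 > 0" "\<And>y. y \<in> cball y0 r \<Longrightarrow> norm (g' y) \<le> L0"
    unfolding bounded_pos by auto
  obtain B where B: "B > 0" "\<forall>(A :: real ^ 'n ^ 'n) x. norm (A *v x) \<le> norm A * norm x * B"
    using norm_matrix_vector_mult_bound by blast
  have lip: "norm (gram (y + f *\<^sub>R e) - gram y) \<le> L0 * \<bar>f\<bar>"
    if y: "y \<in> ball y0 r" "y + f *\<^sub>R e \<in> ball y0 r" for y f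
  proof -
    have in_ball: "y + s *\<^sub>R e \<in> ball y0 r" if s: "s \<in> closed_segment 0 f" for s
    proof -
      obtain u where u: "0 \<le> u" "u \<le> 1" "s = u * f" using s by (auto simp: in_segment)
      then have "y + s *\<^sub>R e = (1 - u) *\<^sub>R y + u *\<^sub>R (y + f *\<^sub>R e)" by (simp add: algebra_simps)
      then show ?thesis using u y convex_ball[of y0 r] by (simp add: convex_alt)
    qed
    have "norm (gram (y + f *\<^sub>R e) - gram (y + 0 *\<^sub>R e)) \<le> L0 * norm (f - 0)"
    proof (rule differentiable_bound[of "closed_segment 0 f" "\<lambda>s. gram (y + s *\<^sub>R e)" "\<lambda>s t. t *\<^sub>R g' (y + s *\<^sub>R e)"])
      fix s assume "s \<in> closed_segment 0 f"
      then have s: "y + s *\<^sub>R e \<in> ball y0 r" by (rule in_ball)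
      then have "gram differentiable (at (y + s *\<^sub>R e))"
        using assms ball_subset_cball by (blast intro: smooth_on_differentiable[OF smooth_gram])
      then have d: "(gram has_derivative frechet_derivative gram (at (y + s *\<^sub>R e))) (at (y + s *\<^sub>R e))"
        by (simp add: frechet_derivative_works)
      have "((\<lambda>s. y + s *\<^sub>R e) has_derivative (\<lambda>t. t *\<^sub>R e)) (at s within closed_segment 0 f)"
        by (auto intro!: derivative_eq_intros)
      from has_derivative_compose[OF this d]
      show "((\<lambda>s. gram (y + s *\<^sub>R e)) has_derivative (\<lambda>t. t *\<^sub>R g' (y + s *\<^sub>R e))) (at s within closed_segment 0 f)"
        using has_derivative_linear[OF d] by (simp add: linear_cmul g'_def)
      have "norm (g' (y + s *\<^sub>R e)) \<le> L0" using s L0(2) by simp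
      then show "onorm (\<lambda>t. t *\<^sub>R g' (y + s *\<^sub>R e)) \<le> L0"
        by (intro onorm_le) (simp add: mult.commute[of L0] mult_left_mono)
    qed auto
    then show ?thesis by simp
  qed
  show thesis
  proof
    show "L0 * B > 0" using L0 B by simp
    fix y f v assume y: "y \<in> ball y0 r" "y + f *\<^sub>R e \<in> ball y0 r"
    have "v \<bullet> (gram (y + f *\<^sub>R e) *v v) - v \<bullet> (gram y *v v) = v \<bullet> ((gram (y + f *\<^sub>R e) - gram y) *v v)"
      by (simp add: matrix_vector_mult_diff_rdistrib inner_diff_right)
    also have "\<dots> \<le> norm v * norm ((gram (y + f *\<^sub>R e) - gram y) *v v)"
      by (rule norm_cauchy_schwarz)
    also have "\<dots> \<le> norm v * (L0 * \<bar>f\<bar> * norm v * B)"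
      using lip[OF y] B
      by (intro mult_left_mono order_trans[OF B(2)[rule_format]] mult_right_mono) auto
    finally show "v \<bullet> (gram (y + f *\<^sub>R e) *v v) \<le> v \<bullet> (gram y *v v) + L0 * B * \<bar>f\<bar> * (norm v)\<^sup>2"
      by (simp add: algebra_simps power2_eq_square)
  qed
qed

lemma gram_close:
  assumes "y0 \<in> \<phi> ` D" "\<epsilon> > 0"
  obtains r where "r > 0" "ball y0 r \<subseteq> \<phi> ` D"
    "\<And>y v w. y \<in> ball y0 r \<Longrightarrow> \<bar>v \<bullet> (gram y *v w) - v \<bullet> (gram y0 *v w)\<bar> \<le> \<epsilon> * norm v * norm w"
    "\<And>y w. y \<in> ball y0 r \<Longrightarrow> \<bar>ori y \<bullet> (gram y *v w) - ori y0 \<bullet> (gram y0 *v w)\<bar> \<le> \<epsilon> * norm w"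
proof -
  obtain B where B: "B > 0" "\<forall>(A :: real ^ 'n ^ 'n) x. norm (A *v x) \<le> norm A * norm x * B"
    using norm_matrix_vector_mult_bound by blast
  have cont: "continuous_on (\<phi> ` D) gram" by (rule smooth_on_imp_continuous_on[OF smooth_gram])
  have "continuous_on (\<phi> ` D) (\<lambda>y. norm (gram y - gram y0) * B)"
    "continuous_on (\<phi> ` D) (\<lambda>y. norm (ori y v* gram y - ori y0 v* gram y0))"
    by (intro continuous_intros cont continuous_on_ori)+
  then have "continuous (at y0) (\<lambda>y. norm (gram y - gram y0) * B)"
    "continuous (at y0) (\<lambda>y. norm (ori y v* gram y - ori y0 v* gram y0))"
    using assms(1) open_image continuous_on_eq_continuous_at by blast+
  then obtain d1 d2 where d: "d1 > 0" "d2 > 0"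
    "\<And>y. dist y y0 < d1 \<Longrightarrow> norm (gram y - gram y0) * B < \<epsilon>"
    "\<And>y. dist y y0 < d2 \<Longrightarrow> norm (ori y v* gram y - ori y0 v* gram y0) < \<epsilon>"
    using \<open>\<epsilon> > 0\<close> unfolding continuous_at_eps_delta
    by (fastforce simp: dist_real_def)
  obtain d3 where d3: "d3 > 0" "ball y0 d3 \<subseteq> \<phi> ` D"
    using assms(1) open_image open_contains_ball by blast
  show thesis
  proof
    show "min d1 (min d2 d3) > 0" using d d3 by simp
    show "ball y0 (min d1 (min d2 d3)) \<subseteq> \<phi> ` D" using d3 by auto
  next
    fix y v w assume "y \<in> ball y0 (min d1 (min d2 d3))"
    then have "norm (gram y - gram y0) * B \<le> \<epsilon>" using d(3)[of y] by (simp add: dist_commute)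
    have "\<bar>v \<bullet> (gram y *v w) - v \<bullet> (gram y0 *v w)\<bar> = \<bar>v \<bullet> ((gram y - gram y0) *v w)\<bar>"
      by (simp add: matrix_vector_mult_diff_rdistrib inner_diff_right)
    also have "\<dots> \<le> norm v * norm ((gram y - gram y0) *v w)"
      by (rule Cauchy_Schwarz_ineq2)
    also have "\<dots> \<le> norm v * (norm (gram y - gram y0) * norm w * B)"
      using B(2) by (intro mult_left_mono) auto
    also have "\<dots> = (norm (gram y - gram y0) * B) * (norm v * norm w)" by simp
    also have "\<dots> \<le> \<epsilon> * (norm v * norm w)"
      using \<open>norm (gram y - gram y0) * B \<le> \<epsilon>\<close> by (intro mult_right_mono) auto
    finally show "\<bar>v \<bullet> (gram y *v w) - v \<bullet> (gram y0 *v w)\<bar> \<le> \<epsilon> * norm v * norm w" by simp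
  next
    fix y w assume "y \<in> ball y0 (min d1 (min d2 d3))"
    then have *: "norm (ori y v* gram y - ori y0 v* gram y0) \<le> \<epsilon>" using d(4)[of y] by (simp add: dist_commute)
    have "\<bar>ori y \<bullet> (gram y *v w) - ori y0 \<bullet> (gram y0 *v w)\<bar> = \<bar>(ori y v* gram y - ori y0 v* gram y0) \<bullet> w\<bar>"
      by (simp add: dot_lmul_matrix inner_diff_left)
    also have "\<dots> \<le> norm (ori y v* gram y - ori y0 v* gram y0) * norm w"
      by (rule Cauchy_Schwarz_ineq2)
    also have "\<dots> \<le> \<epsilon> * norm w" using * by (intro mult_right_mono) auto
    finally show "\<bar>ori y \<bullet> (gram y *v w) - ori y0 \<bullet> (gram y0 *v w)\<bar> \<le> \<epsilon> * norm w" .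
  qed
qed

text \<open>Being timelike and future directed is an open condition on pairs of a base point and a
  vector, and a product neighbourhood of \<open>(y0, e)\<close> yields separate radii. The maximum
  \<open>h\<close> expresses both conditions by one strict inequality.\<close>

lemma narrow_cone_exists:
  assumes "y0 \<in> \<phi> ` D" "e \<bullet> (gram y0 *v e) < 0" "ori y0 \<bullet> (gram y0 *v e) < 0"
  obtains r \<kappa> where "r > 0" "\<kappa> > 0" "\<forall>y v. y \<in> ball y0 r \<longrightarrow> norm (v - e) < \<kappa> \<longrightarrow>
    v \<bullet> (gram y *v v) < 0 \<and> ori y \<bullet> (gram y *v v) < 0"
proof -
  let ?S = "\<phi> ` D \<times> (UNIV :: (real ^ 'n) set)"
  have "open ?S" using open_image by (intro open_Times) auto
  have cont: "continuous_on (\<phi> ` D) gram" by (rule smooth_on_imp_continuous_on[OF smooth_gram])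
  have [continuous_intros]: "continuous_on ?S (\<lambda>z. gram (fst z))" "continuous_on ?S (\<lambda>z. ori (fst z))"
    by (rule continuous_on_compose2[OF cont] continuous_on_compose2[OF continuous_on_ori],
        auto intro: continuous_intros)+
  define h where "h z = max (snd z \<bullet> (gram (fst z) *v snd z)) (ori (fst z) \<bullet> (gram (fst z) *v snd z))" for z
  have "continuous_on ?S h"
    unfolding h_def by (intro continuous_intros)
  then have opn: "open (?S \<inter> h -` {..<0})"
    by (rule continuous_open_preimage[OF _ \<open>open ?S\<close>]) simp
  have mem: "(y0, e) \<in> ?S \<inter> h -` {..<0}" using assms by (simp add: h_def)
  obtain A B where AB: "open A" "open B" "(y0, e) \<in> A \<times> B" "A \<times> B \<subseteq> ?S \<inter> h -` {..<0}"
    using open_prod_elim[OF opn mem] by blast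
  then obtain r \<kappa> where r: "r > 0" "ball y0 r \<subseteq> A" "\<kappa> > 0" "ball e \<kappa> \<subseteq> B"
    by (metis SigmaE2 open_contains_ball)
  have "v \<bullet> (gram y *v v) < 0 \<and> ori y \<bullet> (gram y *v v) < 0"
    if "y \<in> ball y0 r" "norm (v - e) < \<kappa>" for y v
  proof -
    have "(y, v) \<in> A \<times> B" using that r by (auto simp: dist_norm norm_minus_commute)
    then have "h (y, v) < 0" using AB(4) by blast
    then show ?thesis by (simp add: h_def)
  qed
  then show thesis using that r by blast
qed

text \<open>All bounds come from the form at \<open>y0\<close>, for which \<open>e\<close> is
  orthogonal to the kernel of \<tau>; the radius is then so small that the error of replacing
  \<open>gram y\<close> by \<open>gram y0\<close> is absorbed.\<close>

lemma cone_chart_exists: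
  assumes y0: "y0 \<in> \<phi> ` D"
  obtains R \<tau> e K \<kappa> m where "cone_chart M D \<phi> y0 R \<tau> e K \<kappa> m"
proof -
  define T where "T = ori y0"
  \<comment> \<open>Up to sign, \<tau> is the product with the time orientation \<open>T\<close> at
    \<open>y0\<close>; the factor \<beta> scales \<open>T\<close> to the vector \<open>e\<close>
    with \<open>\<tau> e = 1\<close>.\<close>
  define \<beta> where "\<beta> = - 1 / (T \<bullet> (gram y0 *v T))"
  define e where "e = \<beta> *\<^sub>R T"
  define \<tau> where "\<tau> v = - (T \<bullet> (gram y0 *v v))" for v
  have T: "T \<bullet> (gram y0 *v T) < 0" using ori_timelike[OF y0] by (simp add: T_def)
  then have \<beta>: "\<beta> > 0" by (simp add: \<beta>_def divide_pos_neg)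
  have \<tau>_lin: "bounded_linear \<tau>"
    unfolding \<tau>_def
    by (intro linear_conv_bounded_linear[THEN iffD1] linearI)
      (simp_all add: matrix_vector_right_distrib inner_add_right matrix_vector_mult_scaleR)
  interpret \<tau>: bounded_linear \<tau> by (rule \<tau>_lin)
  have sig: "lorentz_signature (gram y0)" using signature_gram[OF y0] .
  have \<tau>e: "\<tau> e = 1"
  proof -
    have "\<tau> e = - \<beta> * (T \<bullet> (gram y0 *v T))"
      by (simp add: \<tau>_def e_def matrix_vector_mult_scaleR)
    then show ?thesis using T by (simp add: \<beta>_def)
  qed
  have e_left: "e \<bullet> (gram y0 *v v) = - \<beta> * \<tau> v" for v by (simp add: e_def \<tau>_def)
  have e_right: "v \<bullet> (gram y0 *v e) = - \<beta> * \<tau> v" for v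
    using lorentz_signature_sym[OF sig] e_left by metis
  obtain \<alpha> where \<alpha>: "\<alpha> > 0" "\<And>w. \<tau> w = 0 \<Longrightarrow> \<alpha> * (norm w)\<^sup>2 \<le> w \<bullet> (gram y0 *v w)"
    using lorentz_signature_orthogonal_bound[OF sig T] by (simp add: \<tau>_def) blast
  \<comment> \<open>The constant in \<open>(norm v)\<^sup>2 \<le> C * (\<tau> v)\<^sup>2\<close> for
    causal \<open>v\<close>, obtained below from the splitting of \<open>v\<close> into a multiple
    of \<open>e\<close> and a part in the kernel of \<tau>. Since \<open>C \<le> K\<^sup>2\<close>,
    taking \<open>K = C + 1\<close> avoids a square root.\<close>
  define C where "C = 4 * (norm e)\<^sup>2 + 4 * \<beta> / \<alpha>"
  define K where "K = C + 1"
  have C: "C > 0" unfolding C_def using \<alpha>(1) \<beta> by (intro add_nonneg_pos) auto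
  then have K: "K > 0" "C \<le> K\<^sup>2" by (auto simp: K_def power2_eq_square algebra_simps)
  have "e \<noteq> 0" using \<tau>e \<tau>.zero by force
  \<comment> \<open>The three bounds in turn absorb the error in the causal inequality, keep \<tau>
    in agreement with the time direction of \<open>v\<close>, and keep the product of
    \<open>v\<close> with \<open>e\<close> at least half of its value at \<open>y0\<close>.\<close>
  define \<epsilon> where "\<epsilon> = min (\<alpha> / 4) (min (1 / (2 * K)) (\<beta> / (2 * K * norm e)))"
  have "\<epsilon> > 0" using \<alpha>(1) K \<beta> \<open>e \<noteq> 0\<close> by (simp add: \<epsilon>_def)
  have "\<epsilon> \<le> \<alpha> / 4" "\<epsilon> \<le> 1 / (2 * K)" "\<epsilon> \<le> \<beta> / (2 * K * norm e)" by (simp_all add: \<epsilon>_def)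
  then have \<epsilon>: "4 * \<epsilon> \<le> \<alpha>" "2 * (\<epsilon> * K) \<le> 1" "2 * (\<epsilon> * K * norm e) \<le> \<beta>"
    using K \<open>e \<noteq> 0\<close> by (simp_all add: field_simps)
  obtain r1 where r1: "r1 > 0" "ball y0 r1 \<subseteq> \<phi> ` D"
    "\<And>y v w. y \<in> ball y0 r1 \<Longrightarrow> \<bar>v \<bullet> (gram y *v w) - v \<bullet> (gram y0 *v w)\<bar> \<le> \<epsilon> * norm v * norm w"
    "\<And>y w. y \<in> ball y0 r1 \<Longrightarrow> \<bar>ori y \<bullet> (gram y *v w) - ori y0 \<bullet> (gram y0 *v w)\<bar> \<le> \<epsilon> * norm w"
    by (rule gram_close[OF y0 \<open>\<epsilon> > 0\<close>], rule that) blast+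
  have ey0: "e \<bullet> (gram y0 *v e) < 0" "ori y0 \<bullet> (gram y0 *v e) < 0"
    using e_left[of e] \<tau>e \<beta> by (simp_all add: \<tau>_def T_def)
  obtain r2 \<kappa> where r2: "r2 > 0" "\<kappa> > 0" "\<forall>y v. y \<in> ball y0 r2 \<longrightarrow> norm (v - e) < \<kappa> \<longrightarrow>
    v \<bullet> (gram y *v v) < 0 \<and> ori y \<bullet> (gram y *v v) < 0"
    using narrow_cone_exists[OF y0 ey0] by blast
  obtain r3 where r3: "r3 > 0" "cball y0 r3 \<subseteq> \<phi> ` D"
    using y0 open_image open_contains_cball by blast
  obtain L where L: "L > 0" "\<And>y f v. y \<in> ball y0 r3 \<Longrightarrow> y + f *\<^sub>R e \<in> ball y0 r3 \<Longrightarrow>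
    v \<bullet> (gram (y + f *\<^sub>R e) *v v) \<le> v \<bullet> (gram y *v v) + L * \<bar>f\<bar> * (norm v)\<^sup>2"
    by (rule gram_lipschitz_along[OF r3(2)], rule that) blast+
  \<comment> \<open>With this \<open>m\<close>, a displacement of size at most
    \<open>\<mu> * m\<close> costs at most \<open>\<mu> * \<beta> * (\<tau> v)\<^sup>2\<close> in
    the square of \<open>v\<close>, which is exactly what the cross term with \<open>e\<close> pays
    back in \<open>push\<close>.\<close>
  define m where "m = \<beta> / (L * K\<^sup>2)"
  have m: "m > 0" "L * m * K\<^sup>2 = \<beta>" using \<beta> L(1) K by (simp_all add: m_def)
  obtain B where B: "B > 0" "\<And>x. norm (\<tau> x) \<le> norm x * B" using \<tau>.pos_bounded by blast
  \<comment> \<open>The last bound makes the spread of \<tau> over the ball, at most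
    \<open>2 * R * B\<close>, no larger than \<open>m\<close>.\<close>
  define R where "R = min (min r1 r2) (min r3 (m / (2 * B)))"
  have R: "R > 0" "ball y0 R \<subseteq> ball y0 r1" "ball y0 R \<subseteq> ball y0 r2" "ball y0 R \<subseteq> ball y0 r3"
    "R \<le> m / (2 * B)"
    using r1 r2 r3 m B by (auto simp: R_def)
  have past_cone: "\<tau> v < 0 \<and> norm v \<le> K * (- \<tau> v)"
    if y: "y \<in> ball y0 R" and v: "v \<bullet> (gram y *v v) \<le> 0" "ori y \<bullet> (gram y *v v) > 0" for y v
  proof -
    \<comment> \<open>\<open>w\<close> is the part of \<open>v\<close> orthogonal to
      \<open>e\<close> at \<open>y0\<close>, so that the square of \<open>v\<close> splits there
      without a cross term.\<close>
    define w where "w = v - \<tau> v *\<^sub>R e"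
    have w: "\<tau> w = 0" by (simp add: w_def \<tau>.diff \<tau>.scaleR \<tau>e)
    have "v \<bullet> (gram y0 *v v) - v \<bullet> (gram y *v v) \<le> \<epsilon> * norm v * norm v"
      using r1(3)[of y v v] y R(2) by fastforce
    then have "v \<bullet> (gram y0 *v v) \<le> \<epsilon> * (norm v)\<^sup>2"
      using v(1) by (simp add: power2_eq_square)
    moreover have "v \<bullet> (gram y0 *v v) = w \<bullet> (gram y0 *v w) - \<beta> * (\<tau> v)\<^sup>2"
    proof -
      have "v = w + \<tau> v *\<^sub>R e" by (simp add: w_def)
      then have "v \<bullet> (gram y0 *v v) = (w + \<tau> v *\<^sub>R e) \<bullet> (gram y0 *v (w + \<tau> v *\<^sub>R e))" by simp
      also have "\<dots> = w \<bullet> (gram y0 *v w) - \<beta> * (\<tau> v)\<^sup>2"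
        using e_left[of w] e_right[of w] e_left[of e] w \<tau>e
        by (simp add: matrix_vector_right_distrib matrix_vector_mult_scaleR inner_add_left
            inner_add_right power2_eq_square)
      finally show ?thesis .
    qed
    ultimately have "\<alpha> * (norm w)\<^sup>2 \<le> \<epsilon> * (norm v)\<^sup>2 + \<beta> * (\<tau> v)\<^sup>2"
      using \<alpha>(2)[OF w] by simp
    also have "\<dots> \<le> \<alpha> / 4 * (norm v)\<^sup>2 + \<beta> * (\<tau> v)\<^sup>2"
      using \<epsilon>(1) by (intro add_right_mono mult_right_mono) auto
    also have "\<dots> = \<alpha> * ((norm v)\<^sup>2 / 4 + \<beta> / \<alpha> * (\<tau> v)\<^sup>2)"
      using \<alpha>(1) by (simp add: field_simps)
    finally have w2: "(norm w)\<^sup>2 \<le> (norm v)\<^sup>2 / 4 + \<beta> / \<alpha> * (\<tau> v)\<^sup>2"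
      using \<alpha>(1) by simp
    have "norm v \<le> norm w + \<bar>\<tau> v\<bar> * norm e"
      using norm_triangle_ineq[of w "\<tau> v *\<^sub>R e"] by (simp add: w_def)
    then have "(norm v)\<^sup>2 \<le> (norm w + \<bar>\<tau> v\<bar> * norm e)\<^sup>2"
      by (rule power_mono) simp
    also have "\<dots> \<le> 2 * (norm w)\<^sup>2 + 2 * (\<bar>\<tau> v\<bar> * norm e)\<^sup>2"
      using sum_squares_bound[of "norm w" "\<bar>\<tau> v\<bar> * norm e"] by (simp add: power2_sum)
    also have "\<dots> = 2 * (norm w)\<^sup>2 + 2 * ((norm e)\<^sup>2 * (\<tau> v)\<^sup>2)"
      by (simp add: power_mult_distrib)
    finally have v2: "(norm v)\<^sup>2 \<le> 2 * (norm w)\<^sup>2 + 2 * ((norm e)\<^sup>2 * (\<tau> v)\<^sup>2)" .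
    have "C * (\<tau> v)\<^sup>2 = 4 * ((norm e)\<^sup>2 * (\<tau> v)\<^sup>2) + 4 * (\<beta> / \<alpha> * (\<tau> v)\<^sup>2)"
      by (simp add: C_def algebra_simps)
    then have "(norm v)\<^sup>2 \<le> C * (\<tau> v)\<^sup>2" using v2 w2 by linarith
    also have "\<dots> \<le> K\<^sup>2 * (\<tau> v)\<^sup>2" using K by (intro mult_right_mono) auto
    finally have "norm v \<le> \<bar>K * \<tau> v\<bar>"
      by (simp add: power_mult_distrib[symmetric] abs_le_square_iff[symmetric])
    then have nv: "norm v \<le> K * \<bar>\<tau> v\<bar>" using K by (simp add: abs_mult)
    have "ori y \<bullet> (gram y *v v) + \<tau> v \<le> \<epsilon> * norm v"
      using r1(4)[of y v] y R(2) by (fastforce simp: \<tau>_def T_def)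
    then have "0 < - \<tau> v + \<epsilon> * norm v" using v(2) by simp
    also have "\<dots> \<le> - \<tau> v + \<epsilon> * (K * \<bar>\<tau> v\<bar>)"
      using nv \<open>\<epsilon> > 0\<close> by simp
    also have "\<dots> \<le> - \<tau> v + \<bar>\<tau> v\<bar> / 2"
      using mult_right_mono[OF \<epsilon>(2), of "\<bar>\<tau> v\<bar>"] by simp
    finally have "\<tau> v < 0" by (auto simp: abs_if split: if_splits)
    then show ?thesis using nv by simp
  qed
  have push: "(v + (\<mu> * \<tau> v) *\<^sub>R e) \<bullet> (gram z *v (v + (\<mu> * \<tau> v) *\<^sub>R e)) < 0 \<and>
      ori z \<bullet> (gram z *v (v + (\<mu> * \<tau> v) *\<^sub>R e)) > 0"
    if y: "y \<in> ball y0 R" "z \<in> ball y0 R" and z: "z = y + f *\<^sub>R e" and \<mu>: "\<mu> > 0" "\<bar>f\<bar> \<le> \<mu> * m"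
      and v: "v \<bullet> (gram y *v v) \<le> 0" "ori y \<bullet> (gram y *v v) > 0" for y z v f \<mu>
  proof -
    define t where "t = - \<tau> v"
    have t: "t > 0" "norm v \<le> K * t" using past_cone[OF y(1) v] by (simp_all add: t_def)
    have "z \<in> \<phi> ` D" using y(2) R(2) r1(2) by blast
    then have sigz: "lorentz_signature (gram z)" by (rule signature_gram)
    have ez: "e \<bullet> (gram z *v e) < 0" "ori z \<bullet> (gram z *v e) < 0"
      using r2(3)[rule_format, of z e] r2(2) y(2) R(3) by auto
    have "v \<bullet> (gram z *v v) \<le> v \<bullet> (gram y *v v) + L * \<bar>f\<bar> * (norm v)\<^sup>2"
      using L(2)[of y f v] y R(4) z by blast
    also have "\<dots> \<le> 0 + L * (\<mu> * m) * (K * t)\<^sup>2"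
      using v(1) L(1) \<mu> t m(1)
      by (intro add_mono mult_mono power_mono) auto
    also have "\<dots> = \<mu> * \<beta> * t\<^sup>2" using m(2) by (simp add: power_mult_distrib algebra_simps)
    finally have vv: "v \<bullet> (gram z *v v) \<le> \<mu> * \<beta> * t\<^sup>2" .
    have "\<beta> * t - v \<bullet> (gram z *v e) \<le> \<epsilon> * norm v * norm e"
      using r1(3)[of z v e] y R(2) e_right[of v] by (fastforce simp: t_def)
    also have "\<dots> \<le> \<epsilon> * (K * t) * norm e"
      using t K(1) \<open>\<epsilon> > 0\<close> by (intro mult_mono) auto
    also have "\<dots> \<le> \<beta> * t / 2"
      using mult_right_mono[OF \<epsilon>(3), of t] t by (simp add: algebra_simps)
    finally have ve: "v \<bullet> (gram z *v e) \<ge> \<beta> * t / 2" by simp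
    have "- \<tau> v - ori z \<bullet> (gram z *v v) \<le> \<epsilon> * norm v"
      using r1(4)[of z v] y R(2) by (fastforce simp: \<tau>_def T_def)
    also have "\<dots> \<le> \<epsilon> * (K * t)" using t \<open>\<epsilon> > 0\<close> by simp
    also have "\<dots> \<le> t / 2" using mult_right_mono[OF \<epsilon>(2), of t] t by simp
    finally have "ori z \<bullet> (gram z *v v) > 0" using t by (simp add: t_def)
    moreover have "ori z \<bullet> (gram z *v (v + (\<mu> * \<tau> v) *\<^sub>R e)) =
        ori z \<bullet> (gram z *v v) + (\<mu> * t) * (- (ori z \<bullet> (gram z *v e)))"
      by (simp add: t_def matrix_vector_right_distrib matrix_vector_mult_scaleR inner_add_right)
    moreover have "(\<mu> * t) * (- (ori z \<bullet> (gram z *v e))) > 0"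
      using \<mu> t ez by (intro mult_pos_pos) auto
    ultimately have "ori z \<bullet> (gram z *v (v + (\<mu> * \<tau> v) *\<^sub>R e)) > 0" by linarith
    \<comment> \<open>In the expanded square the tilt is at worst cancelled by the cross term, and
      the strictly negative square of the multiple of \<open>e\<close> remains.\<close>
    moreover have "(v + (\<mu> * \<tau> v) *\<^sub>R e) \<bullet> (gram z *v (v + (\<mu> * \<tau> v) *\<^sub>R e)) =
        v \<bullet> (gram z *v v) - 2 * (\<mu> * t) * (v \<bullet> (gram z *v e)) + (\<mu> * t)\<^sup>2 * (e \<bullet> (gram z *v e))"
      using lorentz_signature_sym[OF sigz, of e v]
      by (simp add: t_def matrix_vector_right_distrib matrix_vector_mult_scaleR inner_add_right inner_add_left
          power2_eq_square algebra_simps)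
    moreover have "2 * (\<mu> * t) * (v \<bullet> (gram z *v e)) \<ge> 2 * (\<mu> * t) * (\<beta> * t / 2)"
      using \<mu> t ve by (intro mult_left_mono) auto
    moreover have "(\<mu> * t)\<^sup>2 * (e \<bullet> (gram z *v e)) < 0"
      using \<mu> t ez by (intro mult_pos_neg) auto
    moreover have "2 * (\<mu> * t) * (\<beta> * t / 2) = \<mu> * \<beta> * t\<^sup>2" by (simp add: power2_eq_square)
    ultimately show ?thesis using vv by linarith
  qed
  have width: "\<bar>\<tau> y - \<tau> y'\<bar> \<le> m" if y: "y \<in> ball y0 R" "y' \<in> ball y0 R" for y y'
  proof -
    have "dist y0 y < R" "dist y0 y' < R" using y by simp_all
    then have "dist y y' \<le> 2 * R"
      using dist_triangle3[of y y' y0] by linarith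
    then have "norm (y - y') \<le> 2 * R" by (simp add: dist_norm)
    then have "norm (y - y') * B \<le> 2 * R * B" using B(1) by (intro mult_right_mono) auto
    moreover have "2 * R * B \<le> m" using R(5) B(1) by (simp add: field_simps)
    ultimately show ?thesis using B(2)[of "y - y'"] by (simp add: \<tau>.diff)
  qed
  have "cone_chart M D \<phi> y0 R \<tau> e K \<kappa> m"
  proof (unfold_locales, unfold vec_iff_gram, goal_cases)
    case (6 y v) then show ?case using past_cone[of y v] by blast
  next
    case (7 y v) then show ?case using r2(3)[rule_format, of y v] R(3) by blast
  next
    case (8 y v f \<mu>) then show ?case using push[of y "y + f *\<^sub>R e" f \<mu> v] by blast
  next
    case (9 y y') then show ?case using width by blast
  qed (use R r1 \<tau>_lin \<tau>e K r2 in auto)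
  then show thesis by (rule that)
qed

end

section \<open>Causal curves in a cone chart\<close>

lemma half_open_downward: "t \<in> half_open a \<Longrightarrow> 0 \<le> s \<Longrightarrow> s \<le> t \<Longrightarrow> s \<in> half_open a"
  unfolding half_open_def using le_less_trans[of "ereal s" "ereal t" a] by simp

lemma is_interval_half_open: "is_interval (half_open a)"
  unfolding is_interval_1 using half_open_downward[of _ a] by (auto simp: half_open_def)

context cone_chart
begin

sublocale \<tau>: bounded_linear \<tau> by (rule \<tau>(1))

lemma future_cone:
  assumes "y \<in> ball y0 R" "causal_vec M \<phi> (\<iota> y) v" "future_vec M \<phi> (\<iota> y) v"
  shows "\<tau> v > 0 \<and> norm v \<le> K * \<tau> v"
proof -
  have "gram y *v - v = - (gram y *v v)"
    using matrix_vector_mult_scaleR[of "gram y" "-1" v] by simp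
  then have "causal_vec M \<phi> (\<iota> y) (- v)" "past_vec M \<phi> (\<iota> y) (- v)"
    using assms(2,3) by (simp_all add: vec_iff_gram)
  then show ?thesis using past_cone[OF assms(1)] by (force simp: \<tau>.neg)
qed

text \<open>Integrates the pointwise cone bound into a bound on displacement. The functional \<rho>
  is left open because past directed curves use the negative of \<tau> and future directed ones
  \<tau> itself.\<close>

lemma smooth_progress:
  fixes \<rho> :: "real ^ 'n \<Rightarrow> real"
  assumes "smooth_curve M {s..t} \<gamma>" "velocities_satisfy M Q {s..t} \<gamma>" "s < t" "\<gamma> ` {s..t} \<subseteq> D"
    and \<rho>: "bounded_linear \<rho>"
    and Q: "\<And>u v. u \<in> {s..t} \<Longrightarrow> Q \<phi> (\<gamma> u) v \<Longrightarrow> \<rho> v > 0 \<and> norm v \<le> K * \<rho> v"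
  shows "\<rho> (\<phi> (\<gamma> s)) < \<rho> (\<phi> (\<gamma> t)) \<and>
    norm (\<phi> (\<gamma> t) - \<phi> (\<gamma> s)) \<le> K * (\<rho> (\<phi> (\<gamma> t)) - \<rho> (\<phi> (\<gamma> s)))"
proof -
  interpret \<rho>: bounded_linear \<rho> by (rule \<rho>)
  define c where "c u = \<phi> (\<gamma> u)" for u
  define v where "v = velocity \<phi> {s..t} \<gamma>"
  have der: "(c has_vector_derivative v u) (at u within {s..t})" if "u \<in> {s..t}" for u
    unfolding c_def v_def using smooth_curve_velocity[OF assms(1) chart that] assms(4) that by blast
  have Qv: "\<rho> (v u) > 0 \<and> norm (v u) \<le> K * \<rho> (v u)" if "u \<in> {s..t}" for u
    using assms(2,4) chart that by (intro Q[OF that]) (fastforce simp: velocities_satisfy_def v_def)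
  have cont: "continuous_on {s..t} c"
    using der has_vector_derivative_continuous continuous_on_eq_continuous_within by blast
  then have cont\<rho>: "continuous_on {s..t} (\<lambda>u. \<rho> (c u))" by (rule \<rho>.continuous_on)
  have at: "(c has_vector_derivative v u) (at u)" if "s < u" "u < t" for u
    using der[of u] that by (simp add: at_within_Icc_at)
  then have at\<rho>: "((\<lambda>u. \<rho> (c u)) has_vector_derivative \<rho> (v u)) (at u)" if "s < u" "u < t" for u
    using that by (intro \<rho>.has_vector_derivative)
  have "\<rho> (c s) < \<rho> (c t)"
  proof (rule DERIV_pos_imp_increasing_open[OF \<open>s < t\<close> _ cont\<rho>])
    fix u assume "s < u" "u < t"
    then show "\<exists>y. ((\<lambda>u. \<rho> (c u)) has_real_derivative y) (at u) \<and> y > 0"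
      using at\<rho>[of u] Qv[of u] by (auto simp: has_real_derivative_iff_has_vector_derivative)
  qed
  moreover have "norm (c t - c s) \<le> K * \<rho> (c t) - K * \<rho> (c s)"
  proof (rule differentiable_bound_general[OF \<open>s < t\<close> cont])
    show "continuous_on {s..t} (\<lambda>u. K * \<rho> (c u))" by (intro continuous_intros cont\<rho>)
    show "((\<lambda>u. K * \<rho> (c u)) has_vector_derivative K * \<rho> (v u)) (at u)" if "s < u" "u < t" for u
      using at\<rho>[OF that] by (rule has_vector_derivative_mult_right)
  qed (use at Qv in auto)
  ultimately show ?thesis by (simp add: c_def right_diff_distrib)
qed

lemma piecewise_progress:
  fixes \<rho> :: "real ^ 'n \<Rightarrow> real"
  assumes "piecewise_curve M Q I \<gamma>" "is_interval I" "\<gamma> ` I \<subseteq> D" and \<rho>: "bounded_linear \<rho>"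
    and Q: "\<And>u v. u \<in> I \<Longrightarrow> Q \<phi> (\<gamma> u) v \<Longrightarrow> \<rho> v > 0 \<and> norm v \<le> K * \<rho> v"
    and "s \<in> I" "t \<in> I" "s < t"
  shows "\<rho> (\<phi> (\<gamma> s)) < \<rho> (\<phi> (\<gamma> t)) \<and>
    norm (\<phi> (\<gamma> t) - \<phi> (\<gamma> s)) \<le> K * (\<rho> (\<phi> (\<gamma> t)) - \<rho> (\<phi> (\<gamma> s)))"
proof (rule piecewise_curve_trans[OF assms(1,2) _ _ assms(6-8)])
  fix s t assume st: "s \<in> I" "t \<in> I" "s < t" "smooth_curve M {s..t} \<gamma>" "velocities_satisfy M Q {s..t} \<gamma>"
  have sub: "{s..t} \<subseteq> I" using mem_is_interval_1_I[OF assms(2) st(1,2)] by auto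
  show "\<rho> (\<phi> (\<gamma> s)) < \<rho> (\<phi> (\<gamma> t)) \<and>
      norm (\<phi> (\<gamma> t) - \<phi> (\<gamma> s)) \<le> K * (\<rho> (\<phi> (\<gamma> t)) - \<rho> (\<phi> (\<gamma> s)))"
    by (rule smooth_progress[OF st(4,5,3) _ \<rho> Q]) (use sub assms(3) in auto)
next
  fix s t u
  assume "\<rho> (\<phi> (\<gamma> s)) < \<rho> (\<phi> (\<gamma> t)) \<and> norm (\<phi> (\<gamma> t) - \<phi> (\<gamma> s)) \<le> K * (\<rho> (\<phi> (\<gamma> t)) - \<rho> (\<phi> (\<gamma> s)))"
    "\<rho> (\<phi> (\<gamma> t)) < \<rho> (\<phi> (\<gamma> u)) \<and> norm (\<phi> (\<gamma> u) - \<phi> (\<gamma> t)) \<le> K * (\<rho> (\<phi> (\<gamma> u)) - \<rho> (\<phi> (\<gamma> t)))"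
  then show "\<rho> (\<phi> (\<gamma> s)) < \<rho> (\<phi> (\<gamma> u)) \<and> norm (\<phi> (\<gamma> u) - \<phi> (\<gamma> s)) \<le> K * (\<rho> (\<phi> (\<gamma> u)) - \<rho> (\<phi> (\<gamma> s)))"
    using norm_triangle_ineq[of "\<phi> (\<gamma> t) - \<phi> (\<gamma> s)" "\<phi> (\<gamma> u) - \<phi> (\<gamma> t)"]
    by (simp add: right_diff_distrib)
qed

lemma past_causal_progress:
  assumes "past_causal_curve M a \<gamma>" "\<gamma> ` half_open a \<subseteq> \<iota> ` ball y0 R"
    and "s \<in> half_open a" "t \<in> half_open a" "s < t"
  shows "\<tau> (\<phi> (\<gamma> t)) < \<tau> (\<phi> (\<gamma> s))"
    "norm (\<phi> (\<gamma> t) - \<phi> (\<gamma> s)) \<le> K * (\<tau> (\<phi> (\<gamma> s)) - \<tau> (\<phi> (\<gamma> t)))"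
proof -
  have sub: "\<gamma> u \<in> D" "\<phi> (\<gamma> u) \<in> ball y0 R" if "u \<in> half_open a" for u
    using assms(2) that ball_subset inv_in_D coord_inv by fastforce+
  have *: "- \<tau> v > 0 \<and> norm v \<le> K * - \<tau> v"
    if "u \<in> half_open a" "causal_vec M \<phi> (\<gamma> u) v \<and> past_vec M \<phi> (\<gamma> u) v" for u v
    using past_cone[OF sub(2)[OF that(1)], of v] that(2) sub[OF that(1)] by simp
  have "- \<tau> (\<phi> (\<gamma> s)) < - \<tau> (\<phi> (\<gamma> t)) \<and>
    norm (\<phi> (\<gamma> t) - \<phi> (\<gamma> s)) \<le> K * (- \<tau> (\<phi> (\<gamma> t)) - - \<tau> (\<phi> (\<gamma> s)))"
    using sub(1) *
    by (intro piecewise_progress[OF assms(1)[unfolded past_causal_curve_def] is_interval_half_open _ bounded_linear_minus[OF \<tau>(1)] _ assms(3-5)])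
      auto
  then show "\<tau> (\<phi> (\<gamma> t)) < \<tau> (\<phi> (\<gamma> s))"
    "norm (\<phi> (\<gamma> t) - \<phi> (\<gamma> s)) \<le> K * (\<tau> (\<phi> (\<gamma> s)) - \<tau> (\<phi> (\<gamma> t)))" by simp_all
qed

text \<open>Makes every subset of a level of \<tau> in the ball achronal, in particular
  \<open>S\<close>. The cone bounds hold only in the ball, so the chronology is that of the
  submanifold.\<close>

lemma chronological_progress:
  assumes "chronological (open_submanifold M (\<iota> ` ball y0 r)) x x'" "r \<le> R"
  shows "\<tau> (\<phi> x) < \<tau> (\<phi> x')"
proof -
  let ?Q = "\<lambda>\<phi> x v. timelike_vec M \<phi> x v \<and> future_vec M \<phi> x v"
  obtain \<gamma> where \<gamma>: "piecewise_curve (open_submanifold M (\<iota> ` ball y0 r)) ?Q {0..1} \<gamma>" "\<gamma> 0 = x" "\<gamma> 1 = x'"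
    using assms(1) unfolding chronological_def by auto
  have im: "\<gamma> ` {0..1} \<subseteq> \<iota> ` ball y0 r"
    using \<gamma>(1) by (auto simp: piecewise_curve_def points_open_submanifold)
  then have "piecewise_curve M ?Q {0..1} \<gamma>"
    using \<gamma>(1) piecewise_curve_open_submanifold is_interval_cc by blast
  moreover have sub: "\<gamma> u \<in> D" "\<phi> (\<gamma> u) \<in> ball y0 R" if u: "u \<in> {0..1}" for u
  proof -
    have "\<gamma> u \<in> \<iota> ` ball y0 r" using im u by blast
    then obtain y where y: "\<gamma> u = \<iota> y" "y \<in> ball y0 r" by blast
    moreover have "y \<in> ball y0 R" using y(2) assms(2) by simp
    ultimately show "\<gamma> u \<in> D" "\<phi> (\<gamma> u) \<in> ball y0 R" using ball_subset by auto
  qed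
  moreover have "\<tau> v > 0 \<and> norm v \<le> K * \<tau> v" if "u \<in> {0..1}" "?Q \<phi> (\<gamma> u) v" for u v
    using future_cone[OF sub(2)[OF that(1)], of v] that(2) sub[OF that(1)] by (simp add: causal_vec_def)
  ultimately have "\<tau> (\<phi> (\<gamma> 0)) < \<tau> (\<phi> (\<gamma> 1))"
    using piecewise_progress[of ?Q "{0..1}" \<gamma> \<tau> 0 1] \<tau>(1) is_interval_cc by (auto simp: image_subset_iff)
  then show ?thesis using \<gamma> by simp
qed

lemma cone_scaled:
  assumes "y \<in> ball y0 R" "\<tau> v > 0" "norm (v - \<tau> v *\<^sub>R e) < \<kappa> * \<tau> v"
  shows "timelike_vec M \<phi> (\<iota> y) v \<and> future_vec M \<phi> (\<iota> y) v"
proof -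
  have "v /\<^sub>R \<tau> v - e = (v - \<tau> v *\<^sub>R e) /\<^sub>R \<tau> v" using assms(2) by (simp add: algebra_simps)
  then have "norm (v /\<^sub>R \<tau> v - e) = norm (v - \<tau> v *\<^sub>R e) / \<tau> v" using assms(2) by (simp add: divide_inverse mult.commute)
  then have "norm (v /\<^sub>R \<tau> v - e) < \<kappa>" using assms(2,3) by (simp add: pos_divide_less_eq)
  from narrow_cone[OF assms(1) this] show ?thesis
    using assms(2) by (simp add: vec_iff_gram matrix_vector_mult_scaleR mult_less_0_iff zero_less_mult_iff)
qed

text \<open>The straight coordinate segment is itself the timelike curve, and convexity keeps it in
  the ball. Through this, achronality becomes a statement about differences: no two points of the
  horizon in the ball differ by a vector of the narrow cone.\<close>

lemma chronological_segment:
  assumes "y \<in> ball y0 R" "y + v \<in> ball y0 R" "\<tau> v > 0" "norm (v - \<tau> v *\<^sub>R e) < \<kappa> * \<tau> v"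
  shows "chronological M (\<iota> y) (\<iota> (y + v))"
proof -
  let ?Q = "\<lambda>\<phi> x v. timelike_vec M \<phi> x v \<and> future_vec M \<phi> x v"
  have in_ball: "y + t *\<^sub>R v \<in> ball y0 R" if "t \<in> {0..1}" for t
  proof -
    have "y + t *\<^sub>R v = (1 - t) *\<^sub>R y + t *\<^sub>R (y + v)" by (simp add: algebra_simps)
    then show ?thesis using that assms(1,2) convex_ball[of y0 R] by (simp add: convex_alt)
  qed
  have "piecewise_curve M ?Q {0..1} (\<lambda>t. \<iota> (y + t *\<^sub>R v))"
  proof (rule piecewise_curve_inv[where B = "{}"])
    fix s t u :: real assume st: "s \<in> {0..1}" "t \<in> {0..1}" "u \<in> {s..t}"
    have "((\<lambda>t. y + t *\<^sub>R v) has_vector_derivative v) (at u within {s..t})"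
      by (auto intro!: derivative_eq_intros)
    then show "\<exists>w. ((\<lambda>t. y + t *\<^sub>R v) has_vector_derivative w) (at u within {s..t}) \<and> ?Q \<phi> (\<iota> (y + u *\<^sub>R v)) w"
      using cone_scaled[OF in_ball assms(3,4), of u] st by auto
  qed (use in_ball ball_subset vec_transition is_interval_cc locally_smooth_line in \<open>auto intro!: continuous_intros\<close>)
  then show ?thesis unfolding chronological_def by (intro exI[of _ "\<lambda>t. \<iota> (y + t *\<^sub>R v)"]) auto
qed

text \<open>
  The push-up property: composing a causal curve with the affine map that moves a point along \<open>e\<close>
  by an amount proportional to its time difference makes it timelike. The amount is \<open>s'\<close> at the
  start and \<open>s\<close> at the end.
\<close>

lemma push_up:
  assumes \<gamma>: "past_causal_curve M a \<gamma>" "\<gamma> ` half_open a \<subseteq> \<iota> ` ball y0 (R / 4)"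
    and u1: "u1 \<in> half_open a" "u1 > 0" and s: "s \<le> 0" "s' > 0"
    and z: "\<phi> (\<gamma> 0) + s' *\<^sub>R e \<in> ball y0 (R / 2)" and q: "\<phi> (\<gamma> u1) + s *\<^sub>R e \<in> ball y0 (R / 2)"
  shows "chronological M (\<iota> (\<phi> (\<gamma> u1) + s *\<^sub>R e)) (\<iota> (\<phi> (\<gamma> 0) + s' *\<^sub>R e))"
proof -
  let ?P = "\<lambda>\<phi> x v. causal_vec M \<phi> x v \<and> past_vec M \<phi> x v"
  let ?Q = "\<lambda>\<phi> x v. timelike_vec M \<phi> x v \<and> future_vec M \<phi> x v"
  define c where "c u = \<phi> (\<gamma> u)" for u
  have sub4: "\<gamma> u \<in> D" "c u \<in> ball y0 (R / 4)" if u: "u \<in> half_open a" for u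
  proof -
    have "\<gamma> u \<in> \<iota> ` ball y0 (R / 4)" using \<gamma>(2) u by blast
    then obtain y where y: "\<gamma> u = \<iota> y" "y \<in> ball y0 (R / 4)" by blast
    moreover have "y \<in> ball y0 R" using y(2) R by simp
    ultimately show "\<gamma> u \<in> D" "c u \<in> ball y0 (R / 4)" using ball_subset by (auto simp: c_def)
  qed
  have sub: "c u \<in> ball y0 R" if "u \<in> half_open a" for u
    using sub4(2)[OF that] R by simp
  have \<gamma>_eq: "\<gamma> u = \<iota> (c u)" if "u \<in> half_open a" for u
    using sub4(1)[OF that] by (simp add: c_def)
  have imR: "\<gamma> ` half_open a \<subseteq> \<iota> ` ball y0 R" using sub \<gamma>_eq by blast
  have in_I: "u \<in> half_open a" if "0 \<le> u" "u \<le> u1" for u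
    using half_open_downward[OF u1(1) that] .
  have mono: "\<tau> (c t) < \<tau> (c u)" if "0 \<le> u" "u < t" "t \<le> u1" for t u
    using past_causal_progress(1)[OF \<gamma>(1) imR, of u t] in_I that by (simp add: c_def)
  define \<Delta> where "\<Delta> = \<tau> (c 0) - \<tau> (c u1)"
  have \<Delta>: "\<Delta> > 0" using mono[of 0 u1] u1 by (simp add: \<Delta>_def)
  have \<Delta>m: "\<Delta> \<le> m"
    using width[OF sub[of 0] sub[of u1]] in_I[of 0] in_I[of u1] u1 by (simp add: \<Delta>_def)
  \<comment> \<open>The slope for which the affine function \<open>f\<close> of \<tau> falls from
    \<open>s'\<close> at the start of the curve to \<open>s\<close> at its end.\<close>
  define \<mu> where "\<mu> = (s' - s) / \<Delta>"
  have \<mu>: "\<mu> > 0" "\<mu> * \<Delta> = s' - s" using s \<Delta> by (simp_all add: \<mu>_def)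
  define f where "f y = s' + \<mu> * (\<tau> y - \<tau> (c 0))" for y
  have f_range: "s \<le> f (c u)" "f (c u) \<le> s'" if u: "0 \<le> u" "u \<le> u1" for u
  proof -
    have "\<tau> (c u) \<le> \<tau> (c 0)" "\<tau> (c 0) - \<tau> (c u) \<le> \<Delta>"
      using mono[of 0 u] mono[of u u1] u by (auto simp: \<Delta>_def le_less)
    then have "\<mu> * (\<tau> (c 0) - \<tau> (c u)) \<ge> 0" "\<mu> * (\<tau> (c 0) - \<tau> (c u)) \<le> \<mu> * \<Delta>"
      using \<mu>(1) by (auto intro!: mult_left_mono)
    then show "s \<le> f (c u)" "f (c u) \<le> s'" using \<mu>(2) by (simp_all add: f_def right_diff_distrib)
  qed
  have f_ends: "f (c 0) = s'" "f (c u1) = s"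
    using \<mu>(2) by (simp_all add: f_def \<Delta>_def right_diff_distrib)
  define A where "A y = y + f y *\<^sub>R e" for y
  \<comment> \<open>The curve stays within \<open>R / 4\<close> of \<open>y0\<close> and the
    displaced ends within \<open>R / 2\<close>, so both end shifts are shorter than
    \<open>3 * R / 4\<close>. The intermediate shifts are no longer than these, hence the pushed
    curve stays within \<open>R\<close>.\<close>
  have shift: "norm (r *\<^sub>R e) < 3 * R / 4" if "y \<in> ball y0 (R / 4)" "y + r *\<^sub>R e \<in> ball y0 (R / 2)" for y r
  proof -
    have "dist y (y + r *\<^sub>R e) < R / 4 + R / 2"
      using that dist_triangle3[of y "y + r *\<^sub>R e" y0] by simp
    then show ?thesis by (simp add: dist_norm)
  qed
  have ends: "\<bar>s'\<bar> * norm e < 3 * R / 4" "\<bar>s\<bar> * norm e < 3 * R / 4"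
    using shift[OF sub4(2) z[folded c_def]] shift[OF sub4(2) q[folded c_def]] in_I u1 by auto
  have A_ball: "A (c u) \<in> ball y0 R" if u: "0 \<le> u" "u \<le> u1" for u
  proof -
    have "\<bar>f (c u)\<bar> \<le> max \<bar>s'\<bar> \<bar>s\<bar>" using f_range[OF u] by auto
    then have "\<bar>f (c u)\<bar> * norm e \<le> max \<bar>s'\<bar> \<bar>s\<bar> * norm e" by (intro mult_right_mono) auto
    also have "\<dots> < 3 * R / 4" using ends by (simp add: max_def)
    finally have "norm (f (c u) *\<^sub>R e) < 3 * R / 4" by simp
    moreover have "dist y0 (c u) < R / 4" using sub4(2)[OF in_I[OF u]] by simp
    moreover have "dist y0 (A (c u)) \<le> dist y0 (c u) + norm (f (c u) *\<^sub>R e)"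
      using dist_triangle[of y0 "A (c u)" "c u"] by (simp add: A_def dist_norm)
    ultimately show ?thesis by simp
  qed
  have pushed: "timelike_vec M \<phi> (\<iota> (A (c u))) (v + (\<mu> * \<tau> v) *\<^sub>R e) \<and>
      past_vec M \<phi> (\<iota> (A (c u))) (v + (\<mu> * \<tau> v) *\<^sub>R e)"
    if u: "0 \<le> u" "u \<le> u1" and v: "?P \<phi> (\<gamma> u) v" for u v
  proof -
    \<comment> \<open>Zero lies between \<open>s\<close> and \<open>s'\<close>, so the size of
      \<open>f\<close> is bounded by its total drop \<open>\<mu> * \<Delta>\<close>; the width bound
      on \<Delta> then meets the condition of \<open>push\<close>.\<close>
    have "\<bar>f (c u)\<bar> \<le> s' - s" using f_range[OF u] s by auto
    also have "\<dots> \<le> \<mu> * m" using \<mu> \<Delta>m by (metis less_imp_le mult_left_mono)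
    finally show ?thesis
      using push[OF sub[OF in_I[OF u]] A_ball[OF u, unfolded A_def] \<mu>(1)] v \<gamma>_eq[OF in_I[OF u]]
      by (simp add: A_def)
  qed
  have cont\<gamma>: "continuous_on (half_open a) \<gamma>"
    and ex: "\<exists>B. \<forall>s\<in>half_open a. \<forall>t\<in>half_open a. finite (B \<inter> {s..t}) \<and>
       (s < t \<and> B \<inter> {s<..<t} = {} \<longrightarrow> smooth_curve M {s..t} \<gamma> \<and> velocities_satisfy M ?P {s..t} \<gamma>)"
    using \<gamma>(1) unfolding past_causal_curve_def piecewise_curve_def by simp_all
  from ex obtain B where B0: "\<forall>s\<in>half_open a. \<forall>t\<in>half_open a. finite (B \<inter> {s..t}) \<and>
       (s < t \<and> B \<inter> {s<..<t} = {} \<longrightarrow> smooth_curve M {s..t} \<gamma> \<and> velocities_satisfy M ?P {s..t} \<gamma>)" ..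
  have B: "finite (B \<inter> {s..t})"
    "s < t \<Longrightarrow> B \<inter> {s<..<t} = {} \<Longrightarrow> smooth_curve M {s..t} \<gamma> \<and> velocities_satisfy M ?P {s..t} \<gamma>"
    if "s \<in> half_open a" "t \<in> half_open a" for s t
    using bspec[OF bspec[OF B0 that(1)] that(2)] by simp_all
  \<comment> \<open>\<open>chronological\<close> asks for a future directed curve on the unit
    interval, so the parameter runs backwards from \<open>u1\<close> to 0.\<close>
  define h where "h w = u1 - u1 * w" for w
  have h_range: "0 \<le> h w" "h w \<le> u1" if "w \<in> {0..1}" for w
    using that u1 mult_left_mono[of w 1 u1] by (auto simp: h_def)
  have h_less: "h t < h s \<longleftrightarrow> s < t" for s t using u1 by (simp add: h_def)
  define \<sigma> where "\<sigma> w = A (c (h w))" for w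
  \<comment> \<open>As \<open>f\<close> is affine in \<tau>, the push is an affine map with linear
    part \<open>L\<close>. It preserves smooth pieces and acts on velocities through
    \<open>L\<close>.\<close>
  define L where "L y = y + (\<mu> * \<tau> y) *\<^sub>R e" for y
  have L: "bounded_linear L"
    unfolding L_def[abs_def]
    by (intro bounded_linear_add bounded_linear_ident bounded_linear_scaleR_left[THEN bounded_linear_compose]
        bounded_linear_const_mult \<tau>(1))
  have \<sigma>_eq: "\<sigma> = (\<lambda>w. (s' - \<mu> * \<tau> (c 0)) *\<^sub>R e + L (c (u1 + (- u1) * w)))"
    by (auto simp: fun_eq_iff \<sigma>_def A_def f_def L_def h_def algebra_simps)
  have h_im: "{h t..h s} \<subseteq> half_open a" if "s \<in> {0..1}" "t \<in> {0..1}" for s t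
    using h_range(1)[OF that(2)] h_range(2)[OF that(1)] by (intro subsetI in_I) auto
  have smooth: "smooth_curve M {h t..h s} \<gamma>" "velocities_satisfy M ?P {h t..h s} \<gamma>"
    if "s \<in> {0..1}" "t \<in> {0..1}" "s < t" "h -` B \<inter> {s<..<t} = {}" for s t
  proof -
    have "B \<inter> {h t<..<h s} = {}"
    proof (rule ccontr)
      assume "B \<inter> {h t<..<h s} \<noteq> {}"
      then obtain b where b: "b \<in> B" "h t < b" "b < h s" by auto
      have "h ((u1 - b) / u1) = b" using u1 by (simp add: h_def)
      then have "(u1 - b) / u1 \<in> h -` B \<inter> {s<..<t}" using b h_less by (metis IntI greaterThanLessThan_iff vimageI2)
      then show False using that by blast
    qed
    moreover have "h t \<in> half_open a" "h s \<in> half_open a"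
      using in_I h_range that by blast+
    ultimately show "smooth_curve M {h t..h s} \<gamma>" "velocities_satisfy M ?P {h t..h s} \<gamma>"
      using B(2) that(3) h_less by blast+
  qed
  have "piecewise_curve M ?Q {0..1} (\<lambda>w. \<iota> (\<sigma> w))"
  proof (rule piecewise_curve_inv[where B = "h -` B"])
    have "continuous_on (half_open a) c"
      unfolding c_def using continuous_on_compose2[OF continuous_on_coord cont\<gamma>] sub4(1) by blast
    then have "continuous_on {0..1} (\<lambda>w. c (h w))"
      by (rule continuous_on_compose2) (use in_I h_range in \<open>auto simp: h_def intro!: continuous_intros\<close>)
    then show "continuous_on {0..1} \<sigma>"
      unfolding \<sigma>_def A_def f_def by (intro continuous_intros \<tau>.continuous_on)
    show "\<sigma> ` {0..1} \<subseteq> \<phi> ` D"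
      using A_ball h_range ball_subset by (force simp: \<sigma>_def)
    fix s t :: real assume st: "s \<in> {0..1}" "t \<in> {0..1}"
    have "finite (h -` (B \<inter> {h t..h s}))"
      using B(1)[of "h t" "h s"] in_I h_range st u1 by (intro finite_vimageI) (auto simp: inj_def h_def)
    then show "finite (h -` B \<inter> {s..t})"
      by (rule rev_finite_subset) (use h_less in \<open>auto simp: not_less[symmetric]\<close>)
    assume st': "s < t" "h -` B \<inter> {s<..<t} = {}"
    have sm: "smooth_curve M {h t..h s} \<gamma>" "velocities_satisfy M ?P {h t..h s} \<gamma>"
      using smooth[OF st st'] .
    have imD: "\<gamma> ` {h t..h s} \<subseteq> D" using sub4(1) h_im[OF st] by blast
    have h_ivl: "h u \<in> {h t..h s}" if "u \<in> {s..t}" for u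
      using that h_less[of s u] h_less[of u t] by (auto simp: le_less)
    have "locally_smooth {h t..h s} c"
      unfolding c_def using smooth_curve_imp_locally_smooth[OF sm(1) chart imD] .
    then show "locally_smooth {s..t} \<sigma>"
      unfolding \<sigma>_eq by (rule locally_smooth_affine[OF _ L]) (use h_ivl u1 in \<open>auto simp: h_def\<close>)
    fix u assume u: "u \<in> {s..t}"
    define v where "v = velocity \<phi> {h t..h s} \<gamma> (h u)"
    have v: "?P \<phi> (\<gamma> (h u)) v"
      using sm(2) chart h_ivl[OF u] imD unfolding velocities_satisfy_def v_def by fastforce
    have "(c has_vector_derivative v) (at (h u) within {h t..h s})"
      unfolding c_def v_def
      using smooth_curve_velocity[OF sm(1) chart h_ivl[OF u]] imD h_ivl[OF u] by blast
    then have "(c has_vector_derivative v) (at (h u) within h ` {s..t})"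
      by (rule has_vector_derivative_within_subset) (use h_ivl in blast)
    moreover have "(h has_vector_derivative - u1) (at u within {s..t})"
      unfolding h_def by (auto intro!: derivative_eq_intros)
    ultimately have "((\<lambda>w. c (h w)) has_vector_derivative (- u1) *\<^sub>R v) (at u within {s..t})"
      using vector_diff_chain_within[of h "- u1" u "{s..t}" c v] by (simp add: comp_def)
    then have "((\<lambda>w. L (c (h w))) has_vector_derivative L ((- u1) *\<^sub>R v)) (at u within {s..t})"
      by (rule bounded_linear.has_vector_derivative[OF L])
    then have "(\<sigma> has_vector_derivative L ((- u1) *\<^sub>R v)) (at u within {s..t})"
      unfolding \<sigma>_eq h_def by (auto intro!: derivative_eq_intros)
    moreover have "?Q \<phi> (\<iota> (\<sigma> u)) (L ((- u1) *\<^sub>R v))"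
    proof -
      have "L ((- u1) *\<^sub>R v) = (- u1) *\<^sub>R (v + (\<mu> * \<tau> v) *\<^sub>R e)"
        by (simp add: L_def \<tau>.neg \<tau>.scaleR algebra_simps)
      moreover have "u \<in> {0..1}" using u st by auto
      ultimately show ?thesis
        using pushed[OF h_range v] u1(2)
        by (simp only: \<sigma>_def vec_iff_gram matrix_vector_mult_scaleR inner_scaleR_left inner_scaleR_right)
          (simp add: mult_less_0_iff zero_less_mult_iff)
    qed
    ultimately show "\<exists>v. (\<sigma> has_vector_derivative v) (at u within {s..t}) \<and> ?Q \<phi> (\<iota> (\<sigma> u)) v" by blast
  qed (use vec_transition is_interval_cc in auto)
  moreover have "\<sigma> 0 = c u1 + s *\<^sub>R e" "\<sigma> 1 = c 0 + s' *\<^sub>R e"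
    using f_ends by (simp_all add: \<sigma>_def A_def h_def)
  ultimately show ?thesis
    unfolding chronological_def by (intro exI[of _ "\<lambda>w. \<iota> (\<sigma> w)"]) (simp add: c_def)
qed

text \<open>If the level were never reached, \<tau> would decrease to a limit along the curve, and
  the length bound would force the curve to converge, against inextendability. The assumption
  \<open>small\<close> keeps the limit off the boundary of the ball.\<close>

lemma reaches_level:
  assumes \<gamma>: "past_causal_curve (open_submanifold M (\<iota> ` ball y0 r)) a \<gamma>"
    and inext: "inextendable (open_submanifold M (\<iota> ` ball y0 r)) a \<gamma>" and "a > 0" "r \<le> R"
    and l: "l < \<tau> (\<phi> (\<gamma> 0))"
    and small: "dist y0 (\<phi> (\<gamma> 0)) + K * (\<tau> (\<phi> (\<gamma> 0)) - l) < r"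
  obtains u where "u \<in> half_open a" "u > 0" "\<tau> (\<phi> (\<gamma> u)) = l"
proof (rule ccontr)
  note obtained = that
  define c where "c u = \<phi> (\<gamma> u)" for u
  have im: "\<gamma> ` half_open a \<subseteq> \<iota> ` ball y0 r"
    using \<gamma> by (auto simp: past_causal_curve_def piecewise_curve_def points_open_submanifold)
  then have \<gamma>M: "past_causal_curve M a \<gamma>"
    using \<gamma> unfolding past_causal_curve_def
    by (simp add: piecewise_curve_open_submanifold is_interval_half_open)
  have imR: "\<gamma> ` half_open a \<subseteq> \<iota> ` ball y0 R" using im \<open>r \<le> R\<close> by fastforce
  have r_sub: "ball y0 r \<subseteq> \<phi> ` D" using ball_subset \<open>r \<le> R\<close> by fastforce
  have sub: "\<gamma> u \<in> D" "\<iota> (c u) = \<gamma> u" if "u \<in> half_open a" for u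
    using im that r_sub by (auto simp: c_def subset_eq)
  have zero: "0 \<in> half_open a" using \<open>a > 0\<close> by (simp add: half_open_def zero_ereal_def)
  have prog: "\<tau> (c t) < \<tau> (c s)" "norm (c t - c s) \<le> K * (\<tau> (c s) - \<tau> (c t))"
    if "s \<in> half_open a" "t \<in> half_open a" "s < t" for s t
    using past_causal_progress[OF \<gamma>M imR that] by (simp_all add: c_def)
  have cont: "continuous_on (half_open a) c"
    unfolding c_def using \<gamma>M sub(1)
    by (intro continuous_on_compose2[OF continuous_on_coord]) (auto simp: past_causal_curve_def piecewise_curve_def)
  assume no: "\<not> thesis"
  have above: "\<tau> (c u) > l" if u: "u \<in> half_open a" for u
  proof (rule ccontr)
    assume "\<not> \<tau> (c u) > l"
    moreover have ivl: "{0..u} \<subseteq> half_open a" using half_open_downward[OF u] by auto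
    moreover have "0 \<le> u" using u by (simp add: half_open_def)
    ultimately obtain x where x: "0 \<le> x" "x \<le> u" "\<tau> (c x) = l"
      using IVT2'[of "\<lambda>u. \<tau> (c u)" u l 0] \<tau>.continuous_on[OF continuous_on_subset[OF cont ivl]] l
      by (auto simp: c_def)
    then have "x \<noteq> 0" using l by (auto simp: c_def)
    then have "x > 0" "x \<in> half_open a" using x ivl by auto
    then show False using obtained[of x] no x(3) by (auto simp: c_def)
  qed
  define F where "F = (INF u\<in>half_open a. \<tau> (c u))"
  have bdd: "bdd_below ((\<lambda>u. \<tau> (c u)) ` half_open a)"
    using above by (intro bdd_belowI[of _ l]) (auto intro: less_imp_le)
  have F: "F \<le> \<tau> (c u)" if "u \<in> half_open a" for u
    unfolding F_def using bdd that by (rule cINF_lower)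
  have "\<exists>u\<in>half_open a. \<tau> (c u) < F + 1 / real (Suc n)" for n
    using cINF_less_iff[OF _ bdd, of "F + 1 / real (Suc n)"] zero by (auto simp: F_def)
  then obtain u where u: "\<And>n. u n \<in> half_open a" "\<And>n. \<tau> (c (u n)) < F + 1 / real (Suc n)"
    by metis
  \<comment> \<open>The later of the two points still lies at level \<open>F\<close> or higher, so
    \<tau> drops by less than \<epsilon> between them.\<close>
  have close: "dist (c s) (c t) \<le> K * \<epsilon>"
    if "s \<in> half_open a" "t \<in> half_open a" "\<tau> (c s) < F + \<epsilon>" "\<tau> (c t) < F + \<epsilon>" for s t \<epsilon>
  proof -
    have *: "dist (c s) (c t) \<le> K * \<epsilon>"
      if "s \<in> half_open a" "t \<in> half_open a" "\<tau> (c s) < F + \<epsilon>" "s < t" for s t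
    proof -
      have "dist (c s) (c t) \<le> K * (\<tau> (c s) - \<tau> (c t))"
        using prog(2)[OF that(1,2,4)] by (simp add: dist_norm norm_minus_commute)
      also have "\<dots> \<le> K * \<epsilon>" using K F[OF that(2)] that(3) by (intro mult_left_mono) auto
      finally show ?thesis .
    qed
    have "K * \<epsilon> > 0" using K F[OF that(1)] that(3) by simp
    then show ?thesis using *[of s t] *[of t s] that by (cases s t rule: linorder_cases) (auto simp: dist_commute)
  qed
  have close_u: "dist (c s) (c (u n)) \<le> K / real (Suc n)"
    if "s \<in> half_open a" "\<tau> (c s) < F + 1 / real (Suc n)" for s n
    using close[OF that(1) u(1) that(2) u(2)] by simp
  have small_n: "\<exists>N. \<forall>n\<ge>N. K / real (Suc n) < \<epsilon>" if "\<epsilon> > 0" for \<epsilon>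
  proof -
    have "(\<lambda>n. K * (1 / real (Suc n))) \<longlonglongrightarrow> K * 0"
      by (intro tendsto_intros LIMSEQ_Suc lim_1_over_n)
    then have "\<forall>\<^sub>F n in sequentially. K * (1 / real (Suc n)) < \<epsilon>" using that by (intro order_tendstoD) auto
    then show ?thesis by (simp add: eventually_sequentially)
  qed
  have "Cauchy (\<lambda>n. c (u n))"
  proof (rule metric_CauchyI)
    fix \<epsilon> :: real assume "\<epsilon> > 0"
    then obtain N where N: "\<And>n. n \<ge> N \<Longrightarrow> K / real (Suc n) < \<epsilon> / 2" using small_n[of "\<epsilon> / 2"] by auto
    have "dist (c (u n)) (c (u N)) < \<epsilon> / 2" if "n \<ge> N" for n
    proof -
      have "1 / real (Suc n) \<le> 1 / real (Suc N)" using that by (intro divide_left_mono) auto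
      then have "\<tau> (c (u n)) < F + 1 / real (Suc N)" using u(2)[of n] by linarith
      then show ?thesis using close_u[OF u(1)] N[of N] by (meson le_less_trans order_refl)
    qed
    then show "\<exists>N. \<forall>m\<ge>N. \<forall>n\<ge>N. dist (c (u m)) (c (u n)) < \<epsilon>"
      using dist_triangle_half_l by (metis dist_commute)
  qed
  then obtain y where y: "(\<lambda>n. c (u n)) \<longlonglongrightarrow> y" using Cauchy_convergent convergent_def by blast
  have "y \<in> cball y0 (dist y0 (c 0) + K * (\<tau> (c 0) - l))"
  proof (rule closed_sequentially[OF closed_cball _ y])
    fix n
    have "dist (c 0) (c (u n)) \<le> K * (\<tau> (c 0) - l)"
    proof (cases "u n = 0")
      case True
      then show ?thesis using l K by (simp add: c_def)
    next
      case False
      then have "u n > 0" using u(1)[of n] by (simp add: half_open_def)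
      then have "dist (c 0) (c (u n)) \<le> K * (\<tau> (c 0) - \<tau> (c (u n)))"
        using prog(2)[OF zero u(1)] by (simp add: dist_norm norm_minus_commute)
      also have "\<dots> \<le> K * (\<tau> (c 0) - l)"
        using K above[OF u(1)[of n]] by (intro mult_left_mono) auto
      finally show ?thesis .
    qed
    then show "c (u n) \<in> cball y0 (dist y0 (c 0) + K * (\<tau> (c 0) - l))"
      using dist_triangle[of y0 "c (u n)" "c 0"] by simp
  qed
  then have y_ball: "y \<in> ball y0 r" using small by (simp add: c_def)
  have "((\<lambda>t. c (real_of_ereal t)) \<longlongrightarrow> y) (at_left a)"
  proof (rule tendstoI)
    fix \<epsilon> :: real assume "\<epsilon> > 0"
    then obtain N where N: "\<And>n. n \<ge> N \<Longrightarrow> K / real (Suc n) < \<epsilon> / 2" using small_n[of "\<epsilon> / 2"] by auto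
    have "\<forall>\<^sub>F n in sequentially. dist (c (u n)) y < \<epsilon> / 2"
      using y \<open>\<epsilon> > 0\<close> by (intro tendstoD) auto
    then have "\<forall>\<^sub>F n in sequentially. n \<ge> N \<and> dist (c (u n)) y < \<epsilon> / 2"
      using eventually_ge_at_top[of N] by eventually_elim simp
    then obtain n where n: "n \<ge> N" "dist (c (u n)) y < \<epsilon> / 2"
      using eventually_happens'[OF sequentially_bot] by blast
    show "\<forall>\<^sub>F t in at_left a. dist (c (real_of_ereal t)) y < \<epsilon>"
    proof (rule eventually_at_leftI)
      show "ereal (u n) < a" using u(1) by (simp add: half_open_def)
      fix t assume t: "t \<in> {ereal (u n)<..<a}"
      then obtain t' where t': "t = ereal t'" by (cases t) auto
      then have "t' \<in> half_open a" "u n < t'" using t u(1)[of n] by (auto simp: half_open_def)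
      then have "dist (c t') (c (u n)) < \<epsilon> / 2"
        using close_u[of t' n] prog(1)[OF u(1)[of n]] u(2)[of n] N[OF n(1)] by (meson le_less_trans less_trans)
      then show "dist (c (real_of_ereal t)) y < \<epsilon>"
        using n(2) dist_triangle_half_l[of "c t'" "c (u n)" \<epsilon> y] t' by (simp add: dist_commute)
    qed
  qed
  moreover have "isCont \<iota> y"
    using continuous_on_inv open_image r_sub y_ball continuous_on_eq_continuous_at by blast
  ultimately have "((\<lambda>t. \<iota> (c (real_of_ereal t))) \<longlongrightarrow> \<iota> y) (at_left a)"
    using isCont_tendsto_compose by blast
  moreover have "\<forall>\<^sub>F t in at_left a. \<iota> (c (real_of_ereal t)) = \<gamma> (real_of_ereal t)"
  proof (rule eventually_at_leftI[OF _ \<open>a > 0\<close>])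
    fix t assume t: "t \<in> {0<..<a}"
    then obtain t' where "t = ereal t'" by (cases t) auto
    then show "\<iota> (c (real_of_ereal t)) = \<gamma> (real_of_ereal t)"
      using t sub(2)[of t'] by (auto simp: half_open_def)
  qed
  ultimately have "((\<lambda>t. \<gamma> (real_of_ereal t)) \<longlongrightarrow> \<iota> y) (at_left a)"
    by (rule Lim_transform_eventually)
  moreover have "\<iota> y \<in> D" using y_ball r_sub inv_in_D by blast
  then have "\<iota> y \<in> points (open_submanifold M (\<iota> ` ball y0 r))"
    using y_ball D_subset_points by (auto simp: points_open_submanifold)
  ultimately show False using inext unfolding inextendable_def by blast
qed

text \<open>Project along \<open>e\<close> to the kernel of \<tau>. By \<open>graph\<close> the
  projection is injective on \<open>H\<close> near \<open>y0\<close>, which is a homeomorphic image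
  of an open piece of a hyperplane. Invariance of domain makes the projected set open in the kernel,
  so it contains the projections of all points near \<open>y0\<close>.\<close>

lemma hypersurface_meets_vertical_lines:
  assumes H: "topological_hypersurface M H" and y0: "\<iota> y0 \<in> H" and \<rho>: "0 < \<rho>" "\<rho> \<le> R"
    and graph: "\<And>y s. s > 0 \<Longrightarrow> y \<in> ball y0 R \<Longrightarrow> y + s *\<^sub>R e \<in> ball y0 R \<Longrightarrow>
      \<iota> y \<in> H \<Longrightarrow> \<iota> (y + s *\<^sub>R e) \<in> H \<Longrightarrow> False"
  obtains \<delta> where "\<delta> > 0" "\<forall>y\<in>ball y0 \<delta>. \<exists>s. y + s *\<^sub>R e \<in> ball y0 \<rho> \<and> \<iota> (y + s *\<^sub>R e) \<in> H"
proof -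
  obtain V W h h' a b where V: "open V" "\<iota> y0 \<in> V" "V \<subseteq> points M" and W: "open (W :: (real ^ 'n) set)"
    and hom: "homeomorphism V W h h'" and a: "a \<noteq> 0" and hVH: "h ` (V \<inter> H) = W \<inter> {x. a \<bullet> x = b}"
    using H y0 unfolding topological_hypersurface_def by blast
  have \<rho>_sub: "ball y0 \<rho> \<subseteq> \<phi> ` D" "ball y0 \<rho> \<subseteq> ball y0 R" using ball_subset \<rho> by auto
  define X where "X = V \<inter> \<iota> ` ball y0 \<rho>"
  have X: "open X" "X \<subseteq> V" unfolding X_def using V(1) open_inv_image[OF open_ball \<rho>_sub(1)] by auto
  have XH: "x \<in> D" "\<phi> x \<in> ball y0 \<rho>" "\<iota> (\<phi> x) = x" if "x \<in> X" for x
    using that \<rho>_sub(1) by (auto simp: X_def)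
  have h: "\<And>x. x \<in> V \<Longrightarrow> h' (h x) = x" "\<And>x. x \<in> V \<Longrightarrow> h x \<in> W" "continuous_on W h'"
    using hom by (auto simp: homeomorphism_def)
  define S where "S = h ` (X \<inter> H)"
  have "openin (top_of_set W) (h ` X)"
    using hom X by (intro homeomorphism_imp_open_map) (auto simp: openin_open)
  then have "open (h ` X)" using W openin_open_trans by blast
  \<comment> \<open>By injectivity of \<open>h\<close> on \<open>V\<close>, a point of
    \<open>X\<close> mapped into the hyperplane must belong to \<open>H\<close>.\<close>
  moreover have "S = {x. a \<bullet> x = b} \<inter> h ` X"
  proof -
    have "h x \<in> S" if "a \<bullet> h x = b" "x \<in> X" for x
    proof -
      have "h x \<in> h ` (V \<inter> H)" using that hVH h(2) X(2) by blast
      then obtain x' where "x' \<in> V \<inter> H" "h x = h x'" by blast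
      then have "x = x'" using h(1) that(2) X(2) by (metis IntD1 subsetD)
      then show ?thesis using \<open>x' \<in> V \<inter> H\<close> that(2) by (simp add: S_def)
    qed
    moreover have "S \<subseteq> {x. a \<bullet> x = b}" using hVH X(2) by (auto simp: S_def)
    ultimately show ?thesis by (auto simp: S_def)
  qed
  ultimately have S_open: "openin (top_of_set {x. a \<bullet> x = b}) S" by (auto simp: openin_open)
  define \<pi> where "\<pi> y = y - \<tau> y *\<^sub>R e" for y
  have \<pi>_cont: "continuous_on A \<pi>" for A
    unfolding \<pi>_def by (intro continuous_intros \<tau>.continuous_on)
  have \<pi>_ker: "\<tau> (\<pi> y) = 0" for y by (simp add: \<pi>_def \<tau>.diff \<tau>.scaleR \<tau>(2))
  have \<pi>_eq: "y' = y + (\<tau> y' - \<tau> y) *\<^sub>R e" if "\<pi> y = \<pi> y'" for y y'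
    using that by (simp add: \<pi>_def algebra_simps)
  have "openin (top_of_set {v. \<tau> v = 0}) ((\<lambda>x. \<pi> (\<phi> (h' x))) ` S)"
  proof (rule invariance_of_domain_affine_sets[OF S_open affine_hyperplane])
    \<comment> \<open>\<open>g\<close> represents \<tau> as an inner product and thereby exhibits
      the kernel as a hyperplane, of the same dimension as the one that flattens
      \<open>H\<close>.\<close>
    define g where "g = (\<Sum>i\<in>Basis. \<tau> i *\<^sub>R i)"
    have "\<tau> v = g \<bullet> v" for v
    proof -
      have "\<tau> v = \<tau> (\<Sum>i\<in>Basis. (v \<bullet> i) *\<^sub>R i)" by (simp add: euclidean_representation)
      also have "\<dots> = (\<Sum>i\<in>Basis. (v \<bullet> i) * \<tau> i)" by (simp add: \<tau>.sum \<tau>.scaleR)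
      also have "\<dots> = g \<bullet> v"
        unfolding g_def inner_sum_left by (intro sum.cong) (simp_all add: inner_commute)
      finally show ?thesis .
    qed
    moreover then have "g \<noteq> 0" using \<tau>(2) by auto
    ultimately show "affine {v. \<tau> v = 0}" "aff_dim {v. \<tau> v = 0} \<le> aff_dim {x. a \<bullet> x = b}"
      using a by (simp_all add: affine_hyperplane)
    have h'S: "h' ` S \<subseteq> X" using h(1) X(2) by (auto simp: S_def)
    have SW: "S \<subseteq> W" using h(2) X(2) by (auto simp: S_def)
    have "continuous_on S (\<lambda>x. \<phi> (h' x))"
      by (rule continuous_on_compose2[OF continuous_on_coord continuous_on_subset[OF h(3) SW]])
        (use h'S XH in blast)
    then show "continuous_on S (\<lambda>x. \<pi> (\<phi> (h' x)))"
      using continuous_on_compose2[OF \<pi>_cont] by blast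
    show "(\<lambda>x. \<pi> (\<phi> (h' x))) \<in> S \<rightarrow> {v. \<tau> v = 0}" using \<pi>_ker by simp
    show "inj_on (\<lambda>x. \<pi> (\<phi> (h' x))) S"
    proof (rule inj_onI)
      fix x1 x2 assume "x1 \<in> S" "x2 \<in> S" and eq: "\<pi> (\<phi> (h' x1)) = \<pi> (\<phi> (h' x2))"
      then obtain z1 z2 where z: "x1 = h z1" "x2 = h z2" "z1 \<in> X" "z2 \<in> X" "z1 \<in> H" "z2 \<in> H"
        by (auto simp: S_def)
      then have eq': "\<pi> (\<phi> z1) = \<pi> (\<phi> z2)" using eq h(1)[OF subsetD[OF X(2)]] by simp
      have no: "\<not> \<tau> (\<phi> x) < \<tau> (\<phi> x')"
        if "x \<in> X" "x' \<in> X" "x \<in> H" "x' \<in> H" "\<pi> (\<phi> x) = \<pi> (\<phi> x')" for x x'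
        using graph[of "\<tau> (\<phi> x') - \<tau> (\<phi> x)" "\<phi> x"] \<pi>_eq[OF that(5)] XH[OF that(1)] XH[OF that(2)] \<rho>(2) that(3,4)
        by auto
      have "\<tau> (\<phi> z1) = \<tau> (\<phi> z2)"
        using no[of z1 z2] no[of z2 z1] z eq' by auto
      then have "\<phi> z1 = \<phi> z2" using \<pi>_eq[OF eq'] by simp
      then have "z1 = z2" using XH(3) z by metis
      then show "x1 = x2" using z by simp
    qed
  qed
  then obtain T where T: "open T" "(\<lambda>x. \<pi> (\<phi> (h' x))) ` S = {v. \<tau> v = 0} \<inter> T"
    by (auto simp: openin_open)
  have "\<iota> y0 \<in> X" using V(2) \<rho>(1) by (auto simp: X_def)
  then have "\<pi> (\<phi> (h' (h (\<iota> y0)))) \<in> (\<lambda>x. \<pi> (\<phi> (h' x))) ` S" using y0 by (auto simp: S_def)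
  moreover have "y0 \<in> \<phi> ` D" using ball_subset R centre_in_ball by blast
  ultimately have "\<pi> y0 \<in> T" using T(2) h(1)[OF V(2)] by auto
  moreover have "open (\<pi> -` T)" using \<pi>_cont[of UNIV] T(1) open_vimage continuous_on_open_vimage by blast
  ultimately obtain \<delta> where \<delta>: "\<delta> > 0" "ball y0 \<delta> \<subseteq> \<pi> -` T" by (meson openE vimageI)
  have "\<exists>s. y + s *\<^sub>R e \<in> ball y0 \<rho> \<and> \<iota> (y + s *\<^sub>R e) \<in> H" if "y \<in> ball y0 \<delta>" for y
  proof -
    have "\<pi> y \<in> (\<lambda>x. \<pi> (\<phi> (h' x))) ` S" using that \<delta> T(2) \<pi>_ker by auto
    then obtain z where z: "z \<in> X" "z \<in> H" "\<pi> y = \<pi> (\<phi> z)" using h(1) X(2) by (auto simp: S_def)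
    then show ?thesis using \<pi>_eq[OF z(3)] XH[OF z(1)] by (metis (no_types))
  qed
  then show thesis using that \<delta>(1) by blast
qed

end

section \<open>Restricting and concatenating curves\<close>

text \<open>A curve that leaves \<open>U\<close> is cut at its first parameter outside
  \<open>U\<close>, which exists by compactness. By continuity the only possible endpoint of the cut
  curve is \<open>\<gamma> b\<close>, which is not in \<open>U\<close>.\<close>

lemma inextendable_restrict:
  fixes M :: "('a::t2_space, 'n::finite) lorentz"
  assumes cont: "continuous_on (half_open a) \<gamma>" and "a > 0" and "open U" "\<gamma> 0 \<in> U"
    and inext: "inextendable M a \<gamma>"
  obtains b where "0 < b" "b \<le> a" "\<gamma> ` half_open b \<subseteq> U" "inextendable (open_submanifold M U) b \<gamma>"
proof (cases "\<gamma> ` half_open a \<subseteq> U")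
  case True
  moreover have "inextendable (open_submanifold M U) a \<gamma>"
    using inext by (auto simp: inextendable_def points_open_submanifold)
  ultimately show thesis using that \<open>a > 0\<close> by blast
next
  case False
  then obtain t0 where t0: "t0 \<in> half_open a" "\<gamma> t0 \<notin> U" by blast
  have ivl: "{0..t0} \<subseteq> half_open a" using half_open_downward[OF t0(1)] by auto
  have cont0: "continuous_on {0..t0} \<gamma>" using cont ivl by (rule continuous_on_subset)
  have "closed ({0..t0} \<inter> \<gamma> -` (- U))"
    using cont0 \<open>open U\<close> by (intro continuous_closed_preimage) auto
  then have "compact ({0..t0} \<inter> \<gamma> -` (- U))"
    using compact_Icc[of 0 t0] by (metis compact_Int_closed inf.left_idem)
  moreover have "t0 \<in> {0..t0} \<inter> \<gamma> -` (- U)" using t0 by (auto simp: half_open_def)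
  ultimately have "\<exists>b\<in>{0..t0} \<inter> \<gamma> -` (- U). \<forall>t\<in>{0..t0} \<inter> \<gamma> -` (- U). b \<le> t"
    using compact_attains_inf by blast
  then obtain b where b: "b \<in> {0..t0}" "\<gamma> b \<notin> U"
    and least: "\<And>t. t \<in> {0..t0} \<Longrightarrow> \<gamma> t \<notin> U \<Longrightarrow> b \<le> t"
    by auto
  have "b > 0" using b \<open>\<gamma> 0 \<in> U\<close> by (auto simp: le_less)
  have "\<gamma> ` half_open (ereal b) \<subseteq> U"
    using least b(1) by (force simp: half_open_def)
  moreover have "ereal b \<le> a" using b(1) ivl by (auto simp: half_open_def intro: less_imp_le)
  moreover have "inextendable (open_submanifold M U) (ereal b) \<gamma>"
    unfolding inextendable_def
  proof
    assume "\<exists>q\<in>points (open_submanifold M U). ((\<lambda>t. \<gamma> (real_of_ereal t)) \<longlongrightarrow> q) (at_left (ereal b))"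
    then obtain q where q: "q \<in> U" "((\<lambda>t. \<gamma> (real_of_ereal t)) \<longlongrightarrow> q) (at_left (ereal b))"
      by (auto simp: points_open_submanifold)
    then have lim: "(\<gamma> \<longlongrightarrow> q) (at_left b)"
      using ereal_tendsto_simps1(1)[of \<gamma> q b] by (simp add: comp_def)
    have "continuous_on {0..b} \<gamma>" using cont0 b(1) by (auto intro: continuous_on_subset)
    then have "(\<gamma> \<longlongrightarrow> \<gamma> b) (at b within {0..b})"
      using \<open>b > 0\<close> by (auto simp: continuous_on_def)
    then have "(\<gamma> \<longlongrightarrow> \<gamma> b) (at_left b)" using at_within_Icc_at_left[OF \<open>b > 0\<close>] by simp
    then have "q = \<gamma> b" using lim tendsto_unique trivial_limit_at_left_real by blast
    then show False using q(1) b(2) by simp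
  qed
  ultimately show thesis using that[of "ereal b"] \<open>b > 0\<close> by simp
qed

lemma smooth_curve_cong:
  assumes "\<And>t. t \<in> I \<Longrightarrow> \<gamma> t = \<gamma>' t" "smooth_curve M I \<gamma>"
  shows "smooth_curve M I \<gamma>'"
  unfolding smooth_curve_def
proof (intro conjI ballI, goal_cases)
  case 1
  then show ?case using assms unfolding smooth_curve_def by (simp add: image_subset_iff)
next
  case (2 t c)
  obtain D \<phi> where c: "c = (D, \<phi>)" by force
  show ?case unfolding c prod.case
  proof
    assume "\<gamma>' t \<in> D"
    moreover have "(D, \<phi>) \<in> atlas M" using 2 c by simp
    ultimately obtain e \<eta> where *: "e > 0" "smooth_on {t - e<..<t + e} \<eta>"
      "\<And>s. s \<in> I \<Longrightarrow> s \<in> {t - e<..<t + e} \<Longrightarrow> \<gamma> s \<in> D \<and> \<phi> (\<gamma> s) = \<eta> s"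
      using smooth_curve_extension[OF assms(2) _ 2(1)] assms(1)[OF 2(1)] by metis
    then have "\<forall>s\<in>I \<inter> {t - e<..<t + e}. \<gamma>' s \<in> D \<and> \<phi> (\<gamma>' s) = \<eta> s"
      using assms(1) by fastforce
    then show "\<exists>e>0. \<exists>\<eta>. smooth_on {t - e<..<t + e} \<eta> \<and>
        (\<forall>s\<in>I \<inter> {t - e<..<t + e}. \<gamma>' s \<in> D \<and> \<phi> (\<gamma>' s) = \<eta> s)"
      using * by blast
  qed
qed

lemma velocity_cong:
  assumes "\<And>t. t \<in> I \<Longrightarrow> \<gamma> t = \<gamma>' t" "t \<in> I"
  shows "velocity \<phi> I \<gamma> t = velocity \<phi> I \<gamma>' t"
proof -
  have "((\<phi> \<circ> \<gamma>) has_vector_derivative v) (at t within I) \<longleftrightarrow> ((\<phi> \<circ> \<gamma>') has_vector_derivative v) (at t within I)" for v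
    by (rule iffI; erule has_vector_derivative_transform[OF assms(2), rotated]) (simp_all add: assms(1))
  then show ?thesis by (simp add: velocity_def vector_derivative_def)
qed

lemma velocities_satisfy_cong:
  assumes "\<And>t. t \<in> I \<Longrightarrow> \<gamma> t = \<gamma>' t" "velocities_satisfy M Q I \<gamma>"
  shows "velocities_satisfy M Q I \<gamma>'"
  unfolding velocities_satisfy_def
proof (intro ballI, clarify)
  fix t D \<phi> assume "t \<in> I" "(D, \<phi>) \<in> atlas M" "\<gamma>' t \<in> D"
  then show "Q \<phi> (\<gamma>' t) (velocity \<phi> I \<gamma>' t)"
    using assms(2) assms(1)[of t] velocity_cong[of I \<gamma> \<gamma>' t \<phi>, OF assms(1)]
    unfolding velocities_satisfy_def by fastforce
qed

section \<open>Prepending a vertical segment to a curve\<close>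

context cone_chart
begin

text \<open>Joins a point above the horizon to a generator: a segment in direction
  \<open>- e\<close>, run in unit time, ends at \<open>\<iota> y\<close>, where \<gamma> is meant to
  start.\<close>

definition descend :: "real ^ 'n \<Rightarrow> real \<Rightarrow> (real \<Rightarrow> 'a) \<Rightarrow> real \<Rightarrow> 'a" where
  "descend y s \<gamma> t = (if t \<le> 1 then \<iota> (y + (s * (1 - t)) *\<^sub>R e) else \<gamma> (t - 1))"

lemma half_open_plus_one: "b > 0 \<Longrightarrow> t \<in> half_open (b + 1) \<longleftrightarrow> 0 \<le> t \<and> (t \<le> 1 \<or> t - 1 \<in> half_open b)"
  by (cases b) (auto simp: half_open_def one_ereal_def zero_ereal_def)

lemma past_causal_curve_descend:
  assumes \<gamma>: "smooth_curve M I \<gamma>" "continuous_on I \<gamma>"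
    "velocities_satisfy M (\<lambda>\<phi> x v. causal_vec M \<phi> x v \<and> past_vec M \<phi> x v) I \<gamma>"
    and b: "half_open b \<subseteq> I" "b > 0" and \<gamma>0: "\<gamma> 0 = \<iota> y" and "s > 0"
    and y: "y \<in> ball y0 R" "y + s *\<^sub>R e \<in> ball y0 R"
  shows "past_causal_curve M (b + 1) (descend y s \<gamma>)"
proof -
  let ?P = "\<lambda>\<phi> x v. causal_vec M \<phi> x v \<and> past_vec M \<phi> x v"
  \<comment> \<open>On the segment the timelike predicate is used, since
    \<open>vec_transition\<close> gives its independence of the chart; causality is read off
    afterwards.\<close>
  let ?Q = "\<lambda>\<phi> x v. timelike_vec M \<phi> x v \<and> past_vec M \<phi> x v"
  let ?c = "\<lambda>t. y + (s * (1 - t)) *\<^sub>R e"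
  have c_ball: "?c t \<in> ball y0 R" if "t \<in> {0..1}" for t
  proof -
    have "?c t = t *\<^sub>R y + (1 - t) *\<^sub>R (y + s *\<^sub>R e)" by (simp add: algebra_simps)
    then show ?thesis using convexD[OF convex_ball y, of t "1 - t"] that by simp
  qed
  have cD: "?c ` {0..1} \<subseteq> \<phi> ` D" using c_ball ball_subset by blast
  have cont: "continuous_on (half_open (b + 1)) (descend y s \<gamma>)"
    unfolding descend_def[abs_def]
  proof (rule continuous_on_cases_le)
    have "continuous_on {0..1} (\<lambda>t. \<iota> (?c t))"
      by (rule continuous_on_compose2[OF continuous_on_inv _ cD]) (intro continuous_intros)
    then show "continuous_on {t \<in> half_open (b + 1). t \<le> 1} (\<lambda>t. \<iota> (?c t))"
      by (rule continuous_on_subset) (auto simp: half_open_def)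
    have "t - 1 \<in> half_open b" if "t \<in> half_open (b + 1)" "1 \<le> t" for t
    proof (cases "t = 1")
      case True
      then show ?thesis using \<open>b > 0\<close> by (simp add: half_open_def zero_ereal_def)
    next
      case False
      then show ?thesis using that half_open_plus_one[OF \<open>b > 0\<close>, of t] by auto
    qed
    then show "continuous_on {t \<in> half_open (b + 1). 1 \<le> t} (\<lambda>t. \<gamma> (t - 1))"
      using b(1) by (intro continuous_on_compose2[OF \<gamma>(2)] continuous_intros) auto
  qed (use \<gamma>0 in \<open>auto intro: continuous_intros\<close>)
  have pieces: "smooth_curve M {r..t} (descend y s \<gamma>) \<and> velocities_satisfy M ?P {r..t} (descend y s \<gamma>)"
    if rt: "r \<in> half_open (b + 1)" "t \<in> half_open (b + 1)" "r < t" "{1} \<inter> {r<..<t} = {}" for r t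
  proof (cases "t \<le> 1")
    case True
    have sub: "{r..t} \<subseteq> {0..1}" using True rt(1) by (auto simp: half_open_def)
    have im: "?c ` {r..t} \<subseteq> \<phi> ` D" using cD sub by blast
    have eq: "?c = (\<lambda>t. (y + s *\<^sub>R e) + t *\<^sub>R (- s *\<^sub>R e))" by (auto simp: algebra_simps)
    have "smooth_curve M {r..t} (\<lambda>t. \<iota> (?c t))"
      by (rule smooth_curve_inv[OF _ im]) (unfold eq, rule locally_smooth_line)
    moreover have "velocities_satisfy M ?Q {r..t} (\<lambda>t. \<iota> (?c t))"
    proof (rule velocities_satisfy_inv[OF im \<open>r < t\<close>])
      fix u assume u: "u \<in> {r..t}"
      have "timelike_vec M \<phi> (\<iota> (?c u)) e \<and> future_vec M \<phi> (\<iota> (?c u)) e"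
        using narrow_cone[OF c_ball, of u e] u sub \<kappa> by auto
      then have "?Q \<phi> (\<iota> (?c u)) (- s *\<^sub>R e)"
        using \<open>s > 0\<close> by (simp only: vec_iff_gram matrix_vector_mult_scaleR inner_scaleR_left inner_scaleR_right)
          (simp add: mult_less_0_iff zero_less_mult_iff)
      moreover have "(?c has_vector_derivative - s *\<^sub>R e) (at u within {r..t})"
        unfolding eq by (auto intro!: derivative_eq_intros)
      ultimately show "\<exists>v. (?c has_vector_derivative v) (at u within {r..t}) \<and> ?Q \<phi> (\<iota> (?c u)) v" by blast
    qed (use vec_transition in auto)
    then have "velocities_satisfy M ?P {r..t} (\<lambda>t. \<iota> (?c t))"
      by (auto simp: velocities_satisfy_def causal_vec_def)
    moreover have "\<iota> (?c u) = descend y s \<gamma> u" if "u \<in> {r..t}" for u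
      using that True by (simp add: descend_def)
    ultimately show ?thesis
      using smooth_curve_cong velocities_satisfy_cong by (metis (no_types, lifting))
  next
    case False
    then have "1 \<le> r" using rt(4) by auto
    have sub: "{r - 1..t - 1} \<subseteq> I"
      using b(1) half_open_downward[of "t - 1" b] rt(2) \<open>1 \<le> r\<close> False \<open>b > 0\<close> by (auto simp: half_open_plus_one)
    have sm: "smooth_curve M {r - 1..t - 1} \<gamma>" "velocities_satisfy M ?P {r - 1..t - 1} \<gamma>"
      using smooth_curve_subset[OF \<gamma>(1) sub] velocities_satisfy_subinterval[OF \<gamma>(1,3) sub] rt(3) by auto
    have "smooth_curve M {r..t} (\<lambda>u. \<gamma> (u - 1))" "velocities_satisfy M ?P {r..t} (\<lambda>u. \<gamma> (u - 1))"
      using smooth_curve_shift[OF sm(1), of 1] velocities_satisfy_shift[OF sm, of 1] rt(3) by simp_all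
    moreover have "\<gamma> (u - 1) = descend y s \<gamma> u" if "u \<in> {r..t}" for u
      using that \<open>1 \<le> r\<close> \<gamma>0 by (cases "u = 1") (auto simp: descend_def)
    ultimately show ?thesis
      using smooth_curve_cong velocities_satisfy_cong by (metis (no_types, lifting))
  qed
  have "descend y s \<gamma> ` half_open (b + 1) \<subseteq> points M"
  proof
    fix x assume "x \<in> descend y s \<gamma> ` half_open (b + 1)"
    then obtain t where t: "t \<in> half_open (b + 1)" "x = descend y s \<gamma> t" by blast
    show "x \<in> points M"
    proof (cases "t \<le> 1")
      case True
      then have "t \<in> {0..1}" using t by (simp add: half_open_def)
      then have "?c t \<in> \<phi> ` D" using cD by blast
      then show ?thesis using True t D_subset_points inv_in_D by (auto simp: descend_def)
    next
      case False
      then show ?thesis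
        using t \<gamma>(1) b by (auto simp: descend_def half_open_plus_one smooth_curve_def)
    qed
  qed
  then show ?thesis
    using cont pieces unfolding past_causal_curve_def piecewise_curve_def
    by (intro conjI exI[of _ "{1}"] ballI) auto
qed

text \<open>Used in contrapositive form: a prefix of unit duration does not affect the far end, so
  inextendability survives the concatenation. Finite and infinite \<open>b\<close> call for shifting
  different filters.\<close>

lemma tendsto_descend:
  assumes "b > 0" and lim: "((\<lambda>t. descend y s \<gamma> (real_of_ereal t)) \<longlongrightarrow> q) (at_left (b + 1))"
  shows "((\<lambda>t. \<gamma> (real_of_ereal t)) \<longlongrightarrow> q) (at_left b)"
proof (cases b)
  case (real r)
  have "(descend y s \<gamma> \<longlongrightarrow> q) (at_left (r + 1))"
    using lim ereal_tendsto_simps1(1)[of "descend y s \<gamma>" q "r + 1"] real by (simp add: comp_def one_ereal_def)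
  moreover have "filterlim (\<lambda>t. t + 1) (at_left (r + 1)) (at_left r)"
    unfolding filterlim_at by (auto simp: eventually_at_filter intro!: tendsto_eq_intros always_eventually)
  ultimately have "((\<lambda>t. descend y s \<gamma> (t + 1)) \<longlongrightarrow> q) (at_left r)" by (rule filterlim_compose)
  moreover have "\<forall>\<^sub>F t in at_left r. descend y s \<gamma> (t + 1) = \<gamma> t"
    by (rule eventually_at_leftI[of 0]) (use real assms(1) in \<open>auto simp: descend_def\<close>)
  ultimately have "(\<gamma> \<longlongrightarrow> q) (at_left r)" by (rule Lim_transform_eventually)
  then show ?thesis using ereal_tendsto_simps1(1)[of \<gamma> q r] real by (simp add: comp_def)
next
  case PInf
  have "(descend y s \<gamma> \<longlongrightarrow> q) at_top"
    using lim ereal_tendsto_simps1(3)[of "descend y s \<gamma>" q] PInf by (simp add: comp_def)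
  moreover have "filterlim (\<lambda>t::real. t + 1) at_top at_top"
    by (rule filterlim_at_top_mono[OF filterlim_ident]) (auto intro: always_eventually)
  ultimately have "((\<lambda>t. descend y s \<gamma> (t + 1)) \<longlongrightarrow> q) at_top" by (rule filterlim_compose)
  moreover have "\<forall>\<^sub>F t in at_top. descend y s \<gamma> (t + 1) = \<gamma> t"
    using eventually_gt_at_top[of 0] by eventually_elim (simp add: descend_def)
  ultimately have "(\<gamma> \<longlongrightarrow> q) at_top" by (rule Lim_transform_eventually)
  then show ?thesis using ereal_tendsto_simps1(3)[of \<gamma> q] PInf by (simp add: comp_def)
qed (use assms(1) in auto)

end

text \<open>\<open>smooth_curve\<close> keeps the curve in the chart domain near each parameter, so
  the local extension followed by the inverse coordinate map recovers continuity in the manifold.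
  The generators of the horizon are given as smooth curves only.\<close>

lemma smooth_curve_continuous:
  assumes M: "time_oriented_lorentz_manifold M" and "smooth_curve M I \<gamma>"
  shows "continuous_on I \<gamma>"
  unfolding continuous_on_eq_continuous_within
proof
  fix t assume t: "t \<in> I"
  then have "\<gamma> t \<in> points M" using assms(2) by (auto simp: smooth_curve_def)
  then obtain E \<psi> where E: "(E, \<psi>) \<in> atlas M" "\<gamma> t \<in> E" by (auto simp: points_def)
  then interpret lorentz_chart M E \<psi> using M by unfold_locales
  obtain e \<eta> where e: "e > 0" and \<eta>: "smooth_on {t - e<..<t + e} \<eta>"
    and eq: "\<And>s. s \<in> I \<Longrightarrow> s \<in> {t - e<..<t + e} \<Longrightarrow> \<gamma> s \<in> E \<and> \<psi> (\<gamma> s) = \<eta> s"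
    by (rule smooth_curve_extension[OF assms(2) E(1) t E(2)]) blast
  have "(\<eta> \<longlongrightarrow> \<eta> t) (at t within I)"
    using smooth_on_differentiable[OF \<eta>, of t] e differentiable_imp_continuous_within[of \<eta> t UNIV]
    by (auto simp: continuous_within intro: tendsto_within_subset)
  moreover have \<eta>t: "\<eta> t = \<psi> (\<gamma> t)" using eq[OF t] e by simp
  moreover have "isCont \<iota> (\<psi> (\<gamma> t))"
    using continuous_on_inv open_image E(2) continuous_on_eq_continuous_at by blast
  ultimately have "((\<lambda>s. \<iota> (\<eta> s)) \<longlongrightarrow> \<gamma> t) (at t within I)"
    using isCont_tendsto_compose[of "\<eta> t" \<iota> \<eta>] E(2) by simp
  moreover have "\<forall>\<^sub>F s in at t within I. \<iota> (\<eta> s) = \<gamma> s"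
    unfolding eventually_at
  proof (intro exI[of _ e] conjI ballI impI e)
    fix s assume "s \<in> I" "s \<noteq> t \<and> dist s t < e"
    then show "\<iota> (\<eta> s) = \<gamma> s" using eq[of s] by (metis abs_diff_less_iff dist_real_def greaterThanLessThan_iff inv_coord)
  qed
  ultimately show "continuous (at t within I) \<gamma>"
    unfolding continuous_within by (rule Lim_transform_eventually)
qed

text \<open>As \<open>U\<close> is open, relative neighbourhoods may be taken open in the ambient
  space. In this form being a frontier point is refuted by one neighbourhood that lies in
  \<open>A\<close> or misses it.\<close>

lemma frontier_of_open_subset:
  assumes "open U" "x \<in> U"
  shows "x \<in> top_of_set U frontier_of A \<longleftrightarrow>
    (\<forall>T. open T \<longrightarrow> T \<subseteq> U \<longrightarrow> x \<in> T \<longrightarrow> T \<inter> A \<noteq> {} \<and> \<not> T \<subseteq> A)"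
  using assms unfolding frontier_of_def
  by (auto simp: in_closure_of interior_of_def openin_open_eq)

section \<open>Coordinate balls as submanifolds\<close>

context lorentz_chart
begin

lemma diffeomorphic_coordinate_ball:
  assumes "0 < r" and ball: "ball y0 r \<subseteq> \<phi> ` D"
  shows "diffeomorphic_to_open_ball (open_submanifold M (\<iota> ` ball y0 r))"
proof -
  define U where "U = \<iota> ` ball y0 r"
  define A where "A y = - y0 /\<^sub>R r + y /\<^sub>R r" for y :: "real ^ 'n"
  define A' where "A' y = y0 + r *\<^sub>R y" for y :: "real ^ 'n"
  have inv: "A (A' y) = y" "A' (A y) = y" for y
    using \<open>0 < r\<close> by (simp_all add: A_def A'_def algebra_simps)
  have dist_A': "dist y0 (A' y) = r * norm y" for y using \<open>0 < r\<close> by (simp add: A'_def dist_norm)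
  have A'_ball: "A' y \<in> ball y0 r \<longleftrightarrow> y \<in> ball 0 1" for y
    using \<open>0 < r\<close> by (simp add: dist_A')
  have U: "open U" "U \<subseteq> D" "\<phi> ` U = ball y0 r"
    using open_inv_image[OF open_ball ball] ball by (auto simp: U_def image_image subset_eq)
  have smooth_A: "smooth_on X A" "smooth_on X A'" for X
    unfolding A_def A'_def by (intro smooth_on_affine bounded_linear_scaleR_right)+
  have "points (open_submanifold M U) = U"
    using U(2) D_subset_points by (auto simp: points_open_submanifold)
  moreover have "homeomorphism U (ball 0 1) (\<lambda>x. A (\<phi> x)) (\<lambda>y. \<iota> (A' y))"
  proof (rule homeomorphismI)
    show "continuous_on U (\<lambda>x. A (\<phi> x))"
      using continuous_on_compose2[OF smooth_on_imp_continuous_on[OF smooth_A(1)[of UNIV]]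
          continuous_on_subset[OF continuous_on_coord U(2)]] by simp
    show "continuous_on (ball 0 1) (\<lambda>y. \<iota> (A' y))"
      using A'_ball ball
      by (intro continuous_on_compose2[OF continuous_on_inv smooth_on_imp_continuous_on[OF smooth_A(2)]]) blast
    show "(\<lambda>x. A (\<phi> x)) ` U \<subseteq> ball 0 1"
    proof (rule image_subsetI)
      fix x assume "x \<in> U"
      then have "\<phi> x \<in> ball y0 r" using U(3) by blast
      then show "A (\<phi> x) \<in> ball 0 1" using A'_ball[of "A (\<phi> x)"] inv(2)[of "\<phi> x"] by simp
    qed
    show "(\<lambda>y. \<iota> (A' y)) ` ball 0 1 \<subseteq> U" using A'_ball by (auto simp: U_def simp del: mem_ball)
    show "\<iota> (A' (A (\<phi> x))) = x" if "x \<in> U" for x using that U(2) inv by auto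
    show "A (\<phi> (\<iota> (A' y))) = y" if "y \<in> ball 0 1" for y
    proof -
      have "A' y \<in> \<phi> ` D" using that A'_ball ball by blast
      then show ?thesis using inv by simp
    qed
  qed
  moreover have "smooth_on (\<psi> ` (E \<inter> U)) ((\<lambda>x. A (\<phi> x)) \<circ> inv_into (E \<inter> U) \<psi>)"
    and "smooth_on ((\<lambda>x. A (\<phi> x)) ` (E \<inter> U)) (\<psi> \<circ> (\<lambda>y. \<iota> (A' y)))" if E: "(E, \<psi>) \<in> atlas M" for E \<psi>
  proof -
    interpret E: lorentz_chart M E \<psi> using E manifold by unfold_locales
    have "smooth_on (\<psi> ` (E \<inter> U)) (\<lambda>y. \<phi> (E.\<iota> y))"
      by (rule smooth_on_subset[OF E.smooth_transition[OF chart]]) (use U(2) in blast)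
    then have sm: "smooth_on (\<psi> ` (E \<inter> U)) (\<lambda>y. A (\<phi> (E.\<iota> y)))"
      by (intro smooth_on_compose[OF E.open_coord_image[OF U(1)] subset_UNIV smooth_A(1)])
    \<comment> \<open>The submanifold inverts \<psi> on the smaller domain
      \<open>E \<inter> U\<close>; the two inverses are compared on the image of that domain
      only.\<close>
    have inv_eq: "E.\<iota> y = inv_into (E \<inter> U) \<psi> y" if "y \<in> \<psi> ` (E \<inter> U)" for y
    proof -
      obtain x where x: "x \<in> E \<inter> U" "y = \<psi> x" using \<open>y \<in> \<psi> ` (E \<inter> U)\<close> by blast
      have "inj_on \<psi> (E \<inter> U)" by (rule inj_on_inverseI[of _ E.\<iota>]) simp
      then show ?thesis using x by (simp add: inv_into_f_f)
    qed
    show "smooth_on (\<psi> ` (E \<inter> U)) ((\<lambda>x. A (\<phi> x)) \<circ> inv_into (E \<inter> U) \<psi>)"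
      by (rule smooth_on_cong[OF E.open_coord_image[OF U(1)] _ sm]) (simp add: inv_eq)
    have "open (A' -` (\<phi> ` (D \<inter> E)))"
      using open_coord_image[OF E.open_D] smooth_on_imp_continuous_on[OF smooth_A(2)[of UNIV]]
      by (rule open_vimage)
    then have "smooth_on (A' -` (\<phi> ` (D \<inter> E))) (\<lambda>y. \<psi> (\<iota> (A' y)))"
      by (rule smooth_on_compose[OF _ _ smooth_transition[OF E] smooth_A(2)]) blast
    moreover have "(\<lambda>x. A (\<phi> x)) ` (E \<inter> U) \<subseteq> A' -` (\<phi> ` (D \<inter> E))" using U(2) inv by auto
    ultimately show "smooth_on ((\<lambda>x. A (\<phi> x)) ` (E \<inter> U)) (\<psi> \<circ> (\<lambda>y. \<iota> (A' y)))"
      unfolding comp_def by (rule smooth_on_subset)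
  qed
  ultimately show ?thesis
    unfolding diffeomorphic_to_open_ball_def U_def[symmetric]
    by (intro exI[of _ "\<lambda>x. A (\<phi> x)"] exI[of _ "\<lambda>y. \<iota> (A' y)"]) (auto simp: open_submanifold_def)
qed

end

section \<open>Horizons as local Cauchy horizons\<close>

context cone_chart
begin

text \<open>The same bound on the perturbation \<open>w\<close> serves all \<open>t\<close> from
  \<sigma> upwards. This uniformity later shows that the side of \<open>H\<close> on which a point
  lies is locally constant.\<close>

lemma narrow_cone_perturb:
  assumes "\<sigma> > 0"
  obtains d where "d > 0" "\<forall>w t. norm w < d \<longrightarrow> \<sigma> \<le> t \<longrightarrow> \<tau> (w + t *\<^sub>R e) > 0 \<and>
    norm (w + t *\<^sub>R e - \<tau> (w + t *\<^sub>R e) *\<^sub>R e) < \<kappa> * \<tau> (w + t *\<^sub>R e)"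
proof -
  obtain B where B: "B > 0" "\<And>x. norm (\<tau> x) \<le> norm x * B" using \<tau>.pos_bounded by blast
  \<comment> \<open>\<open>C\<close> collects the losses per unit of \<open>norm w\<close>: the
    length of \<open>w\<close>, that of its multiple of \<open>e\<close>, and the decrease of the
    right-hand side caused by \<open>\<tau> w\<close>.\<close>
  define C where "C = 1 + B * norm e + \<kappa> * B"
  have C: "C > 0" using B(1) \<kappa> by (simp add: C_def add_pos_nonneg)
  define d where "d = min (\<sigma> / B) (\<kappa> * \<sigma> / C)"
  have "\<tau> (w + t *\<^sub>R e) > 0 \<and> norm (w + t *\<^sub>R e - \<tau> (w + t *\<^sub>R e) *\<^sub>R e) < \<kappa> * \<tau> (w + t *\<^sub>R e)"
    if w: "norm w < d" and t: "\<sigma> \<le> t" for w t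
  proof -
    have eq: "\<tau> (w + t *\<^sub>R e) = \<tau> w + t" by (simp add: \<tau>.add \<tau>.scaleR \<tau>(2))
    have \<tau>w: "\<bar>\<tau> w\<bar> \<le> norm w * B" using B(2)[of w] by simp
    have "norm w * B < \<sigma>" "norm w * C < \<kappa> * \<sigma>"
      using w B(1) C by (simp_all add: d_def pos_less_divide_eq)
    then have "\<tau> w + t > 0" using \<tau>w t by linarith
    moreover have "norm (w + t *\<^sub>R e - (\<tau> w + t) *\<^sub>R e) < \<kappa> * (\<tau> w + t)"
    proof -
      have "norm (w + t *\<^sub>R e - (\<tau> w + t) *\<^sub>R e) = norm (w - \<tau> w *\<^sub>R e)" by (simp add: algebra_simps)
      also have "\<dots> \<le> norm w + \<bar>\<tau> w\<bar> * norm e" using norm_triangle_ineq4[of w "\<tau> w *\<^sub>R e"] by simp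
      also have "\<dots> \<le> norm w + norm w * B * norm e"
        using mult_right_mono[OF \<tau>w, of "norm e"] by simp
      also have "\<dots> = norm w * C - \<kappa> * (norm w * B)" by (simp add: C_def algebra_simps)
      also have "\<dots> < \<kappa> * \<sigma> - \<kappa> * (norm w * B)" using \<open>norm w * C < \<kappa> * \<sigma>\<close> by simp
      also have "\<dots> = \<kappa> * (\<sigma> - norm w * B)" by (simp add: algebra_simps)
      also have "\<dots> \<le> \<kappa> * (\<tau> w + t)" using \<kappa> \<tau>w t by (intro mult_left_mono) auto
      finally show ?thesis .
    qed
    ultimately show ?thesis by (simp add: eq)
  qed
  moreover have "d > 0" using assms B(1) C \<kappa> by (simp add: d_def)
  ultimately show thesis using that by blast
qed

text \<open>The radii nest as \<open>\<delta> \<le> \<rho> < r < R\<close>: the horizons are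
  compared within \<delta>, vertical lines from there meet \<open>H\<close> within \<rho>, the
  submanifold \<open>U\<close> has radius \<open>r\<close>, and the push-up takes place within
  \<open>R\<close>.\<close>

lemma cauchy_horizon_neighbourhood:
  assumes horizon: "horizon M H" and y0H: "\<iota> y0 \<in> H"
  shows "\<exists>U S Up. open U \<and> \<iota> y0 \<in> U \<and> U \<subseteq> points M \<and>
           diffeomorphic_to_open_ball (open_submanifold M U) \<and>
           S \<subseteq> U \<and> achronal (open_submanifold M U) S \<and>
           open Up \<and> \<iota> y0 \<in> Up \<and> Up \<subseteq> U \<and>
           H \<inter> Up = future_cauchy_horizon (open_submanifold M U) S \<inter> Up"
proof -
  have hyp: "topological_hypersurface M H" and achronal: "\<And>x x'. x \<in> H \<Longrightarrow> x' \<in> H \<Longrightarrow> \<not> chronological M x x'"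
    using horizon by (auto simp: horizon_def achronal_def)
  have cone: False if "y \<in> ball y0 R" "y + v \<in> ball y0 R" "\<tau> v > 0" "norm (v - \<tau> v *\<^sub>R e) < \<kappa> * \<tau> v"
    "\<iota> y \<in> H" "\<iota> (y + v) \<in> H" for y v
    using chronological_segment[OF that(1-4)] achronal that(5,6) by blast
  have graph: False if "s > 0" "y \<in> ball y0 R" "y + s *\<^sub>R e \<in> ball y0 R" "\<iota> y \<in> H" "\<iota> (y + s *\<^sub>R e) \<in> H" for y s
    using cone[OF that(2,3) _ _ that(4,5)] that(1) \<kappa> by (simp add: \<tau>.scaleR \<tau>(2))
  have meets: "\<exists>\<delta>>0. \<forall>y\<in>ball y0 \<delta>. \<exists>s. y + s *\<^sub>R e \<in> ball y0 \<rho> \<and> \<iota> (y + s *\<^sub>R e) \<in> H"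
    if \<rho>: "0 < \<rho>" "\<rho> \<le> R" for \<rho>
  proof (rule hypersurface_meets_vertical_lines[OF hyp y0H \<rho>])
    show False if "s > 0" "y \<in> ball y0 R" "y + s *\<^sub>R e \<in> ball y0 R" "\<iota> y \<in> H" "\<iota> (y + s *\<^sub>R e) \<in> H" for y s
      using that by (rule graph)
  qed blast
  obtain \<delta>1 where \<delta>1: "\<delta>1 > 0" "\<forall>y\<in>ball y0 \<delta>1. \<exists>s. y + s *\<^sub>R e \<in> ball y0 (R / 2) \<and> \<iota> (y + s *\<^sub>R e) \<in> H"
    using meets[of "R / 2"] R by (auto simp del: mem_ball)
  \<comment> \<open>\<open>push_up\<close> accepts curves within \<open>R / 4\<close> and displaced
    ends within \<open>R / 2\<close>; by the choice of \<open>\<delta>1\<close> the vertical line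
    through any point of \<open>U\<close> meets \<open>H\<close> within the latter radius.\<close>
  define r where "r = min \<delta>1 (R / 4)"
  have r: "0 < r" "r \<le> \<delta>1" "r \<le> R / 4" using \<delta>1 R by (simp_all add: r_def)
  then have "r \<le> R" using R by simp
  define U where "U = \<iota> ` ball y0 r"
  define N where "N = open_submanifold M U"
  have ballD: "ball y0 r \<subseteq> \<phi> ` D" "ball y0 r \<subseteq> ball y0 R" using ball_subset \<open>r \<le> R\<close> by auto
  have U: "open U" "U \<subseteq> D" using open_inv_image[OF open_ball ballD(1)] ballD by (auto simp: U_def)
  have pointsN: "points N = U"
    using U(2) D_subset_points by (auto simp: N_def points_open_submanifold)
  obtain B where B: "B > 0" "\<And>x. norm (\<tau> x) \<le> norm x * B" using \<tau>.pos_bounded by blast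
  \<comment> \<open>A curve that starts within \<open>r / 4\<close> and drops by less than
    \<open>2 * \<epsilon>\<close> in \<tau> has a displacement of at most
    \<open>2 * K * \<epsilon> = r / 2\<close>, so it stays within \<open>r\<close> until it reaches
    the level \<open>l\<close>.\<close>
  define \<epsilon> where "\<epsilon> = r / (4 * K)"
  have \<epsilon>: "\<epsilon> > 0" "K * \<epsilon> = r / 4" using r K by (simp_all add: \<epsilon>_def)
  define l where "l = \<tau> y0 - \<epsilon>"
  \<comment> \<open>The bound \<open>\<epsilon> / B\<close> keeps \<tau> above \<open>l\<close> on
    the ball of radius \<rho>, which therefore misses \<open>S\<close>.\<close>
  define \<rho> where "\<rho> = min (r / 4) (\<epsilon> / B)"
  have \<rho>: "\<rho> > 0" "\<rho> \<le> r / 4" "\<rho> \<le> \<epsilon> / B"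
    using r(1) \<epsilon>(1) B(1) min.cobounded1[of "r / 4" "\<epsilon> / B"] min.cobounded2[of "r / 4" "\<epsilon> / B"]
    unfolding \<rho>_def by (simp_all del: min_le_iff_disj)
  have \<rho>_level: "\<bar>\<tau> y - \<tau> y0\<bar> < \<epsilon>" if "y \<in> ball y0 \<rho>" for y
  proof -
    have "norm (y - y0) < \<epsilon> / B" using that \<rho>(3) by (simp add: dist_norm norm_minus_commute)
    then have "norm (y - y0) * B < \<epsilon>" using B(1) by (simp add: pos_less_divide_eq)
    then show ?thesis using B(2)[of "y - y0"] by (simp add: \<tau>.diff)
  qed
  have \<rho>_sub: "ball y0 \<rho> \<subseteq> ball y0 r" using \<rho>(2) r(1) by auto
  obtain \<delta>2 where \<delta>2: "\<delta>2 > 0" "\<forall>y\<in>ball y0 \<delta>2. \<exists>s. y + s *\<^sub>R e \<in> ball y0 \<rho> \<and> \<iota> (y + s *\<^sub>R e) \<in> H"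
    using meets[of \<rho>] \<rho> r by (auto simp del: mem_ball)
  define \<delta> where "\<delta> = min \<delta>2 \<rho>"
  have \<delta>: "\<delta> > 0" "ball y0 \<delta> \<subseteq> ball y0 \<rho>" "ball y0 \<delta> \<subseteq> ball y0 \<delta>2"
    using \<delta>2 \<rho> by (auto simp: \<delta>_def)
  have \<delta>_r: "ball y0 \<delta> \<subseteq> ball y0 r" "ball y0 \<delta> \<subseteq> ball y0 R" using \<delta>(2) \<rho>_sub ballD(2) by blast+
  define Up where "Up = \<iota> ` ball y0 \<delta>"
  \<comment> \<open>The point of \<open>H\<close> above \<open>x\<close> is sought in the larger
    ball of radius \<open>R / 2\<close>, as the vertical line need not meet \<open>H\<close> inside
    \<open>U\<close>.\<close>
  define S where "S = {x \<in> U. \<tau> (\<phi> x) = l \<and>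
    (\<exists>s>0. \<phi> x + s *\<^sub>R e \<in> ball y0 (R / 2) \<and> \<iota> (\<phi> x + s *\<^sub>R e) \<in> H)}"
  define A where "A = future_cauchy_development N S"
  have coord: "\<phi> (\<iota> y) = y" if "y \<in> ball y0 r" for y using that ballD by auto
  have S_level: "x \<notin> S" if "\<phi> x \<in> ball y0 \<rho>" for x
    using \<rho>_level[OF that] by (auto simp: S_def l_def)
  have S_H: "x \<notin> S" if "x \<in> H" "x \<in> U" for x
  proof
    assume "x \<in> S"
    then obtain s where s: "s > 0" "\<phi> x + s *\<^sub>R e \<in> ball y0 (R / 2)" "\<iota> (\<phi> x + s *\<^sub>R e) \<in> H"
      by (auto simp: S_def)
    have "\<phi> x \<in> ball y0 R" "\<iota> (\<phi> x) = x" using that(2) coord ballD(2) U(2) by (auto simp: U_def)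
    then show False using graph[OF s(1), of "\<phi> x"] s(2,3) that(1) R by simp
  qed

  have below: "\<iota> z \<in> A" if z: "z \<in> ball y0 \<delta>" and s: "s > 0" "z + s *\<^sub>R e \<in> ball y0 \<rho>" "\<iota> (z + s *\<^sub>R e) \<in> H" for z s
    unfolding A_def future_cauchy_development_def
  proof (intro CollectI conjI allI impI)
    show "\<iota> z \<in> points N" using z \<delta>_r by (auto simp: pointsN U_def)
    fix a :: ereal and \<gamma> assume "a > 0" and "past_causal_curve N a \<gamma> \<and> inextendable N a \<gamma> \<and> \<gamma> 0 = \<iota> z"
    then have \<gamma>: "past_causal_curve N a \<gamma>" "inextendable N a \<gamma>" "\<gamma> 0 = \<iota> z" by auto
    have z': "z \<in> ball y0 \<rho>" "z \<in> ball y0 r" using z \<delta>(2) \<delta>_r by blast+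
    have \<phi>0: "\<phi> (\<gamma> 0) = z" using \<gamma>(3) coord[OF z'(2)] by simp
    have \<tau>z: "\<bar>\<tau> z - \<tau> y0\<bar> < \<epsilon>" by (rule \<rho>_level[OF z'(1)])
    obtain u where u: "u \<in> half_open a" "u > 0" "\<tau> (\<phi> (\<gamma> u)) = l"
    proof (rule reaches_level[OF \<gamma>(1,2)[unfolded N_def U_def] \<open>a > 0\<close> \<open>r \<le> R\<close>])
      show "l < \<tau> (\<phi> (\<gamma> 0))" using \<tau>z by (auto simp: \<phi>0 l_def)
      have "dist y0 z < r / 4" using z'(1) \<rho>(2) by simp
      moreover have "K * (\<tau> z - l) \<le> K * (2 * \<epsilon>)" using \<tau>z K by (intro mult_left_mono) (auto simp: l_def)
      ultimately show "dist y0 (\<phi> (\<gamma> 0)) + K * (\<tau> (\<phi> (\<gamma> 0)) - l) < r" using \<epsilon>(2) r(1) \<phi>0 by simp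
    qed blast
    have im: "\<gamma> ` half_open a \<subseteq> U"
      using \<gamma>(1) pointsN by (auto simp: past_causal_curve_def piecewise_curve_def)
    then have \<gamma>M: "past_causal_curve M a \<gamma>"
      using \<gamma>(1) unfolding past_causal_curve_def N_def
      by (simp add: piecewise_curve_open_submanifold is_interval_half_open)
    have im4: "\<gamma> ` half_open a \<subseteq> \<iota> ` ball y0 (R / 4)" using im r(3) by (fastforce simp: U_def)
    have "\<gamma> u \<in> U" using im u(1) by blast
    then have "\<phi> (\<gamma> u) \<in> ball y0 r" using coord by (auto simp: U_def)
    then have "\<phi> (\<gamma> u) \<in> ball y0 \<delta>1" using r(2) by simp
    then obtain s1 where s1: "\<phi> (\<gamma> u) + s1 *\<^sub>R e \<in> ball y0 (R / 2)" "\<iota> (\<phi> (\<gamma> u) + s1 *\<^sub>R e) \<in> H"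
      using \<delta>1(2) by blast
    \<comment> \<open>The signs fit \<open>push_up\<close>: the start is lifted by
      \<open>s > 0\<close> onto \<open>H\<close>, and for \<open>s1 \<le> 0\<close> the end is
      lowered onto \<open>H\<close>.\<close>
    have "s1 > 0"
    proof (rule ccontr)
      assume "\<not> s1 > 0"
      moreover have "z + s *\<^sub>R e \<in> ball y0 (R / 2)" using s(2) \<rho>(2) r(1,3) by simp
      ultimately have "chronological M (\<iota> (\<phi> (\<gamma> u) + s1 *\<^sub>R e)) (\<iota> (\<phi> (\<gamma> 0) + s *\<^sub>R e))"
        using push_up[OF \<gamma>M im4 u(1,2) _ s(1) _ s1(1)] by (simp add: \<phi>0)
      then show False using achronal[OF s1(2) s(3)] by (simp add: \<phi>0)
    qed
    then have "\<gamma> u \<in> S" using \<open>\<gamma> u \<in> U\<close> u(3) s1 by (auto simp: S_def)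
    then show "\<gamma> ` half_open a \<inter> S \<noteq> {}" using u(1) by blast
  qed

  have above: "\<iota> z \<notin> A" if z: "z \<in> ball y0 \<delta>" and s: "s < 0" "z + s *\<^sub>R e \<in> ball y0 \<rho>" "\<iota> (z + s *\<^sub>R e) \<in> H" for z s
  proof -
    define y where "y = z + s *\<^sub>R e"
    have y: "y \<in> ball y0 \<rho>" "\<iota> y \<in> H" "y + (- s) *\<^sub>R e = z" using s by (simp_all add: y_def)
    have z': "z \<in> ball y0 \<rho>" using z \<delta>(2) by blast
    obtain a \<gamma> where "a > 0" and geo: "geodesic M (half_open a) \<gamma>"
      and vel: "velocities_satisfy M (\<lambda>\<phi> x v. lightlike_vec M \<phi> x v \<and> past_vec M \<phi> x v) (half_open a) \<gamma>"
      and inext: "inextendable M a \<gamma>" and \<gamma>H: "\<gamma> ` half_open a \<subseteq> H" and \<gamma>0: "\<gamma> 0 = \<iota> y"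
      using horizon y(2) unfolding horizon_def by blast
    let ?P = "\<lambda>\<phi> x v. causal_vec M \<phi> x v \<and> past_vec M \<phi> x v"
    have sm: "smooth_curve M (half_open a) \<gamma>" using geo by (simp add: geodesic_def)
    have vel: "velocities_satisfy M ?P (half_open a) \<gamma>"
      using vel by (auto simp: velocities_satisfy_def causal_vec_def)
    have cont: "continuous_on (half_open a) \<gamma>" using smooth_curve_continuous[OF manifold sm] .
    have "\<gamma> 0 \<in> U" using y(1) \<rho>_sub \<gamma>0 by (auto simp: U_def)
    \<comment> \<open>The generator is inextendable in \<open>M\<close> but may leave
      \<open>U\<close>; cutting it at the first exit makes it inextendable in
      \<open>U\<close>.\<close>
    then obtain b where b: "0 < b" "b \<le> a" "\<gamma> ` half_open b \<subseteq> U" "inextendable N b \<gamma>"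
      using inextendable_restrict[OF cont \<open>a > 0\<close> U(1) _ inext] unfolding N_def by metis
    have sub: "half_open b \<subseteq> half_open a" using b(2) by (auto simp: half_open_def)
    define \<sigma> where "\<sigma> = descend y (- s) \<gamma>"
    have \<sigma>M: "past_causal_curve M (b + 1) \<sigma>"
      unfolding \<sigma>_def
    proof (rule past_causal_curve_descend[OF sm cont vel sub b(1) \<gamma>0])
      show "y \<in> ball y0 R" "y + (- s) *\<^sub>R e \<in> ball y0 R"
        using y z' \<rho>_sub ballD(2) by blast+
    qed (use s in simp)
    \<comment> \<open>The vertical part avoids \<open>S\<close> because it stays within \<rho>,
      above the level of \<open>S\<close>; the generator avoids it because \<open>S\<close> and
      \<open>H\<close> are disjoint.\<close>
    have \<sigma>: "\<sigma> t \<in> U \<and> \<sigma> t \<notin> S" if t: "t \<in> half_open (b + 1)" for t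
    proof (cases "t \<le> 1")
      case True
      define w where "w = y + (- s * (1 - t)) *\<^sub>R e"
      have "w = t *\<^sub>R y + (1 - t) *\<^sub>R z"
        unfolding y(3)[symmetric] w_def by (simp add: algebra_simps)
      moreover have "0 \<le> t" using t by (simp add: half_open_def)
      ultimately have w: "w \<in> ball y0 \<rho>" using convexD[OF convex_ball y(1) z', of t "1 - t"] True by simp
      moreover have "\<sigma> t = \<iota> w" using True by (simp add: \<sigma>_def descend_def w_def)
      moreover have "w \<in> ball y0 r" using w \<rho>_sub by blast
      ultimately show ?thesis using S_level[of "\<sigma> t"] coord by (auto simp: U_def simp del: mem_ball)
    next
      case False
      then have "t - 1 \<in> half_open b" "\<sigma> t = \<gamma> (t - 1)"
        using t half_open_plus_one[OF b(1)] by (auto simp: \<sigma>_def descend_def)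
      then show ?thesis using S_H[of "\<sigma> t"] b(3) \<gamma>H sub by auto
    qed
    have "past_causal_curve N (b + 1) \<sigma>"
      using \<sigma>M \<sigma> unfolding past_causal_curve_def N_def
      by (subst open_submanifold_vec_simps)+ (simp add: piecewise_curve_open_submanifold is_interval_half_open image_subset_iff)
    moreover have "inextendable N (b + 1) \<sigma>"
      using b(4) tendsto_descend[OF b(1)] unfolding inextendable_def \<sigma>_def by blast
    moreover have "\<sigma> 0 = \<iota> z" using y(3) by (simp add: \<sigma>_def descend_def)
    moreover have "b + 1 > 0" using b(1) by (simp add: add_pos_pos)
    moreover have "\<sigma> ` half_open (b + 1) \<inter> S = {}" using \<sigma> by blast
    ultimately show ?thesis unfolding A_def future_cauchy_development_def by blast
  qed

  have open_ball_U: "open (\<iota> ` W)" "\<iota> ` W \<subseteq> U" if "open W" "W \<subseteq> ball y0 r" for W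
    using open_inv_image[OF that(1)] that(2) ballD by (auto simp: U_def)
  have nbhd_sub: "\<exists>d>0. ball z d \<subseteq> ball y0 \<delta> \<and> \<iota> ` ball z d \<subseteq> T"
    if T: "open T" "\<iota> z \<in> T" and z: "z \<in> ball y0 \<delta>" for T z
  proof -
    have "open (ball y0 \<delta> \<inter> \<iota> -` T)"
      using continuous_on_subset[OF continuous_on_inv] \<delta>_r ballD
      by (intro continuous_open_preimage[OF _ open_ball T(1)]) blast
    then show ?thesis using T z by (metis IntI image_subset_iff_subset_vimage inf.boundedE openE vimageI)
  qed
  have vertical: "z + t *\<^sub>R e \<in> ball z d" if "\<bar>t\<bar> * norm e < d" for z t d
    using that by (simp add: dist_norm)
  have small_t: "\<exists>t>0. \<bar>t\<bar> * norm e < d" if "d > 0" for d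
  proof -
    have "e \<noteq> 0" using \<tau>(2) \<tau>.zero by force
    then show ?thesis using that by (intro exI[of _ "d / (2 * norm e)"]) simp
  qed

  have frontier: "\<iota> z \<in> H \<longleftrightarrow> \<iota> z \<in> top_of_set U frontier_of A" if z: "z \<in> ball y0 \<delta>" for z
  proof -
    have zU: "\<iota> z \<in> U" using z \<delta>_r by (auto simp: U_def)
    obtain s where s: "z + s *\<^sub>R e \<in> ball y0 \<rho>" "\<iota> (z + s *\<^sub>R e) \<in> H" using \<delta>2(2) \<delta>(3) z by blast
    have \<rho>R: "ball y0 \<rho> \<subseteq> ball y0 R" using \<rho>_sub ballD(2) by blast
    show ?thesis
    proof
      assume zH: "\<iota> z \<in> H"
      show "\<iota> z \<in> top_of_set U frontier_of A"
        unfolding frontier_of_open_subset[OF U(1) zU]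
      proof (intro allI impI)
        fix T assume T: "open T" "T \<subseteq> U" "\<iota> z \<in> T"
        obtain d where d: "d > 0" "ball z d \<subseteq> ball y0 \<delta>" "\<iota> ` ball z d \<subseteq> T"
          using nbhd_sub[OF T(1,3) z] by blast
        obtain t where t: "t > 0" "\<bar>t\<bar> * norm e < d" using small_t[OF d(1)] by blast
        have z\<rho>: "z \<in> ball y0 \<rho>" using z \<delta>(2) by blast
        \<comment> \<open>The vertical line through both test points meets \<open>H\<close> in
          \<open>z\<close> itself, at height \<open>t\<close> over the lower one and
          \<open>- t\<close> over the upper one, so \<open>below\<close> and \<open>above\<close>
          apply.\<close>
        have tv: "z + (- t) *\<^sub>R e \<in> ball z d" "z + t *\<^sub>R e \<in> ball z d"
          using vertical[of "- t" d z] vertical[of t d z] t by simp_all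
        have "\<iota> (z + (- t) *\<^sub>R e) \<in> A"
          by (rule below[OF subsetD[OF d(2) tv(1)] t(1)]) (use z\<rho> zH in simp_all)
        moreover have "\<iota> (z + t *\<^sub>R e) \<notin> A"
          by (rule above[OF subsetD[OF d(2) tv(2)], of "- t"]) (use t z\<rho> zH in simp_all)
        ultimately show "T \<inter> A \<noteq> {} \<and> \<not> T \<subseteq> A" using tv d(3) by blast
      qed
    next
      assume fr: "\<iota> z \<in> top_of_set U frontier_of A"
      \<comment> \<open>\<open>s\<close> is the signed height of \<open>H\<close> over
        \<open>z\<close>. If it is nonzero, its sign is shared by all nearby points, and a
        neighbourhood of \<open>z\<close> lies in \<open>A\<close> or misses it.\<close>
      have s0: "s = 0"
      proof (rule ccontr)
        assume "s \<noteq> 0"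
        then have "\<bar>s\<bar> > 0" by simp
        then obtain d0 where d0: "d0 > 0" and perturb: "\<forall>w t. norm w < d0 \<longrightarrow> \<bar>s\<bar> \<le> t \<longrightarrow> \<tau> (w + t *\<^sub>R e) > 0 \<and>
          norm (w + t *\<^sub>R e - \<tau> (w + t *\<^sub>R e) *\<^sub>R e) < \<kappa> * \<tau> (w + t *\<^sub>R e)"
          using narrow_cone_perturb[of "\<bar>s\<bar>"] by blast
        have "z \<in> ball y0 \<delta> \<inter> ball z d0" "open (ball y0 \<delta> \<inter> ball z d0)" using z d0 by auto
        then obtain d where d: "d > 0" "ball z d \<subseteq> ball y0 \<delta> \<inter> ball z d0" by (meson openE)
        define T where "T = \<iota> ` ball z d"
        have T: "open T" "T \<subseteq> U" "\<iota> z \<in> T"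
          using open_ball_U[OF open_ball, of z d] d \<delta>_r by (auto simp: T_def)
        have same_side: "\<exists>s'. z' + s' *\<^sub>R e \<in> ball y0 \<rho> \<and> \<iota> (z' + s' *\<^sub>R e) \<in> H \<and> s * s' > 0"
          if z': "z' \<in> ball z d" for z'
        proof -
          have "z' \<in> ball y0 \<delta>" "z' \<in> ball z d0" using z' d(2) by blast+
          then have "norm (z - z') < d0" "norm (z' - z) < d0"
            by (simp_all add: dist_norm norm_minus_commute)
          obtain s' where s': "z' + s' *\<^sub>R e \<in> ball y0 \<rho>" "\<iota> (z' + s' *\<^sub>R e) \<in> H"
            using \<delta>2(2) \<delta>(3) \<open>z' \<in> ball y0 \<delta>\<close> by blast
          have "s' > 0" if "s > 0"
          proof (rule ccontr)
            assume "\<not> s' > 0"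
            \<comment> \<open>\<open>v\<close> joins two points of \<open>H\<close>. With
              \<open>s' \<le> 0\<close> its vertical part is at least \<open>s\<close>, and its
              remaining part is shorter than \<open>d0\<close>, so \<open>v\<close> lies in the
              narrow cone, against achronality.\<close>
            define v where "v = (z - z') + (s - s') *\<^sub>R e"
            have eq: "(z' + s' *\<^sub>R e) + v = z + s *\<^sub>R e" by (simp add: v_def algebra_simps)
            have "\<tau> v > 0 \<and> norm (v - \<tau> v *\<^sub>R e) < \<kappa> * \<tau> v"
              unfolding v_def using perturb \<open>norm (z - z') < d0\<close> \<open>\<not> s' > 0\<close> that by simp
            then show False
              using cone[of "z' + s' *\<^sub>R e" v] s s' \<rho>R unfolding eq by blast
          qed
          moreover have "s' < 0" if "s < 0"
          proof (rule ccontr)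
            assume "\<not> s' < 0"
            define v where "v = (z' - z) + (s' - s) *\<^sub>R e"
            have eq: "(z + s *\<^sub>R e) + v = z' + s' *\<^sub>R e" by (simp add: v_def algebra_simps)
            have "\<tau> v > 0 \<and> norm (v - \<tau> v *\<^sub>R e) < \<kappa> * \<tau> v"
              unfolding v_def using perturb \<open>norm (z' - z) < d0\<close> \<open>\<not> s' < 0\<close> that by simp
            then show False
              using cone[of "z + s *\<^sub>R e" v] s s' \<rho>R unfolding eq by blast
          qed
          ultimately have "s * s' > 0"
            using \<open>s \<noteq> 0\<close> by (cases s "0::real" rule: linorder_cases) (simp_all add: mult_neg_neg)
          then show ?thesis using s' by blast
        qed
        have "T \<subseteq> A \<or> T \<inter> A = {}"
        proof (cases "s > 0")
          case True
          have "\<iota> z' \<in> A" if z': "z' \<in> ball z d" for z'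
          proof -
            obtain s' where "z' + s' *\<^sub>R e \<in> ball y0 \<rho>" "\<iota> (z' + s' *\<^sub>R e) \<in> H" "s' > 0"
              using same_side[OF z'] True by (auto simp: zero_less_mult_iff)
            then show ?thesis using below d(2) z' by blast
          qed
          then show ?thesis by (auto simp: T_def)
        next
          case False
          have "\<iota> z' \<notin> A" if z': "z' \<in> ball z d" for z'
          proof -
            obtain s' where "z' + s' *\<^sub>R e \<in> ball y0 \<rho>" "\<iota> (z' + s' *\<^sub>R e) \<in> H" "s' < 0"
              using same_side[OF z'] False by (auto simp: zero_less_mult_iff)
            then show ?thesis using above d(2) z' by blast
          qed
          then show ?thesis by (auto simp: T_def)
        qed
        then show False using fr T unfolding frontier_of_open_subset[OF U(1) zU] by blast
      qed
      then show "\<iota> z \<in> H" using s by simp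
    qed
  qed
  have closure: "\<iota> z \<notin> top_of_set U closure_of S" if z: "z \<in> ball y0 \<delta>" for z
  proof -
    have "x \<notin> S" if x: "x \<in> Up" for x
    proof -
      obtain y where y: "y \<in> ball y0 \<delta>" "x = \<iota> y" using x unfolding Up_def by blast
      then have "y \<in> ball y0 \<rho>" "y \<in> ball y0 r" using \<delta>(2) \<delta>_r by blast+
      then show ?thesis using S_level[of x] coord y(2) by simp
    qed
    moreover have "openin (top_of_set U) Up"
      using open_ball_U[OF open_ball \<delta>_r(1)] U(1) by (simp add: openin_open_eq Up_def)
    moreover have "\<iota> z \<in> Up" using z by (simp add: Up_def)
    ultimately show ?thesis unfolding in_closure_of by blast
  qed
  have "achronal N S"
    unfolding achronal_def
  proof (intro conjI ballI)
    show "S \<subseteq> points N" by (auto simp: pointsN S_def)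
    fix x x' assume "x \<in> S" "x' \<in> S"
    then show "\<not> chronological N x x'"
      using chronological_progress[OF _ \<open>r \<le> R\<close>, of x x'] by (auto simp: S_def N_def U_def)
  qed
  moreover have "H \<inter> Up = future_cauchy_horizon N S \<inter> Up"
    using frontier closure unfolding future_cauchy_horizon_def pointsN A_def Up_def by blast
  moreover have "diffeomorphic_to_open_ball N"
    unfolding N_def U_def by (rule diffeomorphic_coordinate_ball[OF r(1) ballD(1)])
  moreover have "open Up" "Up \<subseteq> U" "\<iota> y0 \<in> Up" "U \<subseteq> points M" "S \<subseteq> U"
    using open_ball_U[OF open_ball \<delta>_r(1)] \<delta>(1) U(2) D_subset_points by (auto simp: Up_def S_def)
  ultimately show ?thesis using U(1) unfolding N_def by blast
qed

end

theorem lemma8: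
  fixes M :: "('a::{t2_space, second_countable_topology}, 'n::finite) lorentz"
    and H :: "'a set" and p :: 'a
  assumes "time_oriented_lorentz_manifold M" and "horizon M H" and "p \<in> H"
  shows "\<exists>U S Up. open U \<and> p \<in> U \<and> U \<subseteq> points M \<and>
           diffeomorphic_to_open_ball (open_submanifold M U) \<and>
           S \<subseteq> U \<and> achronal (open_submanifold M U) S \<and>
           open Up \<and> p \<in> Up \<and> Up \<subseteq> U \<and>
           H \<inter> Up = future_cauchy_horizon (open_submanifold M U) S \<inter> Up"
proof -
  have "p \<in> points M"
    using assms(2,3) by (auto simp: horizon_def topological_hypersurface_def)
  then obtain D \<phi> where D: "(D, \<phi>) \<in> atlas M" "p \<in> D" by (auto simp: points_def)
  interpret lorentz_chart M D \<phi> using assms(1) D(1) by unfold_locales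
  obtain R \<tau> e K \<kappa> m where "cone_chart M D \<phi> (\<phi> p) R \<tau> e K \<kappa> m"
    using cone_chart_exists[of "\<phi> p"] D(2) by blast
  then interpret cone_chart M D \<phi> "\<phi> p" R \<tau> e K \<kappa> m .
  show ?thesis using cauchy_horizon_neighbourhood[OF assms(2)] assms(3) D(2) by simp
qed

end
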